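(* For every finite or infinite sequence $Z$ of distinct points in the upper half-plane, $$M(Z)\le e\, c_J(Z).$$ The inequality is best possible in the sense that the constant $e$ on the right-hand side cannot be replaced by any smaller number; that is, for every real number $C<e$ there exists a sequence $Z$ of distinct points in the upper half-plane with $M(Z)> C\, c_J(Z)$.
   Context: Let $\mathbb{H}=\{z\in\mathbb{C}:\operatorname{Im} z>0\}$, let $H^\infty$ be the space of bounded analytic functions on $\mathbb{H}$ with the supremum norm $\|\cdot\|_\infty$, and let $H^1$ be the usual Hardy space of the upper half-plane. Let $Z=(z_j)$, $j=1,2,\ldots$, be a finite or infinite (nonempty) sequence of distinct points $z_j=x_j+iy_j\in\mathbb{H}$. Constant of interpolation. $Z$ is an interpolating sequence if for each bounded sequence $(w_j)$ of complex numbers there is $f\in H^\infty$ with $f(z_j)=w_j$ for all $j$. If $Z$ is interpolating, $M(Z)$ is the smallest constant $C<\infty$ such that for every bounded sequence $(w_j)$ the problem $f(z_j)=w_j$ for all $j$ can be solved with $f\in H^\infty$ satisfying $\|f\|_\infty\le C\|(w_j)\|_\infty$, where $\|(w_j)\|_\infty=\sup_j|w_j|$. If $Z$ is not interpolating, $M(Z)=+\infty$. Blaschke factors. Let $B$ be the Blaschke product with zeros $Z$ and $B_j(z)=\frac{z-\overline{z_j}}{z-z_j}B(z)$, so that $$|B_j(z_j)|=\prod_{k\ne j}\left|\frac{z_j-z_k}{z_j-\overline{z_k}}\right|\in[0,1]$$ (empty product equal to $1$). The quantity $|B_j(z_j)|$ is understood as this product for every $Z$, with the convention $1/0=+\infty$.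 The characteristic $c_J(Z)$. Let $g$ be an analytic function on $\mathbb{H}$ with $g(i)=1$ and $(z+i)^{-2}g(z)\in H^1$ (equivalently, $|g|$ has a harmonic majorant on $\mathbb{H}$). Let $u$ be the least harmonic majorant of $|g|$ on $\mathbb{H}$, and put $u_j(z)=u((z-x_j)/y_j)$ and $$U_k(z)=\sum_{j:\,y_j\le y_k}\frac{u_j(z)}{|B_j(z_j)|}.$$ Call $g$ admissible if each $U_k$ defines a (finite) harmonic function on $\mathbb{H}$. For admissible $g$ set $c_J(Z,g)=\sup_j U_j(z_j)\in[0,+\infty]$. Finally $c_J(Z)=\inf_g c_J(Z,g)$, the infimum being over all admissible $g$ (and equal to $+\infty$ if there are none). *)

theory Defs
  imports "HOL-Complex_Analysis.Complex_Analysis" "HOL-Library.Extended_Nat"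
begin

definition uhp :: "complex set" where
  "uhp = {z. Im z > 0}"

(* A finite or infinite sequence (z j) is a function on the naturals together with its length
   N in {1, 2, ..., \<infinity>}; only the values at the indices j < N matter. *)

definition seq_index :: "enat \<Rightarrow> nat set" where
  "seq_index N = {j. enat j < N}"

definition uhp_seq :: "enat \<Rightarrow> (nat \<Rightarrow> complex) \<Rightarrow> bool" where
  "uhp_seq N z \<longleftrightarrow> 0 < N \<and> inj_on z (seq_index N) \<and> z ` seq_index N \<subseteq> uhp"

definition Hinf :: "(complex \<Rightarrow> complex) set" where
  "Hinf = {f. f holomorphic_on uhp \<and> bounded (f ` uhp)}"

definition Hinf_norm :: "(complex \<Rightarrow> complex) \<Rightarrow> real" where
  "Hinf_norm f = (SUP z\<in>uhp. norm (f z))"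

definition H1 :: "(complex \<Rightarrow> complex) set" where
  "H1 = {F. F holomorphic_on uhp \<and>
    (SUP y\<in>{0<..}. \<integral>\<^sup>+ x. ennreal (norm (F (Complex x y))) \<partial>lborel) < \<infinity>}"

definition interpolates :: "enat \<Rightarrow> (nat \<Rightarrow> complex) \<Rightarrow> (nat \<Rightarrow> complex) \<Rightarrow> (complex \<Rightarrow> complex) \<Rightarrow> bool" where
  "interpolates N z w f \<longleftrightarrow> f \<in> Hinf \<and> (\<forall>j\<in>seq_index N. f (z j) = w j)"

definition bounded_data :: "enat \<Rightarrow> (nat \<Rightarrow> complex) \<Rightarrow> bool" where
  "bounded_data N w \<longleftrightarrow> bounded (w ` seq_index N)"

definition data_norm :: "enat \<Rightarrow> (nat \<Rightarrow> complex) \<Rightarrow> real" where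
  "data_norm N w = (SUP j\<in>seq_index N. norm (w j))"

definition interpolating :: "enat \<Rightarrow> (nat \<Rightarrow> complex) \<Rightarrow> bool" where
  "interpolating N z \<longleftrightarrow> (\<forall>w. bounded_data N w \<longrightarrow> (\<exists>f. interpolates N z w f))"

definition interp_const :: "enat \<Rightarrow> (nat \<Rightarrow> complex) \<Rightarrow> ereal" where
  "interp_const N z =
    (if interpolating N z
     then Inf {ereal C | C::real. \<forall>w. bounded_data N w \<longrightarrow>
            (\<exists>f. interpolates N z w f \<and> Hinf_norm f \<le> C * data_norm N w)}
     else \<infinity>)"

(* |B_j(z_j)|. The partial products decrease, so the limit exists; it is taken directly because
   prodinf does not treat infinite products that tend to 0 as convergent. *)

definition blaschke_at :: "enat \<Rightarrow> (nat \<Rightarrow> complex) \<Rightarrow> nat \<Rightarrow> real" where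
  "blaschke_at N z j =
    lim (\<lambda>n. \<Prod>k\<in>{k \<in> seq_index N. k < n \<and> k \<noteq> j}. norm ((z j - z k) / (z j - cnj (z k))))"

(* Twice continuously differentiable with vanishing Laplacian: p, q are the first partial
   derivatives of u, and pxx, pxy, qyx, qyy the partial derivatives of p and q. *)

definition harmonic_on :: "(complex \<Rightarrow> real) \<Rightarrow> complex set \<Rightarrow> bool" where
  "harmonic_on u S \<longleftrightarrow>
    (\<exists>p q pxx pxy qyx qyy :: complex \<Rightarrow> real.
      (\<forall>z\<in>S. (u has_derivative (\<lambda>h. p z * Re h + q z * Im h)) (at z) \<and>
             (p has_derivative (\<lambda>h. pxx z * Re h + pxy z * Im h)) (at z) \<and>
             (q has_derivative (\<lambda>h. qyx z * Re h + qyy z * Im h)) (at z) \<and>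
             pxx z + qyy z = 0) \<and>
      continuous_on S pxx \<and> continuous_on S pxy \<and>
      continuous_on S qyx \<and> continuous_on S qyy)"

definition harmonic_majorant :: "(complex \<Rightarrow> real) \<Rightarrow> (complex \<Rightarrow> real) \<Rightarrow> bool" where
  "harmonic_majorant u \<phi> \<longleftrightarrow> harmonic_on u uhp \<and> (\<forall>z\<in>uhp. \<phi> z \<le> u z)"

definition least_harmonic_majorant :: "(complex \<Rightarrow> real) \<Rightarrow> (complex \<Rightarrow> real) \<Rightarrow> bool" where
  "least_harmonic_majorant u \<phi> \<longleftrightarrow>
    harmonic_majorant u \<phi> \<and> (\<forall>v. harmonic_majorant v \<phi> \<longrightarrow> (\<forall>z\<in>uhp. u z \<le> v z))"

(* The quotient is taken in ereal, where a / 0 = \<infinity> for a > 0. *)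

definition U_sum ::
    "enat \<Rightarrow> (nat \<Rightarrow> complex) \<Rightarrow> (complex \<Rightarrow> real) \<Rightarrow> nat \<Rightarrow> complex \<Rightarrow> ereal" where
  "U_sum N z u k \<zeta> =
    (\<Sum>\<^sub>\<infinity>j\<in>{j \<in> seq_index N. Im (z j) \<le> Im (z k)}.
       ereal (u ((\<zeta> - of_real (Re (z j))) / of_real (Im (z j)))) / ereal (blaschke_at N z j))"

(* u stands for the least harmonic majorant of |g|; it exists for every g as in the second line
   and its values on uhp are determined by g, so pairs (g, u) correspond to functions g. *)

definition admissible ::
    "enat \<Rightarrow> (nat \<Rightarrow> complex) \<Rightarrow> (complex \<Rightarrow> complex) \<Rightarrow> (complex \<Rightarrow> real) \<Rightarrow> bool" where
  "admissible N z g u \<longleftrightarrow>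
    g holomorphic_on uhp \<and> g \<i> = 1 \<and> (\<lambda>\<zeta>. g \<zeta> / (\<zeta> + \<i>)\<^sup>2) \<in> H1 \<and>
    least_harmonic_majorant u (\<lambda>\<zeta>. norm (g \<zeta>)) \<and>
    (\<forall>k\<in>seq_index N. (\<forall>\<zeta>\<in>uhp. U_sum N z u k \<zeta> < \<infinity>) \<and>
                       harmonic_on (\<lambda>\<zeta>. real_of_ereal (U_sum N z u k \<zeta>)) uhp)"

definition cJ_of :: "enat \<Rightarrow> (nat \<Rightarrow> complex) \<Rightarrow> (complex \<Rightarrow> real) \<Rightarrow> ereal" where
  "cJ_of N z u = (SUP j\<in>seq_index N. U_sum N z u j (z j))"

definition cJ :: "enat \<Rightarrow> (nat \<Rightarrow> complex) \<Rightarrow> ereal" where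
  "cJ N z = Inf {cJ_of N z u | g u. admissible N z g u}"

end

theory Submission
  imports Defs "HOL-Probability.Sinc_Integral"
begin

text \<open>
  \<^bold>\<open>Upper bound.\<close> For finitely many points let \<open>H_j\<close> be analytic with real part \<open>U_j\<close>, let
  \<open>U_j(z_j) \<le> c\<close> for all \<open>j\<close>, let \<open>g_j(z) = g((z - x_j) / y_j)\<close>, and put
  \<open>F_j = g_j * (B_j / B_j(z_j)) * exp ((H_j(z_j) - H_j) / c)\<close>.
  Then \<open>F_j\<close> is 1 at \<open>z_j\<close> and 0 at the other points, so \<open>\<Sum> w_j F_j\<close> interpolates. With
  \<open>a_j = u_j / \<bar>B_j(z_j)\<bar>\<close> one has \<open>\<bar>F_j\<bar> \<le> e * a_j * exp (- U_j / c)\<close>, where \<open>U_j\<close> is the sum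
  of the \<open>a_i\<close> over the points that lie no higher than \<open>z_j\<close>. Hence \<open>\<Sum> \<bar>F_j\<bar> \<le> e * c\<close>, because
  \<open>\<Sum> a_j exp (- U_j / c)\<close> is at most a lower Riemann sum of the integral of \<open>exp (- t / c)\<close> over
  \<open>[0, \<infinity>)\<close>, which is \<open>c\<close>
  (\<open>exp_weighted_sum_le\<close>, \<open>finite_seq_interpolation\<close>). Dropping points can only increase the Blaschke
  values and removes summands from \<open>U_k\<close>, so every finite subfamily inherits the constant, and a
  normal family argument passes to the whole sequence (\<open>interp_const_le_cJ\<close>).

  \<^bold>\<open>Sharpness.\<close> Little is lost above if the \<open>a_j\<close> are small against \<open>c\<close> and all \<open>U_j(z_j)\<close>
  are nearly equal. This suggests the points \<open>\<i> r^j\<close>, \<open>0 \<le> j \<le> n\<close>, with \<open>r\<close> close to 1 and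
  \<open>n\<close> large. Let \<open>L\<close> be the product of \<open>(r^l - 1) / (r^l + 1)\<close> over \<open>l \<ge> 1\<close>; away from both ends
  of the sequence \<open>\<bar>B_j(z_j)\<bar>\<close> is close to \<open>L\<^sup>2\<close>, and it is never smaller.

  \<^item> \<^emph>\<open>The constant of interpolation is at least about \<open>2 \<pi> / (L\<^sup>2 ln r)\<close>.\<close> In the disc, if \<open>F\<close>
  interpolates signs at the images \<open>a_j\<close> of the points, the residue theorem for
  \<open>F(w) / (B(w) (1 - \<kappa> w))\<close> turns into a sum of positive terms, bounded by the supremum of \<open>F\<close> times the
  mean of \<open>1 / \<bar>1 - \<kappa> w\<bar>\<close> over the circle (\<open>interpolation_duality_disc\<close>). With \<open>\<kappa> = 1 - r^(-n)\<close> most of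
  the \<open>n\<close> terms are close to \<open>2 / L\<^sup>2\<close>, and the mean is \<open>n ln r / \<pi> + O(1)\<close>.

  \<^item> \<^emph>\<open>The characteristic is at most about \<open>(2 \<pi> / e) / (L\<^sup>2 ln r)\<close>.\<close> Up to this factor \<open>1 / (L\<^sup>2 ln r)\<close>,
  \<open>U_k(z_k)\<close> is a Riemann sum of the integral of \<open>u(\<i> s) / s\<close> over \<open>s \<ge> 1\<close>. Integrating the Poisson
  kernel, this integral is the mean of \<open>\<bar>g\<bar> * \<alpha> / sin \<alpha>\<close> over the circle, \<open>\<alpha>\<close> being the argument in
  \<open>(- \<pi>, \<pi>)\<close> and \<open>g\<close> being normalised to be 1 at the centre. By Szego's theorem the infimum over such
  \<open>g\<close> is the geometric mean of the weight. The factor \<open>1 / sin \<alpha>\<close> is the reciprocal modulus of an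
  outer function and contributes 2, and the geometric mean of \<open>\<alpha>\<close> over \<open>[0, \<pi>]\<close> is \<open>\<pi> / e\<close>.
  The lemma \<open>extremal_polynomial\<close> realises this bound approximately with \<open>g\<close> the square of a polynomial
  in the disc variable; then \<open>u\<close> is the real part of an explicit polynomial, since the square of the
  modulus of a polynomial is a trigonometric polynomial on the circle.

  The quotient of the two estimates tends to \<open>e\<close>.
\<close>

section \<open>Harmonic functions and real parts of analytic functions\<close>

lemma DERIV_along_line:
  fixes u :: "complex \<Rightarrow> real"
  assumes "(u has_derivative (\<lambda>h. p * Re h + q * Im h)) (at (z + of_real a * d))"
  shows "((\<lambda>a. u (z + of_real a * d)) has_field_derivative (p * Re d + q * Im d)) (at a)"
proof -
  have "((\<lambda>a. z + of_real a * d) has_derivative (\<lambda>h. of_real h * d)) (at a)"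
    by (auto intro!: derivative_eq_intros)
  from has_derivative_compose[OF this assms]
  show ?thesis unfolding has_field_derivative_def
    by (rule has_derivative_eq_rhs) (auto simp: fun_eq_iff algebra_simps)
qed

text \<open>
  Comparing the two ways of applying the mean value theorem to the second difference of \<open>u\<close> over a
  small square; this is what makes \<open>p - \<i> q\<close> satisfy both Cauchy-Riemann equations.
\<close>

lemma mixed_partials_commute:
  fixes u p q pxx pxy qyx qyy :: "complex \<Rightarrow> real"
  assumes S: "open S" "z \<in> S"
    and u: "\<And>z. z \<in> S \<Longrightarrow> (u has_derivative (\<lambda>h. p z * Re h + q z * Im h)) (at z)"
    and p: "\<And>z. z \<in> S \<Longrightarrow> (p has_derivative (\<lambda>h. pxx z * Re h + pxy z * Im h)) (at z)"
    and q: "\<And>z. z \<in> S \<Longrightarrow> (q has_derivative (\<lambda>h. qyx z * Re h + qyy z * Im h)) (at z)"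
    and cont: "continuous_on S pxy" "continuous_on S qyx"
  shows "pxy z = qyx z"
proof (rule ccontr)
  assume ne: "pxy z \<noteq> qyx z"
  define e where "e = dist (pxy z) (qyx z) / 2"
  have e: "e > 0" using ne by (simp add: e_def)
  have c1: "isCont pxy z" "isCont qyx z"
    using cont S continuous_on_eq_continuous_at by blast+
  obtain d1 where d1: "d1 > 0" "\<And>x. dist x z < d1 \<Longrightarrow> dist (pxy x) (pxy z) < e"
    using c1(1) e unfolding continuous_at_eps_delta by blast
  obtain d2 where d2: "d2 > 0" "\<And>x. dist x z < d2 \<Longrightarrow> dist (qyx x) (qyx z) < e"
    using c1(2) e unfolding continuous_at_eps_delta by blast
  obtain d3 where d3: "d3 > 0" "ball z d3 \<subseteq> S" using S openE by blast
  define h where "h = min d1 (min d2 d3) / 3"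
  have h: "h > 0" "3*h \<le> d1" "3*h \<le> d2" "3*h \<le> d3" using d1 d2 d3 by (auto simp: h_def)
  have near: "dist (z + of_real a + \<i> * of_real b) z < 3*h" if "0 \<le> a" "a \<le> h" "0 \<le> b" "b \<le> h" for a b
  proof -
    have "norm (of_real a + \<i> * of_real b) \<le> a + b"
      using norm_triangle_ineq[of "of_real a :: complex" "\<i> * of_real b"] that by (simp add: norm_mult)
    thus ?thesis using that h by (simp add: dist_norm algebra_simps)
  qed
  have inS: "z + of_real a + \<i> * of_real b \<in> S" if "0 \<le> a" "a \<le> h" "0 \<le> b" "b \<le> h" for a b
    using near[OF that] h d3 by (force simp: dist_commute)
  have Dx: "((\<lambda>a. f (z + of_real a + \<i> * of_real b)) has_field_derivative fx (z + of_real a + \<i> * of_real b)) (at a)"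
    if "\<And>z. z \<in> S \<Longrightarrow> (f has_derivative (\<lambda>h. fx z * Re h + fy z * Im h)) (at z)"
      "0 \<le> a" "a \<le> h" "0 \<le> b" "b \<le> h" for f fx fy a b
    using DERIV_along_line[of f "fx (z + of_real a + \<i> * of_real b)" "fy (z + of_real a + \<i> * of_real b)"
        "z + \<i> * of_real b" a 1] that(1)[OF inS[OF that(2-)]]
    by (simp add: algebra_simps)
  have Dy: "((\<lambda>b. f (z + of_real a + \<i> * of_real b)) has_field_derivative fy (z + of_real a + \<i> * of_real b)) (at b)"
    if "\<And>z. z \<in> S \<Longrightarrow> (f has_derivative (\<lambda>h. fx z * Re h + fy z * Im h)) (at z)"
      "0 \<le> a" "a \<le> h" "0 \<le> b" "b \<le> h" for f fx fy a b
    using DERIV_along_line[of f "fx (z + of_real a + \<i> * of_real b)" "fy (z + of_real a + \<i> * of_real b)"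
        "z + of_real a" b \<i>] that(1)[OF inS[OF that(2-)]]
    by (simp add: algebra_simps)
  let ?P = "\<lambda>a b. z + of_real a + \<i> * of_real b"
  \<comment> \<open>The second difference of \<open>u\<close> over the square of side \<open>h\<close>.\<close>
  define \<Delta> where "\<Delta> = u (?P h h) - u (?P h 0) - u (?P 0 h) + u (?P 0 0)"
  have "\<exists>a. a > 0 \<and> a < h \<and> (u (?P h h) - u (?P h 0)) - (u (?P 0 h) - u (?P 0 0))
      = (h - 0) * (p (?P a h) - p (?P a 0))"
    using h by (intro MVT2[of 0 h "\<lambda>a. u (?P a h) - u (?P a 0)"] DERIV_diff Dx[OF u]) auto
  then obtain a where a: "a > 0" "a < h" "\<Delta> = h * (p (?P a h) - p (?P a 0))"
    by (auto simp: \<Delta>_def)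
  have "\<exists>b. b > 0 \<and> b < h \<and> p (?P a h) - p (?P a 0) = (h - 0) * pxy (?P a b)"
    using h a by (intro MVT2[of 0 h "\<lambda>b. p (?P a b)"] Dy[OF p]) auto
  then obtain b where b: "b > 0" "b < h" "\<Delta> = h * (h * pxy (?P a b))"
    using a by auto
  have "\<exists>b. b > 0 \<and> b < h \<and> (u (?P h h) - u (?P 0 h)) - (u (?P h 0) - u (?P 0 0))
      = (h - 0) * (q (?P h b) - q (?P 0 b))"
    using h by (intro MVT2[of 0 h "\<lambda>b. u (?P h b) - u (?P 0 b)"] DERIV_diff Dy[OF u]) auto
  then obtain b' where b': "b' > 0" "b' < h" "\<Delta> = h * (q (?P h b') - q (?P 0 b'))"
    by (auto simp: \<Delta>_def)
  have "\<exists>a. a > 0 \<and> a < h \<and> q (?P h b') - q (?P 0 b') = (h - 0) * qyx (?P a b')"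
    using h b' by (intro MVT2[of 0 h "\<lambda>a. q (?P a b')"] Dx[OF q]) auto
  then obtain a' where a': "a' > 0" "a' < h" "\<Delta> = h * (h * qyx (?P a' b'))"
    using b' by auto
  have eq: "pxy (?P a b) = qyx (?P a' b')" using a' b h by auto
  have "dist (pxy (?P a b)) (pxy z) < e"
    using near[of a b] a b h by (intro d1) linarith
  moreover have "dist (qyx (?P a' b')) (qyx z) < e"
    using near[of a' b'] a' b' h by (intro d2) linarith
  ultimately show False using eq e unfolding e_def
    by (metis dist_commute dist_triangle_half_l less_irrefl)
qed

text \<open>
  The function \<open>p - \<i> q\<close> formed from the gradient is holomorphic, and on a convex set it has a primitive.
\<close>

lemma harmonic_on_imp_Re_holomorphic:
  assumes S: "open S" "convex S" and u: "harmonic_on u S"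
  obtains H where "H holomorphic_on S" "\<And>z. z \<in> S \<Longrightarrow> Re (H z) = u z"
proof (cases "S = {}")
  case True
  show ?thesis by (rule that[of "\<lambda>_. 0"]) (auto simp: True)
next
  case False
  then obtain z0 where z0: "z0 \<in> S" by auto
  from u obtain p q pxx pxy qyx qyy :: "complex \<Rightarrow> real" where
    d: "\<And>z. z\<in>S \<Longrightarrow> (u has_derivative (\<lambda>h. p z * Re h + q z * Im h)) (at z)"
       "\<And>z. z\<in>S \<Longrightarrow> (p has_derivative (\<lambda>h. pxx z * Re h + pxy z * Im h)) (at z)"
       "\<And>z. z\<in>S \<Longrightarrow> (q has_derivative (\<lambda>h. qyx z * Re h + qyy z * Im h)) (at z)"
       "\<And>z. z\<in>S \<Longrightarrow> pxx z + qyy z = 0"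
    and c: "continuous_on S pxy" "continuous_on S qyx"
    unfolding harmonic_on_def by blast
  have sym: "qyx z = pxy z" if "z \<in> S" for z
    using mixed_partials_commute[OF S(1) that d(1-3) c] by simp
  define F where "F = (\<lambda>z. complex_of_real (p z) - \<i> * of_real (q z))"
  have "(F has_field_derivative (of_real (pxx z) - \<i> * of_real (pxy z))) (at z)" if z: "z \<in> S" for z
  proof -
    have qyy: "qyy z = - pxx z" using d(4)[OF z] by simp
    have "(F has_derivative (\<lambda>h. complex_of_real (pxx z * Re h + pxy z * Im h) -
        \<i> * of_real (qyx z * Re h + qyy z * Im h))) (at z)"
      unfolding F_def using d(2,3)[OF z]
      by (auto intro!: derivative_eq_intros)
    moreover have "(\<lambda>h. complex_of_real (pxx z * Re h + pxy z * Im h) -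
        \<i> * of_real (qyx z * Re h + qyy z * Im h)) = (*) (of_real (pxx z) - \<i> * of_real (pxy z))"
      by (auto simp: fun_eq_iff complex_eq_iff sym[OF z] qyy algebra_simps)
    ultimately show ?thesis by (simp add: has_field_derivative_def)
  qed
  hence "F holomorphic_on S"
    by (meson has_field_derivative_at_within holomorphic_onI field_differentiable_def)
  then obtain G where G: "\<And>x. x \<in> S \<Longrightarrow> (G has_field_derivative F x) (at x within S)"
    using holomorphic_convex_primitive' S by metis
  have G': "(G has_field_derivative F x) (at x)" if "x \<in> S" for x
    using G[OF that] at_within_open[OF that S(1)] by simp
  have "((\<lambda>z. Re (G z) - u z) has_derivative (\<lambda>h. 0)) (at z within S)" if z: "z \<in> S" for z
  proof -
    have "((\<lambda>z. Re (G z)) has_derivative (\<lambda>h. Re (F z * h))) (at z)"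
      using G'[OF z] unfolding has_field_derivative_def by (rule has_derivative_Re)
    hence "((\<lambda>z. Re (G z) - u z) has_derivative (\<lambda>h. Re (F z * h) - (p z * Re h + q z * Im h))) (at z)"
      using d(1)[OF z] by (rule has_derivative_diff)
    hence "((\<lambda>z. Re (G z) - u z) has_derivative (\<lambda>h. 0)) (at z)"
      by (rule has_derivative_eq_rhs) (auto simp: F_def fun_eq_iff)
    thus ?thesis by (rule has_derivative_at_withinI)
  qed
  from has_derivative_zero_constant[OF S(2) this]
  obtain k where k: "\<And>z. z \<in> S \<Longrightarrow> Re (G z) - u z = k" by blast
  show ?thesis
  proof (rule that[of "\<lambda>z. G z - of_real k"])
    show "(\<lambda>z. G z - of_real k) holomorphic_on S"
      by (intro holomorphic_intros) (use G' in \<open>auto simp: holomorphic_on_open[OF S(1)]\<close>)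
    show "Re (G z - of_real k) = u z" if "z \<in> S" for z using k[OF that] by simp
  qed
qed

lemma harmonic_on_Re:
  assumes S: "open S" and H: "H holomorphic_on S"
  shows "harmonic_on (\<lambda>z. Re (H z)) S"
proof -
  let ?H' = "deriv H" and ?H'' = "deriv (deriv H)"
  have H1: "?H' holomorphic_on S" and H2: "?H'' holomorphic_on S"
    using S H by (auto intro!: holomorphic_deriv)
  have d: "(f has_derivative (*) (deriv f z)) (at z)" if "f holomorphic_on S" "z \<in> S" for f z
    using holomorphic_derivI[OF that(1) S that(2)] by (simp add: has_field_derivative_def)
  have c: "continuous_on S ?H''" using H2 by (rule holomorphic_on_imp_continuous_on)
  show ?thesis unfolding harmonic_on_def
  proof (rule exI[of _ "\<lambda>z. Re (?H' z)"], rule exI[of _ "\<lambda>z. - Im (?H' z)"],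
      rule exI[of _ "\<lambda>z. Re (?H'' z)"], rule exI[of _ "\<lambda>z. - Im (?H'' z)"],
      rule exI[of _ "\<lambda>z. - Im (?H'' z)"], rule exI[of _ "\<lambda>z. - Re (?H'' z)"], intro conjI ballI)
    fix z assume z: "z \<in> S"
    show "((\<lambda>z. Re (H z)) has_derivative (\<lambda>h. Re (?H' z) * Re h + - Im (?H' z) * Im h)) (at z)"
      by (rule has_derivative_eq_rhs, rule has_derivative_Re, rule d[OF H z]) auto
    show "((\<lambda>z. Re (?H' z)) has_derivative (\<lambda>h. Re (?H'' z) * Re h + - Im (?H'' z) * Im h)) (at z)"
      by (rule has_derivative_eq_rhs, rule has_derivative_Re, rule d[OF H1 z]) auto
    show "((\<lambda>z. - Im (?H' z)) has_derivative (\<lambda>h. - Im (?H'' z) * Re h + - Re (?H'' z) * Im h)) (at z)"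
      by (rule has_derivative_eq_rhs, rule has_derivative_minus, rule has_derivative_Im, rule d[OF H1 z]) auto
  qed (use c in \<open>auto intro!: continuous_intros\<close>)
qed

lemma open_uhp: "open uhp"
  unfolding uhp_def by (rule open_halfspace_Im_gt)

lemma convex_uhp: "convex uhp"
  unfolding uhp_def by (rule convex_halfspace_Im_gt)

lemma i_in_uhp: "\<i> \<in> uhp"
  by (simp add: uhp_def)

section \<open>Interpolation at finitely many points by the formula of Jones\<close>

lemma pseudohyperbolic_less_1:
  assumes "z \<in> uhp" "a \<in> uhp"
  shows "norm ((z - a) / (z - cnj a)) < 1"
proof -
  have "(norm (z - a))\<^sup>2 < (norm (z - cnj a))\<^sup>2"
    using assms mult_pos_pos[of "Im z" "Im a"]
    unfolding cmod_power2 by (simp add: uhp_def power2_eq_square algebra_simps)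
  hence "norm (z - a) < norm (z - cnj a)"
    by (rule power2_less_imp_less) simp
  thus ?thesis by (simp add: norm_divide divide_less_eq)
qed

lemma uhp_minus_cnj_nonzero: "z \<in> uhp \<Longrightarrow> a \<in> uhp \<Longrightarrow> z - cnj a \<noteq> 0"
  by (auto simp: uhp_def complex_eq_iff)

definition pseudohyp :: "complex \<Rightarrow> complex \<Rightarrow> real" where
  "pseudohyp a b = norm ((a - b) / (a - cnj b))"

text \<open>
  Order the terms by \<open>y\<close>. The sum is then a lower Riemann sum of the integral of \<open>exp (- t / c)\<close> over
  \<open>[0, \<Sum> a]\<close>; ties in \<open>y\<close> only make it smaller.
\<close>

lemma exp_weighted_sum_le:
  fixes a y :: "'a \<Rightarrow> real"
  assumes "finite A" and a: "\<And>j. j \<in> A \<Longrightarrow> a j \<ge> 0" and c: "c > 0"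
  shows "(\<Sum>j\<in>A. a j * exp (- (\<Sum>i\<in>{i\<in>A. y i \<le> y j}. a i) / c)) \<le> c * (1 - exp (- (\<Sum>i\<in>A. a i) / c))"
  using assms(1) a
proof (induction A rule: finite_ranking_induct[where f = y])
  case empty
  then show ?case by simp
next
  case (insert x S)
  show ?case
  proof (cases "x \<in> S")
    case True
    then show ?thesis using insert by (simp add: insert_absorb)
  next
    case x: False
    let ?T = "\<lambda>A j. (\<Sum>i\<in>{i\<in>A. y i \<le> y j}. a i)"
    have pos: "a j \<ge> 0" if "j \<in> insert x S" for j using insert that by auto
    have "{i\<in>insert x S. y i \<le> y x} = insert x S" using insert by auto
    hence Tx: "?T (insert x S) x = a x + sum a S" using x insert by simp
    have mono: "?T S j \<le> ?T (insert x S) j" for j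
      using insert pos by (intro sum_mono2) auto
    have "(\<Sum>j\<in>S. a j * exp (- ?T (insert x S) j / c)) \<le> (\<Sum>j\<in>S. a j * exp (- ?T S j / c))"
      using mono c pos by (intro sum_mono mult_left_mono) (auto simp: divide_right_mono)
    also have "\<dots> \<le> c * (1 - exp (- sum a S / c))" using insert by simp
    finally have 1: "(\<Sum>j\<in>S. a j * exp (- ?T (insert x S) j / c)) \<le> c * (1 - exp (- sum a S / c))" .
    \<comment> \<open>The new term is at most the integral of \<open>exp (- t / c)\<close> over \<open>[sum a S, sum a S + a x]\<close>.\<close>
    have "a x / c \<le> exp (a x / c) - 1" using exp_ge_add_one_self[of "a x / c"] by linarith
    hence "a x / c * exp (- (a x + sum a S) / c) \<le> (exp (a x / c) - 1) * exp (- (a x + sum a S) / c)"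
      by (intro mult_right_mono) auto
    also have "\<dots> = exp (- sum a S / c) - exp (- (a x + sum a S) / c)"
      by (simp add: algebra_simps flip: exp_add) (simp add: field_simps diff_divide_distrib)
    finally have 2: "a x * exp (- (a x + sum a S) / c) \<le> c * (exp (- sum a S / c) - exp (- (a x + sum a S) / c))"
      using c by (simp add: field_simps)
    have "(\<Sum>j\<in>insert x S. a j * exp (- ?T (insert x S) j / c)) =
        a x * exp (- ?T (insert x S) x / c) + (\<Sum>j\<in>S. a j * exp (- ?T (insert x S) j / c))"
      using x insert by (intro sum.insert) auto
    also have "\<dots> \<le> c * (1 - exp (- (a x + sum a S) / c))"
      using 1 2 unfolding Tx by (simp add: algebra_simps)
    finally show ?thesis using x insert by simp
  qed
qed

text \<open>
  The interpolating functions are those of Jones: \<open>g\<close> moved to the point \<open>z j\<close>, times a normalised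
  Blaschke product vanishing at the other points, times an exponential whose modulus decays with the
  harmonic function \<open>U\<close> of the points not higher than \<open>z j\<close>.
\<close>

lemma finite_seq_interpolation:
  fixes z w :: "nat \<Rightarrow> complex" and u :: "complex \<Rightarrow> real" and y :: "nat \<Rightarrow> real"
  assumes A: "finite A" and inj: "inj_on z A" and z: "z ` A \<subseteq> uhp"
    and g: "g holomorphic_on uhp" "g \<i> = 1"
    and u: "harmonic_majorant u (\<lambda>\<zeta>. norm (g \<zeta>))"
    and c: "c > 0"
    and bd: "\<And>k. k \<in> A \<Longrightarrow> (\<Sum>j\<in>{j\<in>A. Im (z j) \<le> Im (z k)}.
        u ((z k - of_real (Re (z j))) / of_real (Im (z j))) / (\<Prod>i\<in>A-{j}. pseudohyp (z j) (z i))) \<le> c"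
    and w: "\<And>j. j \<in> A \<Longrightarrow> norm (w j) \<le> W" and W: "W \<ge> 0"
  shows "\<exists>f. f holomorphic_on uhp \<and> (\<forall>\<zeta>\<in>uhp. norm (f \<zeta>) \<le> exp 1 * c * W) \<and> (\<forall>j\<in>A. f (z j) = w j)"
proof (cases "A = {}")
  case True
  then show ?thesis using W c
    by (intro exI[of _ "\<lambda>_. 0"]) (auto intro!: holomorphic_intros)
next
  case False
  obtain H where H: "H holomorphic_on uhp" "\<And>\<zeta>. \<zeta> \<in> uhp \<Longrightarrow> Re (H \<zeta>) = u \<zeta>"
    using harmonic_on_imp_Re_holomorphic[OF open_uhp convex_uhp] u
    unfolding harmonic_majorant_def by metis
  have ug: "norm (g \<zeta>) \<le> u \<zeta>" if "\<zeta> \<in> uhp" for \<zeta> using u that by (auto simp: harmonic_majorant_def)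
  define T where "T = (\<lambda>j \<zeta>. (\<zeta> - complex_of_real (Re (z j))) / of_real (Im (z j)))"
  define \<beta> where "\<beta> = (\<lambda>j. \<Prod>i\<in>A-{j}. pseudohyp (z j) (z i))"
  define b where "b = (\<lambda>j \<zeta>. \<Prod>i\<in>A-{j}. (\<zeta> - z i) / (\<zeta> - cnj (z i)))"
  have zA: "z j \<in> uhp" if "j \<in> A" for j using z that by auto
  have T: "T j \<zeta> \<in> uhp" if "j \<in> A" "\<zeta> \<in> uhp" for j \<zeta>
    using zA[OF that(1)] that by (simp add: T_def uhp_def)
  have Tz: "T j (z j) = \<i>" if "j \<in> A" for j
    using zA[OF that(1)] by (auto simp: T_def uhp_def complex_eq_iff)
  have T_hol: "T j holomorphic_on uhp" if "j \<in> A" for j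
    using zA[OF that] unfolding T_def uhp_def by (intro holomorphic_intros) auto
  have b_hol: "b j holomorphic_on uhp" if "j \<in> A" for j
    unfolding b_def using uhp_minus_cnj_nonzero zA by (intro holomorphic_intros) auto
  have b_le: "norm (b j \<zeta>) \<le> 1" if "j \<in> A" "\<zeta> \<in> uhp" for j \<zeta>
    unfolding b_def prod_norm[symmetric] using pseudohyperbolic_less_1 zA that
    by (intro prod_le_1) (auto intro: less_imp_le)
  have b_z: "norm (b j (z j)) = \<beta> j" for j
    unfolding b_def \<beta>_def pseudohyp_def prod_norm[symmetric] by simp
  have \<beta>: "\<beta> j > 0" if "j \<in> A" for j
    unfolding \<beta>_def pseudohyp_def using that inj zA uhp_minus_cnj_nonzero
    by (intro prod_pos) (auto simp: inj_on_def)
  have b0: "b j (z k) = 0" if "j \<in> A" "k \<in> A" "k \<noteq> j" for j k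
    using A that unfolding b_def by (intro prod_zero) auto
  define a where "a = (\<lambda>\<zeta> j. u (T j \<zeta>) / \<beta> j)"
  have a: "a \<zeta> j \<ge> 0" if "j \<in> A" "\<zeta> \<in> uhp" for j \<zeta>
    using ug[OF T[OF that]] \<beta>[OF that(1)] norm_ge_zero[of "g (T j \<zeta>)"] 
    unfolding a_def by (intro divide_nonneg_pos) linarith+
  define K where "K = (\<lambda>k \<zeta>. \<Sum>j\<in>{j\<in>A. Im (z j) \<le> Im (z k)}. H (T j \<zeta>) / of_real (\<beta> j))"
  have K_hol: "K k holomorphic_on uhp" for k
    unfolding K_def
  proof (intro holomorphic_intros)
    fix j assume j: "j \<in> {j\<in>A. Im (z j) \<le> Im (z k)}"
    show "(\<lambda>\<zeta>. H (T j \<zeta>)) holomorphic_on uhp"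
      using holomorphic_on_compose_gen[OF T_hol H(1)] j T by (auto simp: o_def)
    show "complex_of_real (\<beta> j) \<noteq> 0" using \<beta> j by force
  qed
  have ReK: "Re (K k \<zeta>) = (\<Sum>j\<in>{j\<in>A. Im (z j) \<le> Im (z k)}. a \<zeta> j)" if "\<zeta> \<in> uhp" for k \<zeta>
    unfolding K_def a_def Re_sum using H(2) T that by (intro sum.cong) auto
  have Kc: "Re (K k (z k)) \<le> c" if "k \<in> A" for k
    unfolding ReK[OF zA[OF that]] using bd[OF that] by (simp add: a_def T_def \<beta>_def)
  \<comment> \<open>The functions of Jones; the exponential is the one factor that depends on the order of the points by height.\<close>
  define F where "F = (\<lambda>j \<zeta>. g (T j \<zeta>) * (b j \<zeta> / b j (z j)) * exp ((K j (z j) - K j \<zeta>) / of_real c))"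
  have b_ne: "b j (z j) \<noteq> 0" if "j \<in> A" for j using b_z[of j] \<beta>[OF that] by auto
  have F_hol: "F j holomorphic_on uhp" if "j \<in> A" for j
    unfolding F_def
  proof (intro holomorphic_intros K_hol b_hol that b_ne)
    show "(\<lambda>\<zeta>. g (T j \<zeta>)) holomorphic_on uhp"
      using holomorphic_on_compose_gen[OF T_hol g(1)] that T by (auto simp: o_def)
  qed (use c in auto)
  have F_diag: "F j (z j) = 1" if "j \<in> A" for j
    using that b_ne Tz g by (simp add: F_def)
  have F_off: "F j (z k) = 0" if "j \<in> A" "k \<in> A" "k \<noteq> j" for j k
    using b0[OF that] by (simp add: F_def)
  have F_le: "norm (F j \<zeta>) \<le> exp 1 * (a \<zeta> j * exp (- (\<Sum>i\<in>{i\<in>A. Im (z i) \<le> Im (z j)}. a \<zeta> i) / c))"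
    if j: "j \<in> A" and \<zeta>: "\<zeta> \<in> uhp" for j \<zeta>
  proof -
    have "norm (F j \<zeta>) = norm (g (T j \<zeta>)) * (norm (b j \<zeta>) / \<beta> j) * exp (Re (K j (z j)) / c - Re (K j \<zeta>) / c)"
      by (simp add: F_def norm_mult norm_divide b_z diff_divide_distrib)
    also have "\<dots> \<le> u (T j \<zeta>) * (1 / \<beta> j) * exp (1 - Re (K j \<zeta>) / c)"
      using ug[OF T[OF j \<zeta>]] \<beta>[OF j] b_le[OF j \<zeta>] Kc[OF j] c order_trans[OF norm_ge_zero ug[OF T[OF j \<zeta>]]]
      by (intro mult_mono divide_right_mono) (auto simp: divide_le_eq)
    also have "\<dots> = exp 1 * (a \<zeta> j * exp (- (\<Sum>i\<in>{i\<in>A. Im (z i) \<le> Im (z j)}. a \<zeta> i) / c))"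
      by (simp add: a_def ReK[OF \<zeta>] exp_diff exp_minus field_simps)
    finally show ?thesis .
  qed
  define f where "f = (\<lambda>\<zeta>. \<Sum>j\<in>A. w j * F j \<zeta>)"
  show ?thesis
  proof (intro exI[of _ f] conjI ballI)
    show "f holomorphic_on uhp" unfolding f_def by (intro holomorphic_intros F_hol)
    fix \<zeta> assume \<zeta>: "\<zeta> \<in> uhp"
    have "norm (f \<zeta>) \<le> (\<Sum>j\<in>A. norm (w j) * norm (F j \<zeta>))"
      unfolding f_def norm_mult[symmetric] by (rule norm_sum)
    also have "\<dots> \<le> (\<Sum>j\<in>A. W * (exp 1 * (a \<zeta> j * exp (- (\<Sum>i\<in>{i\<in>A. Im (z i) \<le> Im (z j)}. a \<zeta> i) / c))))"
      using w F_le \<zeta> W by (intro sum_mono mult_mono) auto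
    also have "\<dots> = W * exp 1 * (\<Sum>j\<in>A. a \<zeta> j * exp (- (\<Sum>i\<in>{i\<in>A. Im (z i) \<le> Im (z j)}. a \<zeta> i) / c))"
      by (simp add: sum_distrib_left mult.assoc)
    also have "\<dots> \<le> W * exp 1 * (c * (1 - exp (- (\<Sum>i\<in>A. a \<zeta> i) / c)))"
      using W a \<zeta> c A by (intro mult_left_mono exp_weighted_sum_le) auto
    also have "\<dots> \<le> W * exp 1 * (c * 1)"
      using W c by (intro mult_left_mono) auto
    finally show "norm (f \<zeta>) \<le> exp 1 * c * W" by (simp add: mult_ac)
  next
    fix k assume k: "k \<in> A"
    have "f (z k) = (\<Sum>j\<in>A. if j = k then w k else 0)"
      unfolding f_def using F_diag F_off k by (intro sum.cong) auto
    thus "f (z k) = w k" using k A by simp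
  qed
qed

section \<open>The upper bound for arbitrary sequences\<close>

lemma seq_index_0: "uhp_seq N z \<Longrightarrow> 0 \<in> seq_index N"
  by (simp add: uhp_seq_def seq_index_def zero_enat_def)

lemma pseudohyp_nonneg: "pseudohyp a b \<ge> 0"
  by (simp add: pseudohyp_def)

lemma pseudohyp_le_1: "a \<in> uhp \<Longrightarrow> b \<in> uhp \<Longrightarrow> pseudohyp a b \<le> 1"
  using pseudohyperbolic_less_1 unfolding pseudohyp_def by (rule less_imp_le)

text \<open>
  The partial products decrease, so the limit that defines the Blaschke value exists and lies below
  the product over any finite set of indices.
\<close>

lemma blaschke_at_bounds:
  assumes Z: "uhp_seq N z" and j: "j \<in> seq_index N"
  shows "0 \<le> blaschke_at N z j"
    and "finite A \<Longrightarrow> A \<subseteq> seq_index N \<Longrightarrow> blaschke_at N z j \<le> (\<Prod>i\<in>A-{j}. pseudohyp (z j) (z i))"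
proof -
  define P where "P = (\<lambda>n. \<Prod>k\<in>{k \<in> seq_index N. k < n \<and> k \<noteq> j}. pseudohyp (z j) (z k))"
  have eq: "blaschke_at N z j = lim P" by (simp add: blaschke_at_def P_def pseudohyp_def)
  have zI: "z k \<in> uhp" if "k \<in> seq_index N" for k using Z that by (auto simp: uhp_seq_def)
  have mono: "(\<Prod>k\<in>X. pseudohyp (z j) (z k)) \<le> (\<Prod>k\<in>Y. pseudohyp (z j) (z k))"
    if "finite X" "Y \<subseteq> X" "X \<subseteq> seq_index N" for X Y
  proof -
    have "(\<Prod>k\<in>X. pseudohyp (z j) (z k)) = (\<Prod>k\<in>X-Y. pseudohyp (z j) (z k)) * (\<Prod>k\<in>Y. pseudohyp (z j) (z k))"
      using that by (simp add: prod.subset_diff)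
    also have "\<dots> \<le> 1 * (\<Prod>k\<in>Y. pseudohyp (z j) (z k))"
      using that zI j by (intro mult_right_mono prod_le_1 prod_nonneg) (auto intro: pseudohyp_le_1 pseudohyp_nonneg)
    finally show ?thesis by simp
  qed
  have dec: "decseq P"
    unfolding decseq_def P_def by (intro allI impI mono) auto
  have ge0: "P n \<ge> 0" for n unfolding P_def by (intro prod_nonneg) (auto intro: pseudohyp_nonneg)
  have "convergent P"
    using decseq_convergent[OF dec, of 0] ge0 unfolding convergent_def by metis
  hence lim: "P \<longlonglongrightarrow> lim P" by (simp add: convergent_LIMSEQ_iff)
  show "0 \<le> blaschke_at N z j" unfolding eq using ge0 by (intro LIMSEQ_le_const[OF lim]) auto
  show "blaschke_at N z j \<le> (\<Prod>i\<in>A-{j}. pseudohyp (z j) (z i))" if A: "finite A" "A \<subseteq> seq_index N"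
  proof -
    have "lim P \<le> P (Suc (Max A))" by (rule decseq_ge[OF dec lim])
    also have "\<dots> \<le> (\<Prod>i\<in>A-{j}. pseudohyp (z j) (z i))"
      unfolding P_def using A by (intro mono) (auto simp: less_Suc_eq_le)
    finally show ?thesis by (simp add: eq)
  qed
qed

lemma sum_le_infsum_ereal:
  fixes f :: "'a \<Rightarrow> ereal"
  assumes "finite B" "B \<subseteq> A" "\<And>x. x \<in> A \<Longrightarrow> f x \<ge> 0"
  shows "sum f B \<le> infsum f A"
proof -
  have "infsum f B \<le> infsum f A"
    using assms by (intro infsum_mono_neutral nonneg_summable_on_complete) auto
  thus ?thesis using assms by simp
qed

text \<open>
  Passing to a finite subfamily removes nonnegative terms and increases the Blaschke values in the
  denominators. A vanishing Blaschke value needs care: the corresponding term of the full sum is then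
  \<open>\<infinity>\<close>, or \<open>0 / 0 = 0\<close>.
\<close>

lemma U_sum_ge_finite:
  assumes Z: "uhp_seq N z" and u: "harmonic_majorant u (\<lambda>\<zeta>. norm (g \<zeta>))"
    and A: "finite A" "A \<subseteq> seq_index N" and \<zeta>: "\<zeta> \<in> uhp"
  shows "ereal (\<Sum>j\<in>{j\<in>A. Im (z j) \<le> Im (z k)}.
        u ((\<zeta> - of_real (Re (z j))) / of_real (Im (z j))) / (\<Prod>i\<in>A-{j}. pseudohyp (z j) (z i)))
      \<le> U_sum N z u k \<zeta>"
proof -
  let ?u = "\<lambda>j. u ((\<zeta> - of_real (Re (z j))) / of_real (Im (z j)))"
  have zI: "z j \<in> uhp" if "j \<in> seq_index N" for j using Z that by (auto simp: uhp_seq_def)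
  have u0: "?u j \<ge> 0" if "j \<in> seq_index N" for j
  proof -
    have "(\<zeta> - of_real (Re (z j))) / of_real (Im (z j)) \<in> uhp"
      using zI[OF that] \<zeta> by (simp add: uhp_def)
    hence "norm (g ((\<zeta> - of_real (Re (z j))) / of_real (Im (z j)))) \<le> ?u j"
      using u unfolding harmonic_majorant_def by blast
    thus ?thesis using norm_ge_zero order_trans by blast
  qed
  note \<beta>0 = blaschke_at_bounds(1)[OF Z]
  have nn: "ereal (?u j) / ereal (blaschke_at N z j) \<ge> 0" if "j \<in> seq_index N" for j
    using u0[OF that] \<beta>0[OF that] by (auto simp: divide_ereal_def)
  have "ereal (\<Sum>j\<in>{j\<in>A. Im (z j) \<le> Im (z k)}. ?u j / (\<Prod>i\<in>A-{j}. pseudohyp (z j) (z i)))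
      = (\<Sum>j\<in>{j\<in>A. Im (z j) \<le> Im (z k)}. ereal (?u j / (\<Prod>i\<in>A-{j}. pseudohyp (z j) (z i))))"
    by simp
  also have "\<dots> \<le> (\<Sum>j\<in>{j\<in>A. Im (z j) \<le> Im (z k)}. ereal (?u j) / ereal (blaschke_at N z j))"
  proof (rule sum_mono)
    fix j assume "j \<in> {j\<in>A. Im (z j) \<le> Im (z k)}"
    hence j: "j \<in> seq_index N" using A by auto
    show "ereal (?u j / (\<Prod>i\<in>A-{j}. pseudohyp (z j) (z i))) \<le> ereal (?u j) / ereal (blaschke_at N z j)"
    proof (cases "blaschke_at N z j = 0")
      case True
      then show ?thesis using u0[OF j] by (cases "?u j = 0") (auto simp: divide_ereal_def)
    next
      case False
      hence "blaschke_at N z j > 0" using \<beta>0[OF j] by simp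
      moreover have "blaschke_at N z j \<le> (\<Prod>i\<in>A-{j}. pseudohyp (z j) (z i))"
        by (rule blaschke_at_bounds(2)[OF Z j A])
      ultimately have "?u j / (\<Prod>i\<in>A-{j}. pseudohyp (z j) (z i)) \<le> ?u j / blaschke_at N z j"
        using u0[OF j] by (intro divide_left_mono mult_pos_pos) auto
      with False show ?thesis by simp
    qed
  qed
  also have "\<dots> \<le> U_sum N z u k \<zeta>"
    unfolding U_sum_def using A nn by (intro sum_le_infsum_ereal) auto
  finally show ?thesis .
qed

text \<open>
  The term of index \<open>0\<close> in \<open>U_0(z_0)\<close> is \<open>u(\<i>)\<close> divided by a number that is at most 1, and
  \<open>u(\<i>) \<ge> \<bar>g(\<i>)\<bar> = 1\<close>.
\<close>

lemma one_le_cJ_of: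
  assumes Z: "uhp_seq N z" and adm: "admissible N z g u"
  shows "1 \<le> cJ_of N z u"
proof -
  have g: "g holomorphic_on uhp" "g \<i> = 1" and u: "harmonic_majorant u (\<lambda>\<zeta>. norm (g \<zeta>))"
    using adm by (auto simp: admissible_def least_harmonic_majorant_def)
  have zI: "z j \<in> uhp" if "j \<in> seq_index N" for j using Z that by (auto simp: uhp_seq_def)
  note 0 = seq_index_0[OF Z]
  have T0: "(z 0 - of_real (Re (z 0))) / of_real (Im (z 0)) = \<i>"
    using zI[OF 0] by (auto simp: uhp_def complex_eq_iff)
  have "1 \<le> u \<i>" using u g i_in_uhp unfolding harmonic_majorant_def by force
  moreover have "ereal (u \<i>) \<le> U_sum N z u 0 (z 0)"
  proof -
    have "{j \<in> {0}. Im (z j) \<le> Im (z 0)} = {0::nat}" by auto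
    from U_sum_ge_finite[OF Z u, of "{0}" "z 0" 0, unfolded this] show ?thesis
      using 0 zI[OF 0] by (simp add: T0)
  qed
  ultimately have "ereal 1 \<le> U_sum N z u 0 (z 0)"
    by (metis ereal_less_eq(3) order_trans)
  also have "\<dots> \<le> cJ_of N z u" unfolding cJ_of_def using 0 by (rule SUP_upper)
  finally show ?thesis by (simp add: one_ereal_def)
qed

text \<open>
  Finite subfamilies are interpolated with a common bound, and Montel's theorem yields a limit that
  interpolates at every point of the sequence.
\<close>

lemma interp_const_le_cJ_of:
  assumes Z: "uhp_seq N z" and adm: "admissible N z g u"
  shows "interp_const N z \<le> ereal (exp 1) * cJ_of N z u"
proof (cases "cJ_of N z u = \<infinity>")
  case True
  then show ?thesis by simp
next
  case False
  have g: "g holomorphic_on uhp" "g \<i> = 1" and u: "harmonic_majorant u (\<lambda>\<zeta>. norm (g \<zeta>))"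
    using adm by (auto simp: admissible_def least_harmonic_majorant_def)
  have zI: "z j \<in> uhp" if "j \<in> seq_index N" for j using Z that by (auto simp: uhp_seq_def)
  have le: "U_sum N z u k (z k) \<le> cJ_of N z u" if "k \<in> seq_index N" for k
    unfolding cJ_of_def using that by (rule SUP_upper)
  note 0 = seq_index_0[OF Z]
  have "ereal 1 \<le> cJ_of N z u" using one_le_cJ_of[OF Z adm] by (simp add: one_ereal_def)
  then obtain c where c: "cJ_of N z u = ereal c" "c > 0"
    using False by (cases "cJ_of N z u") auto
  have solve: "\<exists>f. interpolates N z w f \<and> Hinf_norm f \<le> exp 1 * c * data_norm N w" if w: "bounded_data N w" for w
  proof -
    define W where "W = data_norm N w"
    have bdd: "bdd_above ((\<lambda>j. norm (w j)) ` seq_index N)"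
      using w unfolding bounded_data_def bounded_iff bdd_above_def by auto
    have wW: "norm (w j) \<le> W" if "j \<in> seq_index N" for j
      unfolding W_def data_norm_def using bdd that by (intro cSUP_upper)
    hence W0: "W \<ge> 0" using 0 norm_ge_zero order_trans by blast
    have "\<exists>f. f holomorphic_on uhp \<and> (\<forall>\<zeta>\<in>uhp. norm (f \<zeta>) \<le> exp 1 * c * W) \<and>
        (\<forall>j\<in>{j \<in> seq_index N. j < n}. f (z j) = w j)" for n
    proof (rule finite_seq_interpolation[OF _ _ _ g u c(2) _ _ W0])
      fix k assume k: "k \<in> {j \<in> seq_index N. j < n}"
      let ?s = "\<Sum>j\<in>{j \<in> {j \<in> seq_index N. j < n}. Im (z j) \<le> Im (z k)}.
         u ((z k - of_real (Re (z j))) / of_real (Im (z j))) /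
         (\<Prod>i\<in>{j \<in> seq_index N. j < n} - {j}. pseudohyp (z j) (z i))"
      have "ereal ?s \<le> U_sum N z u k (z k)"
        using k zI by (intro U_sum_ge_finite[OF Z u]) auto
      also have "\<dots> \<le> ereal c" using le k c by simp
      finally show "?s \<le> c" by simp
    qed (use Z wW in \<open>auto simp: uhp_seq_def intro: inj_on_subset\<close>)
    from choice[OF allI[OF this]] obtain F where FF: "\<forall>n. F n holomorphic_on uhp \<and>
        (\<forall>\<zeta>\<in>uhp. norm (F n \<zeta>) \<le> exp 1 * c * W) \<and> (\<forall>j\<in>{j \<in> seq_index N. j < n}. F n (z j) = w j)" ..
    have F: "\<And>n. F n holomorphic_on uhp"
      "\<And>n \<zeta>. \<zeta> \<in> uhp \<Longrightarrow> norm (F n \<zeta>) \<le> exp 1 * c * W"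
      "\<And>n j. j \<in> seq_index N \<Longrightarrow> j < n \<Longrightarrow> F n (z j) = w j"
      using FF by simp_all
    obtain f r where f: "f holomorphic_on uhp" "strict_mono (r :: nat \<Rightarrow> nat)"
      "\<And>x. x \<in> uhp \<Longrightarrow> (\<lambda>n. F (r n) x) \<longlonglongrightarrow> f x"
    proof (rule Montel[OF open_uhp, of "range F" F])
      show "\<exists>B. \<forall>h\<in>range F. \<forall>z\<in>K. norm (h z) \<le> B" if "K \<subseteq> uhp" for K
      proof (intro exI[of _ "exp 1 * c * W"] ballI)
        fix h x assume "h \<in> range F" "x \<in> K"
        thus "norm (h x) \<le> exp 1 * c * W" using F(2)[of x] that by auto
      qed
    qed (use F(1) in auto)
    have f_le: "norm (f \<zeta>) \<le> exp 1 * c * W" if "\<zeta> \<in> uhp" for \<zeta>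
      using F(2) that by (intro LIMSEQ_le_const2[OF tendsto_norm[OF f(3)[OF that]]]) auto
    have "f (z j) = w j" if j: "j \<in> seq_index N" for j
    proof (rule LIMSEQ_unique[OF f(3)[OF zI[OF j]]])
      have "\<forall>\<^sub>F n in sequentially. F (r n) (z j) = w j"
        using eventually_gt_at_top[of j]
        by eventually_elim (meson F(3) j f(2) seq_suble less_le_trans)
      thus "(\<lambda>n. F (r n) (z j)) \<longlonglongrightarrow> w j" by (rule tendsto_eventually)
    qed
    moreover have "f \<in> Hinf"
      using f(1) f_le by (auto simp: Hinf_def bounded_iff)
    moreover have "Hinf_norm f \<le> exp 1 * c * W"
      unfolding Hinf_norm_def using f_le i_in_uhp by (intro cSUP_least) auto
    ultimately show ?thesis by (auto simp: interpolates_def W_def)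
  qed
  hence "interpolating N z" unfolding interpolating_def by blast
  hence "interp_const N z = Inf {ereal C | C::real. \<forall>w. bounded_data N w \<longrightarrow>
            (\<exists>f. interpolates N z w f \<and> Hinf_norm f \<le> C * data_norm N w)}"
    by (simp add: interp_const_def)
  also have "\<dots> \<le> ereal (exp 1 * c)"
    using solve by (intro Inf_lower) auto
  finally show ?thesis by (simp add: c)
qed

theorem interp_const_le_cJ:
  assumes Z: "uhp_seq N z"
  shows "interp_const N z \<le> ereal (exp 1) * cJ N z"
proof -
  have "interp_const N z / ereal (exp 1) \<le> cJ N z"
    unfolding cJ_def using interp_const_le_cJ_of[OF Z]
    by (intro Inf_greatest) (auto simp: ereal_divide_le_pos)
  thus ?thesis by (simp add: ereal_divide_le_pos)
qed

section \<open>Residues and the mean of the Cauchy kernel\<close>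

lemma Cauchy_formula_partial_fractions:
  assumes A: "finite A" "A \<subseteq> ball 0 \<rho>" and \<rho>: "0 < \<rho>" "\<rho> < 1" and f: "f holomorphic_on ball 0 1"
  shows "contour_integral (circlepath 0 \<rho>) (\<lambda>w. f w / (\<Prod>a\<in>A. w - a))
    = 2 * pi * \<i> * (\<Sum>a\<in>A. f a / (\<Prod>b\<in>A-{a}. a - b))"
proof -
  let ?g = "\<lambda>w. f w / (\<Prod>a\<in>A. w - a)"
  have "contour_integral (circlepath 0 \<rho>) ?g
      = 2 * pi * \<i> * (\<Sum>p\<in>A. winding_number (circlepath 0 \<rho>) p * residue ?g p)"
  proof (rule Residue_theorem[where S = "ball 0 1"])
    show "?g holomorphic_on ball 0 1 - A"
      using A f by (intro holomorphic_intros) (auto intro: holomorphic_on_subset)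
    show "path_image (circlepath 0 \<rho>) \<subseteq> ball 0 1 - A"
      using A \<rho> by (auto simp: path_image_circlepath)
    show "\<forall>z. z \<notin> ball 0 1 \<longrightarrow> winding_number (circlepath 0 \<rho>) z = 0"
      using \<rho> by (auto intro!: winding_number_zero_outside[of _ "cball 0 \<rho>"] simp: path_image_circlepath)
  qed (use A in auto)
  also have "(\<Sum>p\<in>A. winding_number (circlepath 0 \<rho>) p * residue ?g p) = (\<Sum>a\<in>A. f a / (\<Prod>b\<in>A-{a}. a - b))"
  proof (rule sum.cong)
    fix p assume p: "p \<in> A"
    let ?s = "ball 0 1 - (A - {p})" and ?h = "\<lambda>w. f w / (\<Prod>b\<in>A-{p}. w - b)"
    have "winding_number (circlepath 0 \<rho>) p = 1"
      using p A by (intro winding_number_circlepath) auto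
    moreover have "residue ?g p = residue (\<lambda>w. ?h w / (w - p)) p"
      using p A by (simp add: prod.remove[of A p] divide_divide_eq_left mult.commute)
    moreover have "residue (\<lambda>w. ?h w / (w - p)) p = ?h p"
    proof (rule residue_simple)
      show "open ?s" using A by (intro open_Diff finite_imp_closed) auto
      show "p \<in> ?s" using p A \<rho> by auto
      show "?h holomorphic_on ?s"
        using A f by (intro holomorphic_intros) (auto intro: holomorphic_on_subset)
    qed
    ultimately show "winding_number (circlepath 0 \<rho>) p * residue ?g p = f p / (\<Prod>b\<in>A-{p}. p - b)"
      by simp
  qed auto
  finally show ?thesis .
qed

lemma norm_one_minus_circle_ge:
  assumes "0 \<le> \<kappa>" "\<kappa> \<le> 1"
  shows "1 - \<kappa> \<le> norm (1 - of_real \<kappa> * exp (2 * pi * \<i> * of_real t))"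
    and "2 * sqrt \<kappa> * \<bar>sin (pi * t)\<bar> \<le> norm (1 - of_real \<kappa> * exp (2 * pi * \<i> * of_real t))"
proof -
  let ?e = "exp (2 * pi * \<i> * of_real t)"
  have e: "norm ?e = 1" by (simp add: norm_exp_eq_Re)
  have "norm (1::complex) - norm (of_real \<kappa> * ?e) \<le> norm (1 - of_real \<kappa> * ?e)" by (rule norm_triangle_ineq2)
  thus "1 - \<kappa> \<le> norm (1 - of_real \<kappa> * ?e)" using e assms by (simp add: norm_mult)
  have e2: "?e = cis (2 * (pi * t))" by (simp add: cis_conv_exp mult_ac)
  have cs: "(cos (2 * (pi * t)))\<^sup>2 + (sin (2 * (pi * t)))\<^sup>2 = 1" by simp
  have "(norm (1 - of_real \<kappa> * ?e))\<^sup>2 = (1 - \<kappa> * cos (2 * (pi * t)))\<^sup>2 + (\<kappa> * sin (2 * (pi * t)))\<^sup>2"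
    unfolding e2 by (simp add: cmod_power2)
  also have "\<dots> = 1 - 2 * \<kappa> * cos (2 * (pi * t)) + \<kappa>\<^sup>2 * ((cos (2 * (pi * t)))\<^sup>2 + (sin (2 * (pi * t)))\<^sup>2)"
    by (simp only: power2_eq_square) (simp only: algebra_simps)
  also have "\<dots> = (1 - \<kappa>)\<^sup>2 + 4 * \<kappa> * (sin (pi * t))\<^sup>2"
    unfolding cs unfolding cos_double_sin by (simp add: power2_eq_square algebra_simps)
  finally have "(2 * sqrt \<kappa> * \<bar>sin (pi * t)\<bar>)\<^sup>2 \<le> (norm (1 - of_real \<kappa> * ?e))\<^sup>2"
    using assms by (simp add: power_mult_distrib)
  thus "2 * sqrt \<kappa> * \<bar>sin (pi * t)\<bar> \<le> norm (1 - of_real \<kappa> * ?e)"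
    by (rule power2_le_imp_le) simp
qed

text \<open>
  Away from the point 1 the distance \<open>\<bar>1 - \<kappa> w\<bar>\<close> is compared with \<open>2 sqrt \<kappa> \<bar>sin (pi * t)\<bar>\<close>, whose
  reciprocal has the primitive \<open>ln (tan (pi * t / 2))\<close>; the two parameter intervals of length \<open>1 - \<kappa>\<close> next to
  that point contribute at most 1 each. Only the coefficient of the logarithm matters later.
\<close>

lemma integral_Cauchy_kernel_le:
  assumes \<kappa>: "1/2 < \<kappa>" "\<kappa> < 1"
  shows "integral {0..1} (\<lambda>t. 1 / norm (1 - of_real \<kappa> * exp (2 * pi * \<i> * of_real t)))
    \<le> 2 + ln (1 / (1 - \<kappa>)) / (pi * sqrt \<kappa>)"
proof -
  \<comment> \<open>On \<open>[0, c]\<close> and \<open>[1 - c, 1]\<close> the kernel is bounded by its maximum \<open>1 / c\<close>.\<close>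
  define c where "c = 1 - \<kappa>"
  have c: "0 < c" "c < 1/2" using \<kappa> by (auto simp: c_def)
  let ?f = "\<lambda>t. 1 / norm (1 - of_real \<kappa> * exp (2 * pi * \<i> * of_real t))"
  have pos: "norm (1 - of_real \<kappa> * exp (2 * pi * \<i> * of_real t)) \<ge> c" for t
    using norm_one_minus_circle_ge(1)[of \<kappa> t] \<kappa> by (simp add: c_def)
  have ne: "1 - of_real \<kappa> * exp (2 * pi * \<i> * of_real t) \<noteq> 0" for t
    using pos[of t] c by auto
  have int: "?f integrable_on {a..b}" for a b
    using ne by (intro integrable_continuous_real continuous_intros) auto
  have le1: "?f t \<le> 1 / c" for t using pos[of t] c by (intro divide_left_mono mult_pos_pos) auto
  have "integral {0..c} ?f \<le> integral {0..c} (\<lambda>_. 1 / c)"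
    by (intro integral_le int le1) auto
  hence i1: "integral {0..c} ?f \<le> 1" using c by simp
  have "integral {1-c..1} ?f \<le> integral {1-c..1} (\<lambda>_. 1 / c)"
    by (intro integral_le int le1) auto
  hence i3: "integral {1-c..1} ?f \<le> 1" using c by simp
  let ?G = "\<lambda>t. ln (tan (pi * t / 2)) / (2 * pi * sqrt \<kappa>)"
  have sinpos: "sin (pi * t) > 0" if "t \<in> {c..1-c}" for t
    using that c by (intro sin_gt_zero) auto
  have "((\<lambda>t. 1 / (2 * sqrt \<kappa> * sin (pi * t))) has_integral (?G (1-c) - ?G c)) {c..1-c}"
  proof (rule fundamental_theorem_of_calculus)
    fix t assume t: "t \<in> {c..1-c}"
    have t': "pi * t / 2 > 0" "pi * t / 2 < pi / 2" using t c by auto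
    have co: "cos (pi * t / 2) > 0" using t' by (intro cos_gt_zero) auto
    have si: "sin (pi * t / 2) > 0" using t' by (intro sin_gt_zero) auto
    have dbl: "sin (pi * t) = 2 * sin (pi * t / 2) * cos (pi * t / 2)"
      using sin_double[of "pi * t / 2"] by simp
    have "(?G has_real_derivative (1 / (2 * sqrt \<kappa> * sin (pi * t)))) (at t)"
    proof (rule DERIV_cong)
      show "(?G has_real_derivative
          (inverse ((cos (pi * t / 2))\<^sup>2) * (pi / 2) / tan (pi * t / 2)) / (2 * pi * sqrt \<kappa>)) (at t)"
        using co tan_gt_zero[OF t'] by (intro DERIV_cdivide) (auto intro!: derivative_eq_intros)
      show "(inverse ((cos (pi * t / 2))\<^sup>2) * (pi / 2) / tan (pi * t / 2)) / (2 * pi * sqrt \<kappa>)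
          = 1 / (2 * sqrt \<kappa> * sin (pi * t))"
        using co si \<kappa> unfolding dbl by (simp add: power2_eq_square tan_def field_simps)
    qed
    thus "(?G has_vector_derivative (1 / (2 * sqrt \<kappa> * sin (pi * t)))) (at t within {c..1-c})"
      by (simp add: has_real_derivative_iff_has_vector_derivative has_vector_derivative_at_within)
  qed (use c in auto)
  moreover have "?f t \<le> 1 / (2 * sqrt \<kappa> * sin (pi * t))" if "t \<in> {c..1-c}" for t
    using norm_one_minus_circle_ge(2)[of \<kappa> t] sinpos[OF that] \<kappa> ne[of t]
    by (intro divide_left_mono mult_pos_pos) auto
  ultimately have i2: "integral {c..1-c} ?f \<le> ?G (1-c) - ?G c"
    using int[of c "1-c"] by (meson has_integral_le integrable_integral)
  have "pi * (1 - c) / 2 = pi / 2 - pi * c / 2" by (simp add: field_simps)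
  hence cot: "tan (pi * (1 - c) / 2) = inverse (tan (pi * c / 2))"
    by (simp only: tan_cot)
  have tan: "tan (pi * c / 2) \<ge> pi * c / 2"
  proof -
    have *: "0 < pi * c / 2" "pi * c / 2 < pi / 2" using c by auto
    have "arctan (pi * c / 2) \<le> pi * c / 2"
      using arctan_le_self[of "pi * c / 2"] * by linarith
    hence "tan (arctan (pi * c / 2)) \<le> tan (pi * c / 2)"
      using * arctan_bounded by (intro tan_mono_le) auto
    thus ?thesis by (simp add: tan_arctan)
  qed
  have tpos: "tan (pi * c / 2) > 0" using tan c by (smt (verit) divide_pos_pos mult_pos_pos pi_gt_zero)
  have "?G (1-c) - ?G c = - ln (tan (pi * c / 2)) / (pi * sqrt \<kappa>)"
    unfolding cot ln_inverse using \<kappa> by (simp add: field_simps)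
  also have "\<dots> \<le> - ln c / (pi * sqrt \<kappa>)"
  proof -
    have "c \<le> pi * c / 2" using pi_ge_two c by (simp add: field_simps)
    hence "c \<le> tan (pi * c / 2)" using tan by linarith
    hence "ln c \<le> ln (tan (pi * c / 2))" using c tpos by simp
    thus ?thesis using \<kappa> by (intro divide_right_mono) auto
  qed
  also have "- ln c = ln (1 / c)" using c by (simp add: ln_div)
  finally have i2': "integral {c..1-c} ?f \<le> ln (1/c) / (pi * sqrt \<kappa>)" using i2 by linarith
  have "integral {0..1} ?f = integral {0..c} ?f + integral {c..1} ?f"
    using c by (intro Henstock_Kurzweil_Integration.integral_combine[symmetric] int) auto
  also have "integral {c..1} ?f = integral {c..1-c} ?f + integral {1-c..1} ?f"
    using c by (intro Henstock_Kurzweil_Integration.integral_combine[symmetric] int) auto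
  finally show ?thesis using i1 i2' i3 by (simp add: c_def)
qed

section \<open>A dual lower bound for interpolation in the disc\<close>

text \<open>
  A finite Blaschke product has modulus 1 on the unit circle and is uniformly continuous on a closed
  annulus next to it. Working on circles of radius below 1 avoids the boundary values of a bounded
  holomorphic function, which exist only almost everywhere.
\<close>

lemma Blaschke_product_uniform_near_circle:
  fixes A :: "real set"
  assumes A: "finite A" "A \<subseteq> {-1<..<1}" and e: "e > 0"
  shows "\<forall>\<^sub>F \<rho> in at_left 1. \<forall>w::complex. norm w = \<rho> \<longrightarrow>
      norm ((\<Prod>a\<in>A. 1 - of_real a * w) / (\<Prod>a\<in>A. w - of_real a)) \<le> 1 + e"
proof -
  obtain r where r: "0 < r" "r < 1" "\<And>a. a \<in> A \<Longrightarrow> \<bar>a\<bar> < r"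
  proof -
    let ?m = "Max (insert 0 (abs ` A))"
    have "\<bar>a\<bar> < 1" if "a \<in> A" for a using A(2) that by (auto simp: abs_less_iff)
    hence "?m < 1" using A by (subst Max_less_iff) auto
    moreover have "\<bar>a\<bar> \<le> ?m" if "a \<in> A" for a using A that by (intro Max_ge) auto
    moreover have "0 \<le> ?m" using A by (intro Max_ge) auto
    ultimately show ?thesis using that[of "(?m + 1) / 2"] by fastforce
  qed
  define Q where "Q = (\<lambda>w::complex. norm ((\<Prod>a\<in>A. 1 - of_real a * w) / (\<Prod>a\<in>A. w - of_real a)))"
  define K where "K = cball (0::complex) 1 - ball 0 r"
  have K: "compact K" unfolding K_def by (intro compact_diff) auto
  have ne: "(\<Prod>a\<in>A. w - of_real a) \<noteq> 0" if "w \<in> K" for w :: complex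
    using that r(3) A unfolding K_def by force
  have "continuous_on K Q"
    unfolding Q_def using ne by (intro continuous_intros) auto
  hence "uniformly_continuous_on K Q" using K by (rule compact_uniformly_continuous)
  then obtain d where d: "d > 0" "\<And>x y. x \<in> K \<Longrightarrow> y \<in> K \<Longrightarrow> dist y x < d \<Longrightarrow> dist (Q y) (Q x) < e"
    unfolding uniformly_continuous_on_def using e by meson
  have Q1: "Q w = 1" if "norm w = 1" for w
  proof -
    have "norm (1 - of_real a * w) = norm (w - of_real a)" for a
    proof -
      have "w * cnj w = 1" using complex_norm_square[of w] that by simp
      hence "1 - of_real a * w = w * cnj (w - of_real a)" by (simp add: algebra_simps)
      thus ?thesis using that by (simp add: norm_mult del: complex_cnj_diff)
    qed
    hence "norm (\<Prod>a\<in>A. 1 - of_real a * w) = norm (\<Prod>a\<in>A. w - of_real a)"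
      by (simp add: prod_norm[symmetric])
    moreover have "w \<in> K" using that r by (simp add: K_def)
    ultimately show ?thesis using ne[of w] unfolding Q_def norm_divide by simp
  qed
  have "\<forall>\<^sub>F \<rho> in at_left 1. \<rho> \<in> {max r (1 - d)<..<1}"
    using r d by (intro eventually_at_left_real) auto
  thus ?thesis
  proof eventually_elim
    case (elim \<rho>)
    show ?case
    proof (intro allI impI)
      fix w :: complex assume w: "norm w = \<rho>"
      let ?v = "sgn w"
      have nv: "norm ?v = 1" using w elim r by (auto simp: norm_sgn)
      have "w = of_real \<rho> * ?v" using w elim r by (auto simp: sgn_eq)
      hence "?v - w = of_real (1 - \<rho>) * ?v" by (simp add: algebra_simps)
      hence "norm (?v - w) = \<bar>1 - \<rho>\<bar>" using nv by (metis mult.right_neutral norm_mult norm_of_real)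
      hence "dist w ?v < d" using elim by (simp add: dist_norm norm_minus_commute)
      moreover have "w \<in> K" "?v \<in> K" using w nv elim r by (auto simp: K_def)
      ultimately have "dist (Q w) (Q ?v) < e" using d by blast
      hence "Q w \<le> 1 + e" using Q1[OF nv] unfolding dist_real_def by linarith
      thus "norm ((\<Prod>a\<in>A. 1 - of_real a * w) / (\<Prod>a\<in>A. w - of_real a)) \<le> 1 + e"
        by (simp only: Q_def)
    qed
  qed
qed

text \<open>
  Integrate \<open>F(w) / (B(w) (1 - \<kappa> w))\<close> over a circle of radius \<open>\<rho> < 1\<close>. The prescribed
  signs cancel those of the derivative of the Blaschke product \<open>B\<close>, so all residues are nonnegative.
  On the circle \<open>\<bar>1 / B\<bar>\<close> is close to 1, which leaves the mean of \<open>1 / \<bar>1 - \<kappa> w\<bar>\<close>; finally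
  \<open>\<rho> \<longlonglongrightarrow> 1\<close>.
\<close>

lemma interpolation_duality_disc:
  fixes A :: "real set"
  assumes A: "finite A" "A \<subseteq> {-1<..<1}" and F: "F holomorphic_on ball 0 1"
    and M: "\<And>w. norm w < 1 \<Longrightarrow> norm (F w) \<le> M"
    and data: "\<And>a. a \<in> A \<Longrightarrow> F (of_real a) = of_real (sgn (\<Prod>b\<in>A-{a}. a - b))"
    and \<kappa>: "1/2 < \<kappa>" "\<kappa> < 1"
  shows "(\<Sum>a\<in>A. (1 - a\<^sup>2) / (1 - \<kappa> * a) / (\<Prod>b\<in>A-{a}. \<bar>(a - b) / (1 - a * b)\<bar>))
    \<le> M * (2 + ln (1 / (1 - \<kappa>)) / (pi * sqrt \<kappa>))"
proof -
  define L where "L = (\<Sum>a\<in>A. (1 - a\<^sup>2) / (1 - \<kappa> * a) / (\<Prod>b\<in>A-{a}. \<bar>(a - b) / (1 - a * b)\<bar>))"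
  have A1: "\<bar>a\<bar> < 1" if "a \<in> A" for a using A(2) that by (force simp: abs_less_iff)
  have M0: "M \<ge> 0" using order_trans[OF norm_ge_zero M[of 0]] by simp
  let ?A = "complex_of_real ` A"
  \<comment> \<open>The integrand is \<open>N\<close> divided by \<open>\<Prod>a\<in>A. w - a\<close>, that is \<open>F / (B (1 - \<kappa> w))\<close>.\<close>
  define N where "N = (\<lambda>w. F w * (\<Prod>a\<in>A. 1 - of_real a * w) / (1 - of_real \<kappa> * w))"
  have \<kappa>w: "1 - of_real \<kappa> * w \<noteq> 0" if "norm w < 1" for w :: complex
  proof
    assume "1 - of_real \<kappa> * w = 0"
    hence "norm (of_real \<kappa> * w) = 1" by (metis eq_iff_diff_eq_0 norm_one)
    thus False using that \<kappa> mult_strict_mono[of \<kappa> 1 "norm w" 1] by (simp add: norm_mult)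
  qed
  have N: "N holomorphic_on ball 0 1"
    unfolding N_def using F \<kappa>w by (intro holomorphic_intros) auto
  have summand: "N (of_real a) / (\<Prod>b\<in>?A-{of_real a}. of_real a - b)
      = of_real ((1 - a\<^sup>2) / (1 - \<kappa> * a) / (\<Prod>b\<in>A-{a}. \<bar>(a - b) / (1 - a * b)\<bar>))" if a: "a \<in> A" for a
  proof -
    let ?p = "\<Prod>b\<in>A-{a}. a - b" and ?n = "\<Prod>b\<in>A-{a}. 1 - a * b"
    have pos: "1 - a * b > 0" if "b \<in> A" for b
    proof -
      have "a \<in> {-1<..<1}" "b \<in> {-1<..<1}" using A(2) a that by blast+
      hence "\<bar>a\<bar> < 1" "\<bar>b\<bar> < 1" by (simp_all add: abs_less_iff)
      hence "\<bar>a * b\<bar> < 1" using abs_mult_less[of a 1 b 1] by (simp add: abs_mult)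
      thus ?thesis by linarith
    qed
    have img: "?A - {of_real a} = complex_of_real ` (A - {a})" by auto
    have "(\<Prod>b\<in>?A-{of_real a}. of_real a - b) = of_real ?p"
      unfolding img by (subst prod.reindex) (auto simp: inj_on_def)
    moreover have "(\<Prod>b\<in>A. 1 - of_real b * of_real a) = complex_of_real ((1 - a\<^sup>2) * ?n)"
      using a A by (subst prod.remove[of A a]) (auto simp: power2_eq_square mult.commute)
    ultimately have "N (of_real a) / (\<Prod>b\<in>?A-{of_real a}. of_real a - b)
        = of_real (sgn ?p * ((1 - a\<^sup>2) * ?n) / (1 - \<kappa> * a) / ?p)"
      unfolding N_def data[OF a] by (simp only: of_real_mult of_real_divide of_real_diff of_real_1)
    moreover have "(\<Prod>b\<in>A-{a}. \<bar>(a - b) / (1 - a * b)\<bar>) = \<bar>?p\<bar> / ?n"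
    proof -
      have "(\<Prod>b\<in>A-{a}. \<bar>(a - b) / (1 - a * b)\<bar>) = (\<Prod>b\<in>A-{a}. \<bar>a - b\<bar> / (1 - a * b))"
        using pos by (intro prod.cong) (auto simp: abs_divide abs_of_pos)
      thus ?thesis by (simp add: prod_dividef abs_prod)
    qed
    moreover have "?p \<noteq> 0" using A by auto
    ultimately show ?thesis by (simp add: sgn_real_def)
  qed
  have main: "L \<le> M * (1 + e) * (2 + ln (1 / (1 - \<kappa> * \<rho>)) / (pi * sqrt (\<kappa> * \<rho>)))"
    if \<rho>: "0 < \<rho>" "\<rho> < 1" "A \<subseteq> {-\<rho><..<\<rho>}" "1/2 < \<kappa> * \<rho>" and e: "e > 0"
      and B: "\<And>w::complex. norm w = \<rho> \<Longrightarrow> norm ((\<Prod>a\<in>A. 1 - of_real a * w) / (\<Prod>a\<in>A. w - of_real a)) \<le> 1 + e"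
    for \<rho> e
  proof -
    have "\<bar>a\<bar> < \<rho>" if "a \<in> A" for a using \<rho>(3) that by (force simp: abs_less_iff)
    hence "?A \<subseteq> ball 0 \<rho>" by auto
    hence "contour_integral (circlepath 0 \<rho>) (\<lambda>w. N w / (\<Prod>a\<in>?A. w - a))
        = 2 * pi * \<i> * (\<Sum>a\<in>?A. N a / (\<Prod>b\<in>?A-{a}. a - b))"
      using A \<rho> N by (intro Cauchy_formula_partial_fractions) auto
    also have "(\<Sum>a\<in>?A. N a / (\<Prod>b\<in>?A-{a}. a - b)) = of_real L"
      by (subst sum.reindex) (auto simp: inj_on_def summand L_def)
    finally have "contour_integral (circlepath 0 \<rho>) (\<lambda>w. N w / (\<Prod>a\<in>?A. w - a)) = 2 * pi * \<i> * of_real L" .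
    moreover have "contour_integral (circlepath 0 \<rho>) (\<lambda>w. N w / (\<Prod>a\<in>?A. w - a))
        = integral {0..1} (\<lambda>t. N (circlepath 0 \<rho> t) / (\<Prod>a\<in>?A. circlepath 0 \<rho> t - a) *
            vector_derivative (circlepath 0 \<rho>) (at t))"
      by (simp add: contour_integral_integral)
    ultimately have "2 * pi * L \<le> norm (integral {0..1} (\<lambda>t. N (circlepath 0 \<rho> t) / (\<Prod>a\<in>?A. circlepath 0 \<rho> t - a) *
            vector_derivative (circlepath 0 \<rho>) (at t)))"
      by (simp add: norm_mult)
    also have "\<dots> \<le> integral {0..1} (\<lambda>t. 2 * pi * (M * (1 + e)) * (1 / norm (1 - of_real (\<kappa> * \<rho>) * exp (2 * pi * \<i> * of_real t))))"
    proof (rule integral_norm_bound_integral)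
      let ?w = "\<lambda>t. circlepath 0 \<rho> t"
      have nw: "norm (?w t) = \<rho>" for t using \<rho> by (simp add: circlepath norm_mult norm_exp_eq_Re)
      have w: "?w t = of_real \<rho> * exp (2 * pi * \<i> * of_real t)" for t by (simp add: circlepath)
      have c: "continuous_on {0..1} ?w" unfolding circlepath by (intro continuous_intros)
      have prod_eq: "(\<Prod>a\<in>?A. v - a) = (\<Prod>a\<in>A. v - of_real a)" for v
        by (subst prod.reindex) (auto simp: inj_on_def)
      have ne: "(\<Prod>a\<in>?A. ?w t - a) \<noteq> 0" for t
      proof
        assume "(\<Prod>a\<in>?A. ?w t - a) = 0"
        then obtain a where "a \<in> A" "?w t = of_real a" using A by (auto simp: prod_zero_iff)
        hence "\<bar>a\<bar> = \<rho>" using nw[of t] by simp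
        thus False using \<rho> \<open>a \<in> A\<close> by fastforce
      qed
      have cN: "continuous_on {0..1} (\<lambda>t. N (?w t))"
        using nw \<rho> by (intro continuous_on_compose2[OF holomorphic_on_imp_continuous_on[OF N] c]) auto
      show "(\<lambda>t. N (?w t) / (\<Prod>a\<in>?A. ?w t - a) * vector_derivative ?w (at t)) integrable_on {0..1}"
        using ne by (intro integrable_continuous_real continuous_intros cN c) (auto simp: vector_derivative_circlepath intro!: continuous_intros)
      have ne2: "1 - of_real (\<kappa> * \<rho>) * exp (2 * pi * \<i> * of_real t) \<noteq> 0" for t
        using \<kappa>w[of "?w t"] nw[of t] \<rho> by (simp add: w mult.assoc)
      show "(\<lambda>t. 2 * pi * (M * (1 + e)) * (1 / norm (1 - of_real (\<kappa> * \<rho>) * exp (2 * pi * \<i> * of_real t)))) integrable_on {0..1}"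
        using ne2 by (intro integrable_continuous_real continuous_intros) auto
      show "norm (N (?w t) / (\<Prod>a\<in>?A. ?w t - a) * vector_derivative ?w (at t))
          \<le> 2 * pi * (M * (1 + e)) * (1 / norm (1 - of_real (\<kappa> * \<rho>) * exp (2 * pi * \<i> * of_real t)))" for t
      proof -
        have "norm (vector_derivative ?w (at t)) = 2 * pi * \<rho>"
          using \<rho> by (simp add: vector_derivative_circlepath norm_mult norm_exp_eq_Re)
        moreover have "norm (N (?w t) / (\<Prod>a\<in>?A. ?w t - a)) = norm (F (?w t)) *
            norm ((\<Prod>a\<in>A. 1 - of_real a * ?w t) / (\<Prod>a\<in>A. ?w t - of_real a)) / norm (1 - of_real \<kappa> * ?w t)"
          unfolding N_def prod_eq by (simp add: norm_mult norm_divide)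
        moreover have "\<dots> \<le> M * (1 + e) / norm (1 - of_real \<kappa> * ?w t)"
          using M[of "?w t"] B[OF nw[of t]] nw[of t] \<rho> M0 by (intro divide_right_mono mult_mono) auto
        ultimately have "norm (N (?w t) / (\<Prod>a\<in>?A. ?w t - a) * vector_derivative ?w (at t))
            \<le> M * (1 + e) / norm (1 - of_real \<kappa> * ?w t) * (2 * pi * \<rho>)"
          unfolding norm_mult using \<rho> by (metis mult_right_mono norm_ge_zero)
        also have "\<dots> \<le> M * (1 + e) / norm (1 - of_real \<kappa> * ?w t) * (2 * pi * 1)"
          using \<rho> M0 e by (intro mult_left_mono) auto
        finally show ?thesis by (simp add: w mult_ac)
      qed
    qed
    also have "\<dots> = 2 * pi * (M * (1 + e)) * integral {0..1} (\<lambda>t. (1 / norm (1 - of_real (\<kappa> * \<rho>) * exp (2 * pi * \<i> * of_real t))))"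
      by (rule integral_mult_right)
    also have "\<dots> \<le> 2 * pi * (M * (1 + e)) * (2 + ln (1 / (1 - \<kappa> * \<rho>)) / (pi * sqrt (\<kappa> * \<rho>)))"
      using \<rho> \<kappa> M0 e mult_strict_mono[of \<kappa> 1 \<rho> 1] by (intro mult_left_mono integral_Cauchy_kernel_le) auto
    finally have "2 * pi * L \<le> 2 * pi * (M * (1 + e) * (2 + ln (1 / (1 - \<kappa> * \<rho>)) / (pi * sqrt (\<kappa> * \<rho>))))"
      by (simp only: mult.assoc)
    thus ?thesis by (subst (asm) mult_le_cancel_left_pos) auto
  qed
  have eps: "L \<le> M * (1 + e) * (2 + ln (1 / (1 - \<kappa>)) / (pi * sqrt \<kappa>))" if e: "e > 0" for e
  proof (rule tendsto_lowerbound)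
    have "((\<lambda>\<rho>. \<rho>) \<longlongrightarrow> (1::real)) (at_left 1)" by (rule tendsto_ident_at)
    hence "((\<lambda>\<rho>. M * (1 + e) * (2 + ln (1 / (1 - \<kappa> * \<rho>)) / (pi * sqrt (\<kappa> * \<rho>))))
      \<longlongrightarrow> M * (1 + e) * (2 + ln (1 / (1 - \<kappa> * 1)) / (pi * sqrt (\<kappa> * 1)))) (at_left 1)"
      using \<kappa> by (intro tendsto_intros) auto
    thus "((\<lambda>\<rho>. M * (1 + e) * (2 + ln (1 / (1 - \<kappa> * \<rho>)) / (pi * sqrt (\<kappa> * \<rho>))))
      \<longlongrightarrow> M * (1 + e) * (2 + ln (1 / (1 - \<kappa>)) / (pi * sqrt \<kappa>))) (at_left 1)" by simp
    have ev: "\<forall>\<^sub>F \<rho> in at_left 1. \<rho> \<in> {Max (insert (1 / (2 * \<kappa>)) (abs ` A))<..<1}"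
      using A(1) A1 \<kappa> by (intro eventually_at_left_real) (auto simp: field_simps)
    show "\<forall>\<^sub>F \<rho> in at_left 1. L \<le> M * (1 + e) * (2 + ln (1 / (1 - \<kappa> * \<rho>)) / (pi * sqrt (\<kappa> * \<rho>)))"
      using ev Blaschke_product_uniform_near_circle[OF A e]
    proof eventually_elim
      case (elim \<rho>)
      have 1: "1 / (2 * \<kappa>) < \<rho>" "\<And>a. a \<in> A \<Longrightarrow> \<bar>a\<bar> < \<rho>" using elim(1) A by (auto simp: Max_less_iff)
      have "0 < 1 / (2 * \<kappa>)" using \<kappa> by simp
      hence "0 < \<rho>" using 1 by linarith
      moreover have "A \<subseteq> {-\<rho><..<\<rho>}" using 1(2) by (force simp: abs_less_iff)
      moreover have "1/2 < \<kappa> * \<rho>" using 1(1) \<kappa> by (simp add: field_simps)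
      ultimately show ?case using elim e by (intro main) auto
    qed
  qed auto
  show ?thesis
    unfolding L_def[symmetric]
  proof (rule tendsto_lowerbound)
    have "((\<lambda>e. M * (1 + e) * (2 + ln (1 / (1 - \<kappa>)) / (pi * sqrt \<kappa>)))
      \<longlongrightarrow> M * (1 + 0) * (2 + ln (1 / (1 - \<kappa>)) / (pi * sqrt \<kappa>))) (at_right 0)"
      using \<kappa> by (intro tendsto_intros) auto
    thus "((\<lambda>e. M * (1 + e) * (2 + ln (1 / (1 - \<kappa>)) / (pi * sqrt \<kappa>)))
      \<longlongrightarrow> M * (2 + ln (1 / (1 - \<kappa>)) / (pi * sqrt \<kappa>))) (at_right 0)" by simp
    show "\<forall>\<^sub>F e in at_right 0. L \<le> M * (1 + e) * (2 + ln (1 / (1 - \<kappa>)) / (pi * sqrt \<kappa>))"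
      using eps by (auto simp: eventually_at_filter)
  qed auto
qed

section \<open>Lower bound for the constant of a geometric sequence\<close>

text \<open>
  The Blaschke value of one end point of \<open>n + 1\<close> consecutive points \<open>\<i> r^j\<close>.
\<close>

definition qprod :: "real \<Rightarrow> nat \<Rightarrow> real" where
  "qprod r n = (\<Prod>l=1..n. (r ^ l - 1) / (r ^ l + 1))"

lemma qprod_pos: "r > 1 \<Longrightarrow> qprod r n > 0"
  unfolding qprod_def by (intro prod_pos divide_pos_pos) (auto simp: add_pos_pos)

lemma qprod_antimono:
  assumes "r > 1" "m \<le> n"
  shows "qprod r n \<le> qprod r m"
  using assms(2)
proof (induction n rule: dec_induct)
  case (step n)
  have "qprod r (Suc n) = qprod r n * ((r ^ Suc n - 1) / (r ^ Suc n + 1))"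
    by (simp add: qprod_def)
  also have "\<dots> \<le> qprod r n * 1"
    using qprod_pos[OF assms(1), of n] assms(1) 
    by (intro mult_left_mono) (auto simp: divide_le_eq add_pos_pos)
  finally show ?case using step by simp
qed auto

lemma qprod_limit:
  assumes r: "r > 1"
  obtains L where "L > 0" "qprod r \<longlonglongrightarrow> L" "\<And>n. L \<le> qprod r n"
proof -
  define f where "f = (\<lambda>l. (r ^ Suc l - 1) / (r ^ Suc l + 1))"
  have f: "f l = 1 + (- 2 / (r ^ Suc l + 1))" for l
    using r add_pos_pos[of "r ^ Suc l" 1] by (simp add: f_def field_simps)
  have "summable (\<lambda>l. norm (- 2 / (r ^ Suc l + 1)))"
  proof (rule summable_comparison_test)
    show "\<exists>N. \<forall>l\<ge>N. norm (norm (- 2 / (r ^ Suc l + 1))) \<le> 2 * (1 / r) ^ l"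
    proof (intro exI allI impI)
      fix l
      have "r ^ l \<le> r ^ Suc l" using r by (intro power_increasing) auto
      hence "r ^ l \<le> r ^ Suc l + 1" by linarith
      hence "2 / (r ^ Suc l + 1) \<le> 2 / r ^ l" using r by (intro divide_left_mono mult_pos_pos) (auto simp: add_pos_pos)
      thus "norm (norm (- 2 / (r ^ Suc l + 1))) \<le> 2 * (1 / r) ^ l"
        using r add_pos_pos[of "r ^ Suc l" 1] by (simp add: power_divide)
    qed
    show "summable (\<lambda>l. 2 * (1 / r) ^ l)" using r by (intro summable_mult summable_geometric) auto
  qed
  hence "summable (\<lambda>l. norm (f l - 1))" by (simp add: f)
  hence "abs_convergent_prod f" by (rule summable_imp_abs_convergent_prod)
  hence cp: "convergent_prod f" by (rule abs_convergent_prod_imp_convergent_prod)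
  have fpos: "f l > 0" for l
    using r one_less_power[of r "Suc l"] unfolding f_def by (intro divide_pos_pos) auto
  have part: "(\<Prod>i\<le>n. f i) = qprod r (Suc n)" for n
    unfolding qprod_def f_def by (rule prod.reindex_bij_witness[of _ "\<lambda>l. l - 1" Suc]) auto
  have lim: "qprod r \<longlonglongrightarrow> prodinf f"
    using convergent_prod_LIMSEQ[OF cp] unfolding part by (rule LIMSEQ_imp_Suc)
  have le: "prodinf f \<le> qprod r n" for n
    using lim by (rule decseq_ge[rotated]) (auto simp: decseq_def qprod_antimono[OF r])
  have "prodinf f \<noteq> 0" using fpos by (intro prodinf_nonzero[OF cp]) (metis less_irrefl)
  moreover have "prodinf f \<ge> 0"
    using qprod_pos[OF r] by (intro LIMSEQ_le_const[OF lim]) (auto intro: less_imp_le)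
  ultimately have "prodinf f > 0" by simp
  thus ?thesis using lim le by (rule that)
qed

text \<open>
  The pseudohyperbolic distance of \<open>\<i> r^j\<close> and \<open>\<i> r^k\<close> depends only on \<open>\<bar>j - k\<bar>\<close>.
\<close>

lemma prod_geometric_pseudohyp:
  assumes r: "r > 1" and j: "j \<le> n"
  shows "(\<Prod>k\<in>{..n}-{j}. \<bar>r ^ j - r ^ k\<bar> / (r ^ j + r ^ k)) = qprod r j * qprod r (n - j)"
proof -
  let ?g = "\<lambda>k. \<bar>r ^ j - r ^ k\<bar> / (r ^ j + r ^ k)"
  have split: "{..n} - {j} = {..<j} \<union> {j<..n}" using j by auto
  have "(\<Prod>k<j. ?g k) = qprod r j"
    unfolding qprod_def
  proof (rule prod.reindex_bij_witness[of _ "\<lambda>l. j - l" "\<lambda>k. j - k"])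
    fix k assume "k \<in> {..<j}"
    hence k: "k < j" by simp
    have e: "r ^ j = r ^ (j - k) * r ^ k" using k by (simp flip: power_add)
    have p: "r ^ k > 0" "r ^ (j - k) > 1" using r k by auto
    have "(r ^ (j - k) - 1) * r ^ k = \<bar>r ^ j - r ^ k\<bar>" using p unfolding e by (simp add: algebra_simps)
    moreover have "(r ^ (j - k) + 1) * r ^ k = r ^ j + r ^ k" unfolding e by (simp add: algebra_simps)
    ultimately show "(r ^ (j - k) - 1) / (r ^ (j - k) + 1) = ?g k"
      using p by (metis less_irrefl mult_divide_mult_cancel_right)
  qed auto
  moreover have "(\<Prod>k\<in>{j<..n}. ?g k) = qprod r (n - j)"
    unfolding qprod_def
  proof (rule prod.reindex_bij_witness[of _ "\<lambda>l. l + j" "\<lambda>k. k - j"])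
    fix k assume "k \<in> {j<..n}"
    hence k: "j < k" by simp
    have e: "r ^ k = r ^ (k - j) * r ^ j" using k by (simp flip: power_add)
    have p: "r ^ j > 0" "r ^ (k - j) > 1" using r k by auto
    have "(r ^ (k - j) - 1) * r ^ j = \<bar>r ^ j - r ^ k\<bar>" using p unfolding e by (simp add: algebra_simps abs_if mult_less_cancel_left)
    moreover have "(r ^ (k - j) + 1) * r ^ j = r ^ j + r ^ k" unfolding e by (simp add: algebra_simps)
    ultimately show "(r ^ (k - j) - 1) / (r ^ (k - j) + 1) = ?g k"
      using p by (metis less_irrefl mult_divide_mult_cancel_right)
  qed auto
  ultimately show ?thesis unfolding split by (subst prod.union_disjoint) auto
qed

text \<open>
  For \<open>1 / s\<close> and \<open>\<tau> s\<close> both small, that is, for points in the middle of the sequence, the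
  normalised test function takes a value close to 2.
\<close>

lemma Cayley_kernel_lower_bound:
  fixes s \<tau> q :: real
  assumes s: "s \<ge> 1" and \<tau>: "0 < \<tau>" "\<tau> < 1" and q: "1 / s \<le> q" "\<tau> * s \<le> q"
  defines "x \<equiv> (s - 1) / (s + 1)"
  shows "2 / (1 + q)\<^sup>2 \<le> (1 - x\<^sup>2) / (1 - (1 - \<tau>) * x)"
proof -
  have q0: "q > 0" using q s by (smt (verit) divide_pos_pos)
  have "s + 1 \<le> s * (1 + q)" using q s by (simp add: field_simps)
  moreover have "2 + \<tau> * (s - 1) \<le> 2 * (1 + q)" using q q0 \<tau> by (simp add: algebra_simps)
  ultimately have "(s + 1) * (2 + \<tau> * (s - 1)) \<le> (s * (1 + q)) * (2 * (1 + q))"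
    using s q0 \<tau> by (intro mult_mono) auto
  moreover have pos: "2 + \<tau> * (s - 1) > 0" using s \<tau> by (simp add: add_pos_nonneg)
  ultimately have "4 * s / ((s * (1 + q)) * (2 * (1 + q))) \<le> 4 * s / ((s + 1) * (2 + \<tau> * (s - 1)))"
    using s q0 by (intro divide_left_mono mult_pos_pos) auto
  also have "4 * s / ((s * (1 + q)) * (2 * (1 + q))) = 2 / (1 + q)\<^sup>2"
    using s q0 by (simp add: power2_eq_square divide_simps)
  also have "1 - x\<^sup>2 = 4 * s / (s + 1)\<^sup>2"
    using s unfolding x_def by (simp add: power2_eq_square divide_simps) (simp add: algebra_simps)
  moreover have "1 - (1 - \<tau>) * x = (2 + \<tau> * (s - 1)) / (s + 1)"
    using s unfolding x_def by (simp add: divide_simps) (simp add: algebra_simps)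
  ultimately have "2 / (1 + q)\<^sup>2 \<le> 4 * s / ((s + 1) * (2 + \<tau> * (s - 1)))"
    "(1 - x\<^sup>2) / (1 - (1 - \<tau>) * x) = 4 * s / (s + 1)\<^sup>2 / ((2 + \<tau> * (s - 1)) / (s + 1))"
    by simp_all
  moreover have "4 * s / (s + 1)\<^sup>2 / ((2 + \<tau> * (s - 1)) / (s + 1)) = 4 * s / ((s + 1) * (2 + \<tau> * (s - 1)))"
    using s by (simp add: power2_eq_square)
  ultimately show ?thesis by simp
qed

lemma seq_index_Suc: "seq_index (enat (Suc n)) = {..n}"
  by (auto simp: seq_index_def)

lemma Cayley_maps_ball_to_uhp:
  assumes "norm v < 1"
  shows "\<i> * (1 + v) / (1 - v) \<in> uhp"
proof -
  have "v \<noteq> 1" using assms by auto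
  have "(norm v)\<^sup>2 < 1" using assms by (simp add: power_less_one_iff)
  hence "0 < 1 - (Re v)\<^sup>2 - (Im v)\<^sup>2" by (simp add: cmod_power2)
  moreover have "Im (\<i> * (1 + v) / (1 - v)) = (1 - (Re v)\<^sup>2 - (Im v)\<^sup>2) / (norm (1 - v))\<^sup>2"
    unfolding Im_divide cmod_power2 by (simp add: power2_eq_square algebra_simps)
  ultimately show ?thesis using \<open>v \<noteq> 1\<close> by (simp add: uhp_def)
qed

text \<open>
  Only the indices between \<open>b\<close> and \<open>n - b\<close> are used: there the Blaschke value is at most
  \<open>(qprod r b)\<^sup>2\<close>. The test function has \<open>\<kappa> = 1 - r^(-n)\<close>, which places its cut-off at the top of the
  sequence.
\<close>

lemma interp_const_geometric_ge:
  fixes r :: real and b n :: nat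
  assumes r: "r > 1" and n: "r ^ n > 2" "2 * b \<le> n"
  shows "ereal ((n - 2 * b + 1) * (2 / (1 + (1 / r) ^ b)\<^sup>2 / (qprod r b)\<^sup>2)
      / (2 + n * ln r / (pi * sqrt (1 - (1 / r) ^ n))))
    \<le> interp_const (enat (Suc n)) (\<lambda>j. \<i> * of_real (r ^ j))" (is "ereal (?S / ?m) \<le> interp_const ?N ?z")
proof -
  \<comment> \<open>The points \<open>x j\<close> are the images of \<open>\<i> r^j\<close> under \<open>z \<mapsto> (z - \<i>) / (z + \<i>)\<close>.\<close>
  define x where "x = (\<lambda>j. (r ^ j - 1) / (r ^ j + 1))"
  define \<tau> where "\<tau> = (1 / r) ^ n"
  define A where "A = x ` {..n}"
  have \<tau>: "0 < \<tau>" "\<tau> < 1 / 2" using r n by (auto simp: \<tau>_def power_divide field_simps)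
  have rp: "r ^ j \<ge> 1" for j using r by simp
  have rp1: "r ^ j + 1 > 0" for j using rp[of j] by linarith
  have pair: "\<bar>(x j - x k) / (1 - x j * x k)\<bar> = \<bar>r ^ j - r ^ k\<bar> / (r ^ j + r ^ k)" for j k
  proof -
    let ?d = "(r ^ j + 1) * (r ^ k + 1)"
    have "x j - x k = 2 * (r ^ j - r ^ k) / ?d"
      using rp1[of j] rp1[of k] by (simp add: x_def divide_simps) (simp add: algebra_simps)
    moreover have "1 - x j * x k = 2 * (r ^ j + r ^ k) / ?d"
      using rp1[of j] rp1[of k] by (simp add: x_def divide_simps) (simp add: algebra_simps)
    moreover have "?d \<noteq> 0" using rp1[of j] rp1[of k] by simp
    moreover have "2 * P / d / (2 * Q / d) = P / Q" if "d \<noteq> 0" for P Q d :: real using that by simp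
    ultimately have "(x j - x k) / (1 - x j * x k) = (r ^ j - r ^ k) / (r ^ j + r ^ k)"
      by (simp only: )
    thus ?thesis using rp[of j] rp[of k] by (simp add: abs_divide)
  qed
  have injr: "r ^ j = r ^ k \<longleftrightarrow> j = k" for j k using r by (simp add: power_inject_exp)
  have xinv: "(1 + x j) / (1 - x j) = r ^ j" for j
  proof -
    have "1 + x j = 2 * r ^ j / (r ^ j + 1)" "1 - x j = 2 / (r ^ j + 1)"
      using rp1[of j] by (simp_all add: x_def field_simps)
    thus ?thesis using rp1[of j] by simp
  qed
  have injx: "inj x" by (rule injI) (metis injr xinv)
  have A: "finite A" "A \<subseteq> {-1<..<1}" using r rp rp1 by (auto simp: A_def x_def field_simps)
  have summ: "?S \<le> (\<Sum>a\<in>A. (1 - a\<^sup>2) / (1 - (1 - \<tau>) * a) / (\<Prod>b\<in>A-{a}. \<bar>(a - b) / (1 - a * b)\<bar>))"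
  proof -
    have prod_eq: "(\<Prod>b\<in>A-{x j}. \<bar>(x j - b) / (1 - x j * b)\<bar>) = qprod r j * qprod r (n - j)" if "j \<le> n" for j
    proof -
      have "A - {x j} = x ` ({..n} - {j})" using injx by (auto simp: A_def inj_def)
      hence "(\<Prod>b\<in>A-{x j}. \<bar>(x j - b) / (1 - x j * b)\<bar>) = (\<Prod>k\<in>{..n}-{j}. \<bar>(x j - x k) / (1 - x j * x k)\<bar>)"
        using injx by (simp add: prod.reindex inj_on_subset)
      thus ?thesis unfolding pair prod_geometric_pseudohyp[OF r that] .
    qed
    have nn: "(1 - (x j)\<^sup>2) / (1 - (1 - \<tau>) * x j) \<ge> 0" for j
    proof -
      have x: "0 \<le> x j" "x j < 1" using rp[of j] rp1[of j] by (auto simp: x_def field_simps)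
      hence "(x j)\<^sup>2 \<le> 1" by (simp add: power_le_one)
      moreover have "(1 - \<tau>) * x j \<le> 1 * 1" using x \<tau> by (intro mult_mono) auto
      ultimately show ?thesis by simp
    qed
    have "?S = (\<Sum>j\<in>{b..n-b}. 2 / (1 + (1 / r) ^ b)\<^sup>2 / (qprod r b)\<^sup>2)"
      using n by (simp add: of_nat_diff Suc_diff_le)
    also have "\<dots> \<le> (\<Sum>j\<in>{b..n-b}. (1 - (x j)\<^sup>2) / (1 - (1 - \<tau>) * x j) / (qprod r j * qprod r (n - j)))"
    proof (rule sum_mono)
      fix j assume j: "j \<in> {b..n-b}"
      have 1: "qprod r j * qprod r (n - j) \<le> (qprod r b)\<^sup>2"
        unfolding power2_eq_square
        using j r by (intro mult_mono qprod_antimono) (auto intro: less_imp_le qprod_pos)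
      have 2: "2 / (1 + (1 / r) ^ b)\<^sup>2 \<le> (1 - (x j)\<^sup>2) / (1 - (1 - \<tau>) * x j)"
        unfolding x_def
      proof (rule Cayley_kernel_lower_bound)
        show "1 / r ^ j \<le> (1 / r) ^ b" using j r by (simp add: power_divide frac_le power_increasing)
        have "j \<le> n" using j by auto
        hence "r ^ n = r ^ (n - j) * r ^ j" by (simp flip: power_add)
        hence "\<tau> * r ^ j = (1 / r) ^ (n - j)"
          using r by (simp add: \<tau>_def power_divide)
        also have "\<dots> \<le> (1 / r) ^ b" using r j n by (intro power_decreasing) auto
        finally show "\<tau> * r ^ j \<le> (1 / r) ^ b" .
      qed (use rp \<tau> in auto)
      show "2 / (1 + (1 / r) ^ b)\<^sup>2 / (qprod r b)\<^sup>2
          \<le> (1 - (x j)\<^sup>2) / (1 - (1 - \<tau>) * x j) / (qprod r j * qprod r (n - j))"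
        by (rule frac_le[OF nn 2 _ 1]) (simp add: qprod_pos[OF r])
    qed
    also have "\<dots> \<le> (\<Sum>j\<in>{..n}. (1 - (x j)\<^sup>2) / (1 - (1 - \<tau>) * x j) / (qprod r j * qprod r (n - j)))"
      using qprod_pos[OF r] by (intro sum_mono2 divide_nonneg_pos nn mult_pos_pos) auto
    also have "\<dots> = (\<Sum>a\<in>A. (1 - a\<^sup>2) / (1 - (1 - \<tau>) * a) / (\<Prod>b\<in>A-{a}. \<bar>(a - b) / (1 - a * b)\<bar>))"
      unfolding A_def using prod_eq[unfolded A_def] injx by (subst sum.reindex) (auto intro: inj_on_subset)
    finally show ?thesis .
  qed
  have m_pos: "?m > 0" using r \<tau> by (intro add_pos_nonneg) (auto simp: \<tau>_def)
  \<comment> \<open>The data of supremum norm 1 for which the duality estimate is stated.\<close>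
  define w where "w = (\<lambda>j. complex_of_real (sgn (\<Prod>b\<in>A-{x j}. x j - b)))"
  have wn: "norm (w j) = 1" for j
    using A by (auto simp: w_def norm_of_real abs_sgn_eq)
  have w: "bounded_data ?N w" "data_norm ?N w = 1"
    using wn by (auto simp: bounded_data_def bounded_iff data_norm_def seq_index_Suc)
  have C: "?S / ?m \<le> C"
    if C: "\<forall>w. bounded_data ?N w \<longrightarrow> (\<exists>f. interpolates ?N ?z w f \<and> Hinf_norm f \<le> C * data_norm ?N w)" for C
  proof -
    from C w obtain f where f: "interpolates ?N ?z w f" "Hinf_norm f \<le> C" by force
    define F where "F = (\<lambda>v. f (\<i> * (1 + v) / (1 - v)))"
    have hol: "f holomorphic_on uhp" and bdd: "bounded (f ` uhp)"
      and fz: "\<And>j. j \<le> n \<Longrightarrow> f (\<i> * of_real (r ^ j)) = w j"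
      using f(1) by (auto simp: interpolates_def Hinf_def seq_index_Suc)
    have le: "norm (f v) \<le> C" if "v \<in> uhp" for v
    proof -
      have "bdd_above ((\<lambda>v. norm (f v)) ` uhp)" using bdd unfolding bounded_iff bdd_above_def by auto
      hence "norm (f v) \<le> Hinf_norm f" unfolding Hinf_norm_def using that by (intro cSUP_upper)
      thus ?thesis using f by simp
    qed
    have "(\<lambda>v. \<i> * (1 + v) / (1 - v)) holomorphic_on ball 0 1" by (intro holomorphic_intros) auto
    hence F: "F holomorphic_on ball 0 1"
      unfolding F_def using holomorphic_on_compose_gen[OF _ hol] Cayley_maps_ball_to_uhp by (fastforce simp: o_def)
    have "(\<Sum>a\<in>A. (1 - a\<^sup>2) / (1 - (1 - \<tau>) * a) / (\<Prod>b\<in>A-{a}. \<bar>(a - b) / (1 - a * b)\<bar>))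
      \<le> C * (2 + ln (1 / (1 - (1 - \<tau>))) / (pi * sqrt (1 - \<tau>)))"
    proof (rule interpolation_duality_disc[OF A F])
      show "norm (F v) \<le> C" if "norm v < 1" for v
        unfolding F_def using le Cayley_maps_ball_to_uhp[OF that] by blast
      show "F (of_real a) = of_real (sgn (\<Prod>b\<in>A-{a}. a - b))" if aA: "a \<in> A" for a
      proof -
        obtain j where j: "a = x j" "j \<le> n" using aA by (auto simp: A_def)
        have "\<i> * (1 + of_real a) / (1 - of_real a) = \<i> * complex_of_real ((1 + a) / (1 - a))" by simp
        also have "\<dots> = \<i> * of_real (r ^ j)" unfolding j xinv ..
        finally show ?thesis unfolding F_def using fz[OF j(2)] j by (simp add: w_def)
      qed
    qed (use \<tau> in auto)
    also have "2 + ln (1 / (1 - (1 - \<tau>))) / (pi * sqrt (1 - \<tau>)) = ?m"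
      using r by (simp add: \<tau>_def ln_realpow power_divide)
    finally have "?S \<le> C * ?m" using summ by linarith
    thus ?thesis by (simp only: pos_divide_le_eq[OF m_pos])
  qed
  show ?thesis
  proof (cases "interpolating ?N ?z")
    case True
    hence "interp_const ?N ?z = Inf {ereal C | C::real. \<forall>w. bounded_data ?N w \<longrightarrow>
            (\<exists>f. interpolates ?N ?z w f \<and> Hinf_norm f \<le> C * data_norm ?N w)}"
      by (simp add: interp_const_def)
    also have "\<dots> \<ge> ereal (?S / ?m)" using C by (intro Inf_greatest) auto
    finally show ?thesis .
  qed (simp add: interp_const_def)
qed

section \<open>Prescribing the modulus of a polynomial on the circle\<close>

text \<open>
  Horner's scheme: multiplying \<open>Re (b + w * P2)\<close> by \<open>cos \<alpha> = (w + 1/w) / 2\<close> gives the real part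
  of \<open>b * w + (1 + w^2) * P2 / 2\<close> when \<open>b\<close> is real.
\<close>

lemma cosine_polynomial_as_Re:
  fixes T :: "real poly"
  shows "\<exists>P :: complex poly. (\<forall>n. coeff P n \<in> \<real>) \<and> (\<forall>\<alpha>. Re (poly P (cis \<alpha>)) = poly T (cos \<alpha>))"
proof (induction T)
  case 0
  show ?case by (intro exI[of _ 0]) auto
next
  case (pCons a T)
  then obtain P1 where P1: "\<And>n. coeff P1 n \<in> \<real>" "\<And>\<alpha>. Re (poly P1 (cis \<alpha>)) = poly T (cos \<alpha>)" by blast
  obtain b P2 where eq: "P1 = pCons b P2" by (cases P1)
  have b: "b \<in> \<real>" using P1(1)[of 0] by (simp add: eq)
  have P2: "coeff P2 n \<in> \<real>" for n using P1(1)[of "Suc n"] by (simp add: eq)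
  define P where "P = [:of_real a, b:] + smult (1/2) (P2 + pCons 0 (pCons 0 P2))"
  have "coeff P n \<in> \<real>" for n
    using b P2 unfolding P_def by (auto simp: coeff_pCons intro!: Reals_mult Reals_add split: nat.split)
  moreover have "Re (poly P (cis \<alpha>)) = poly (pCons a T) (cos \<alpha>)" for \<alpha>
  proof -
    let ?w = "cis \<alpha>"
    have w: "?w * cnj ?w = 1" by (simp add: cis_cnj cis_mult)
    have "?w + cnj ?w = of_real (2 * cos \<alpha>)" by (simp add: complex_eq_iff)
    hence "1 + ?w * ?w = of_real (2 * cos \<alpha>) * ?w" using w by (metis distrib_left mult.commute add.commute)
    hence "(1 + ?w * ?w) * poly P2 ?w / 2 = of_real (cos \<alpha>) * (?w * poly P2 ?w)" by simp
    hence "poly P ?w = of_real a + ?w * b + of_real (cos \<alpha>) * (?w * poly P2 ?w)"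
      by (simp add: P_def algebra_simps)
    also have "Re \<dots> = a + cos \<alpha> * Re (poly P1 ?w)"
      using b by (auto simp: eq algebra_simps complex_is_Real_iff)
    finally show ?thesis by (simp add: P1(2))
  qed
  ultimately show ?case by blast
qed

lemma has_integral_cos_nat:
  "((\<lambda>\<alpha>. cos (real n * \<alpha>)) has_integral (if n = 0 then pi else 0)) {0..pi}"
proof (cases "n = 0")
  case True
  then show ?thesis using has_integral_const_real[of "1::real" 0 pi] by simp
next
  case False
  have "((\<lambda>\<alpha>. cos (real n * \<alpha>)) has_integral (sin (real n * pi) / n - sin (real n * 0) / n)) {0..pi}"
    using False
    by (intro fundamental_theorem_of_calculus)
      (auto intro!: derivative_eq_intros simp flip: has_real_derivative_iff_has_vector_derivative)
  thus ?thesis using False by (simp add: sin_npi)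
qed

lemma has_integral_Re_real_poly:
  assumes "\<And>n. coeff P n \<in> \<real>"
  shows "((\<lambda>\<alpha>. Re (poly P (cis \<alpha>))) has_integral (pi * Re (poly P 0))) {0..pi}"
proof -
  have im: "Im (coeff P n) = 0" for n using assms by (simp add: complex_is_Real_iff)
  have eq: "Re (poly P (cis \<alpha>)) = (\<Sum>i\<le>degree P. Re (coeff P i) * cos (real i * \<alpha>))" for \<alpha>
    by (simp add: poly_altdef Complex.DeMoivre im)
  have "((\<lambda>\<alpha>. \<Sum>i\<le>degree P. Re (coeff P i) * cos (real i * \<alpha>)) has_integral
      (\<Sum>i\<le>degree P. Re (coeff P i) * (if i = 0 then pi else 0))) {0..pi}"
    by (intro has_integral_sum has_integral_mult_right has_integral_cos_nat) auto
  also have "(\<Sum>i\<le>degree P. Re (coeff P i) * (if i = 0 then pi else 0)) = (\<Sum>i\<le>degree P. if i = 0 then pi * Re (coeff P 0) else 0)"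
    by (intro sum.cong) auto
  also have "\<dots> = pi * Re (poly P 0)"
    by (simp add: poly_0_coeff_0)
  finally show ?thesis by (simp only: eq)
qed

text \<open>
  Weierstrass approximation in the variable \<open>cos \<alpha>\<close>. Since the coefficients are real, \<open>P(0)\<close> is the mean
  of \<open>Re P\<close> over the half circle, so it is controlled by the mean of \<open>L\<close>.
\<close>

lemma approximate_by_Re_poly:
  fixes L :: "real \<Rightarrow> real"
  assumes L: "continuous_on {0..pi} L" and e: "e > 0"
  obtains P :: "complex poly" where
    "\<And>\<alpha>. \<alpha> \<in> {0..pi} \<Longrightarrow> \<bar>Re (poly P (cis \<alpha>)) - L \<alpha>\<bar> \<le> e"
    "\<And>\<alpha>. Re (poly P (cis (- \<alpha>))) = Re (poly P (cis \<alpha>))"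
    "pi * Re (poly P 0) \<le> integral {0..pi} L + pi * e"
proof -
  \<comment> \<open>Cosine polynomials are even, so it suffices to approximate on the upper half of the circle.\<close>
  have "continuous_on {-1..1} (\<lambda>x. L (arccos x))"
    by (rule continuous_on_compose2[OF L continuous_on_arccos']) (auto intro: arccos_lbound arccos_ubound)
  from Stone_Weierstrass_polynomial_function[OF _ this e]
  obtain g where g: "polynomial_function g" "\<And>x. x \<in> {-1..1} \<Longrightarrow> norm (L (arccos x) - g x) < e" by auto
  from g(1) have "real_polynomial_function g" by (simp add: real_polynomial_function_eq)
  then obtain a n where gs: "g = (\<lambda>x. \<Sum>i\<le>n. a i * x ^ i)"
    unfolding real_polynomial_function_iff_sum by blast
  have gp: "g x = poly (\<Sum>i\<le>n. monom (a i) i) x" for x by (simp add: gs poly_sum poly_monom)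
  obtain P :: "complex poly" where P: "\<And>n. coeff P n \<in> \<real>" "\<And>\<alpha>. Re (poly P (cis \<alpha>)) = g (cos \<alpha>)"
    using cosine_polynomial_as_Re unfolding gp by blast
  have close: "\<bar>Re (poly P (cis \<alpha>)) - L \<alpha>\<bar> \<le> e" if "\<alpha> \<in> {0..pi}" for \<alpha>
  proof -
    have "norm (L (arccos (cos \<alpha>)) - g (cos \<alpha>)) < e" by (rule g(2)) simp
    thus ?thesis using that by (simp add: P(2) arccos_cos abs_minus_commute)
  qed
  have "pi * Re (poly P 0) = integral {0..pi} (\<lambda>\<alpha>. Re (poly P (cis \<alpha>)))"
    using has_integral_Re_real_poly[OF P(1)] by (simp add: integral_unique)
  also have "\<dots> \<le> integral {0..pi} (\<lambda>\<alpha>. L \<alpha> + e)"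
  proof (rule integral_le)
    show "(\<lambda>\<alpha>. Re (poly P (cis \<alpha>))) integrable_on {0..pi}"
      using has_integral_Re_real_poly[OF P(1)] by (rule has_integral_integrable)
    show "(\<lambda>\<alpha>. L \<alpha> + e) integrable_on {0..pi}"
      by (intro integrable_continuous_real continuous_intros L)
    show "Re (poly P (cis \<alpha>)) \<le> L \<alpha> + e" if "\<alpha> \<in> {0..pi}" for \<alpha> using close[OF that] by linarith
  qed
  also have "\<dots> = integral {0..pi} L + pi * e"
    by (subst Henstock_Kurzweil_Integration.integral_add[OF integrable_continuous_real[OF L]]) auto
  finally show ?thesis using that close P(2) by (metis cos_minus)
qed

text \<open>
  Truncating the exponential series keeps the value 1 at 0. The error is stated relatively, which is
  possible because \<open>exp (poly X w)\<close> is bounded away from 0 on the disc.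
\<close>

lemma exp_poly_approximation:
  fixes X :: "complex poly"
  assumes X0: "poly X 0 = 0" and d: "d > 0"
  obtains q where "poly q 0 = 1" "\<And>w. norm w \<le> 1 \<Longrightarrow> norm (poly q w) \<le> (1 + d) * exp (Re (poly X w))"
proof -
  have "compact ((\<lambda>w. poly X w) ` cball 0 1)" by (intro compact_continuous_image continuous_intros) auto
  then obtain K where K: "K > 0" "\<And>w. norm w \<le> 1 \<Longrightarrow> norm (poly X w) \<le> K"
    using compact_imp_bounded bounded_pos by (metis (no_types, lifting) image_eqI mem_cball_0)
  have "(\<lambda>n. inverse (fact n) * K ^ n) \<longlonglongrightarrow> 0" by (rule summable_LIMSEQ_zero[OF summable_exp])
  hence "(\<lambda>n. exp K * K * (inverse (fact n) * K ^ n)) \<longlonglongrightarrow> exp K * K * 0" by (intro tendsto_intros)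
  hence "\<forall>\<^sub>F n in sequentially. exp K * K * (inverse (fact n) * K ^ n) < d * exp (-K)"
    using d by (intro order_tendstoD) auto
  then obtain n where n: "exp K * K * (inverse (fact n) * K ^ n) < d * exp (-K)"
    by (auto simp: eventually_sequentially)
  define q where "q = (\<Sum>i\<le>n. smult (1 / fact i) (X ^ i))"
  have q: "poly q w = (\<Sum>i\<le>n. poly X w ^ i / fact i)" for w
    by (simp add: q_def poly_sum poly_power)
  show ?thesis
  proof (rule that[of q])
    have "(\<Sum>i\<le>n. (0::complex) ^ i / fact i) = (\<Sum>i\<le>n. if i = 0 then 1 else 0)"
      by (intro sum.cong) auto
    thus "poly q 0 = 1" by (simp add: q X0)
    fix w :: complex assume w: "norm w \<le> 1"
    let ?x = "poly X w"
    have xK: "norm ?x \<le> K" by (rule K(2)[OF w])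
    hence re: "\<bar>Re ?x\<bar> \<le> K" using abs_Re_le_cmod order_trans by blast
    have "norm (exp ?x - poly q w) \<le> exp \<bar>Re ?x\<bar> * (norm ?x) ^ Suc n / fact n"
      unfolding q by (rule Taylor_exp)
    also have "\<dots> \<le> exp K * K ^ Suc n / fact n"
      using re xK K(1) by (intro divide_right_mono mult_mono power_mono) auto
    also have "\<dots> \<le> d * exp (-K)" using n by (simp add: field_simps)
    also have "\<dots> \<le> d * exp (Re ?x)" using re d by (intro mult_left_mono) auto
    finally have "norm (exp ?x - poly q w) \<le> d * exp (Re ?x)" .
    moreover have "norm (poly q w) \<le> norm (exp ?x) + norm (exp ?x - poly q w)"
      by (metis norm_minus_commute norm_triangle_sub)
    ultimately show "norm (poly q w) \<le> (1 + d) * exp (Re ?x)"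
      by (simp add: norm_exp_eq_Re algebra_simps)
  qed
qed

section \<open>The extremal polynomial\<close>

lemma has_integral_ln_shift:
  assumes "c > 0"
  shows "((\<lambda>\<alpha>. ln (\<alpha> + c)) has_integral ((pi + c) * ln (pi + c) - c * ln c - pi)) {0..pi}"
proof -
  let ?F = "\<lambda>\<alpha>. (\<alpha> + c) * ln (\<alpha> + c) - \<alpha>"
  have "((\<lambda>\<alpha>. ln (\<alpha> + c)) has_integral (?F pi - ?F 0)) {0..pi}"
    using assms
    by (intro fundamental_theorem_of_calculus)
      (auto intro!: derivative_eq_intros simp flip: has_real_derivative_iff_has_vector_derivative)
  thus ?thesis by (simp add: algebra_simps)
qed

text \<open>
  Applied below to the function \<open>ln (cos (\<alpha> / 2) + e) - ln (sin (\<alpha> / 2) + e)\<close>: the regularised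
  cotangent factor of the weight has geometric mean 1.
\<close>

lemma has_integral_antisymmetric:
  fixes h :: "real \<Rightarrow> real"
  assumes h: "continuous_on {0..a} h" and anti: "\<And>x. h (a - x) = - h x"
  shows "(h has_integral 0) {0..a}"
proof -
  obtain I where I: "(h has_integral I) {0..a}"
    using integrable_continuous_real[OF h] by (auto simp: integrable_on_def)
  hence "((\<lambda>x. h (- x)) has_integral I) {-a..-0}"
    by (subst has_integral_reflect_real) simp
  from has_integral_shift_real_ivl[OF this, of "- a"]
  have "((\<lambda>x. h (a - x)) has_integral I) {0..a}" by simp
  hence "((\<lambda>x. - h x) has_integral I) {0..a}" by (simp add: anti)
  hence "(h has_integral - I) {0..a}" using has_integral_neg_iff by fastforce
  with I have "I = - I" by (rule has_integral_unique)
  thus ?thesis using I by simp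
qed

text \<open>
  A weak form of Jordan's inequality, from \<open>tan y \<ge> y\<close> at \<open>y = \<alpha> / 4\<close>.
\<close>

lemma half_angle_sine_lower_bound:
  assumes "0 \<le> \<alpha>" "\<alpha> \<le> pi"
  shows "\<alpha> \<le> 4 * sin (\<alpha> / 2)"
proof -
  define y where "y = \<alpha> / 4"
  have y: "0 \<le> y" "y \<le> pi / 4" "y < pi / 2" using assms pi_gt_zero unfolding y_def by linarith+
  have c: "cos y > 0" using y by (intro cos_gt_zero_pi) auto
  have "tan (arctan y) \<le> tan y"
    using y arctan_le_self[of y] arctan_bounded[of y] by (intro tan_mono_le) auto
  hence "y * cos y \<le> sin y" using c unfolding tan_arctan by (simp add: tan_def field_simps)
  hence "2 * (y * cos y) * cos y \<le> 2 * sin y * cos y" using c by (intro mult_right_mono) auto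
  moreover have "(1/2) \<le> (cos y)\<^sup>2"
  proof -
    have "0 \<le> cos (2 * y)" using y by (intro cos_ge_zero) auto
    thus ?thesis by (simp add: cos_double_cos)
  qed
  hence "y * (1/2) \<le> y * (cos y)\<^sup>2" using y by (intro mult_left_mono) auto
  ultimately have "y \<le> sin (2 * y)"
    unfolding sin_double power2_eq_square by (simp add: algebra_simps)
  thus ?thesis by (simp add: y_def)
qed

text \<open>
  This is the upper half of Szego's theorem for the weight \<open>W(\<alpha>) = 2 \<alpha> cot (\<alpha> / 2)\<close>, with a
  pointwise conclusion \<open>\<bar>q\<bar>\<^sup>2 W \<le> Q\<close>. The weight has a zero at \<open>\<pi>\<close>, so it is first
  enlarged to \<open>exp L\<close> with
  \<open>exp (L \<alpha>) = 2 (\<alpha> + c) (cos (\<alpha> / 2) + e) / (sin (\<alpha> / 2) + e)\<close>, which is continuous and positive.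
  If the real part of \<open>P\<close> is close to \<open>L\<close> on the circle, then \<open>\<bar>exp ((P(0) - P) / 2)\<bar>\<^sup>2\<close> is close to
  \<open>exp (P(0) - L)\<close>, and \<open>exp (P(0))\<close> is close to the geometric mean of \<open>exp L\<close>,
  which tends to \<open>2 \<pi> / e\<close>.
\<close>

lemma extremal_polynomial:
  assumes Q: "Q > 2 * pi / exp 1"
  obtains q :: "complex poly" where "poly q 0 = 1"
    "\<And>\<alpha> w. 0 \<le> \<alpha> \<Longrightarrow> \<alpha> \<le> pi \<Longrightarrow> w = cis \<alpha> \<or> w = cis (- \<alpha>) \<Longrightarrow>
      (norm (poly q w))\<^sup>2 * (2 * \<alpha> * cos (\<alpha> / 2)) \<le> Q * sin (\<alpha> / 2)"
proof -
  \<comment> \<open>All error terms are governed by the single small parameter \<open>c\<close>; \<open>exp (G c)\<close> will bound the geometric mean of the regularised weight.\<close>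
  define G where "G = (\<lambda>c. (pi * ln 2 + ((pi + c) * ln (pi + c) + 2 * sqrt c - pi)) / pi)"
  have "((\<lambda>c. exp (G c + 2 * c) * (1 + c)\<^sup>2) \<longlongrightarrow>
      exp ((pi * ln 2 + ((pi + 0) * ln (pi + 0) + 2 * sqrt 0 - pi)) / pi + 2 * 0) * (1 + 0)\<^sup>2) (at_right 0)"
    unfolding G_def by (intro tendsto_intros) auto
  also have "exp ((pi * ln 2 + ((pi + 0) * ln (pi + 0) + 2 * sqrt 0 - pi)) / pi + 2 * 0) * (1 + 0)\<^sup>2 = 2 * pi / exp 1"
    by (simp add: add_divide_distrib diff_divide_distrib exp_add exp_diff)
  finally have "\<forall>\<^sub>F c in at_right 0. exp (G c + 2 * c) * (1 + c)\<^sup>2 < Q"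
    using Q by (rule order_tendstoD)
  moreover have "\<forall>\<^sub>F c in at_right 0. (0::real) < c" by (simp add: eventually_at_right_less)
  ultimately have "\<forall>\<^sub>F c in at_right 0. exp (G c + 2 * c) * (1 + c)\<^sup>2 < Q \<and> 0 < c"
    by (rule eventually_conj)
  hence "\<exists>c. exp (G c + 2 * c) * (1 + c)\<^sup>2 < Q \<and> 0 < c"
    by (rule eventually_happens'[rotated]) simp
  then obtain c where c: "0 < c" "exp (G c + 2 * c) * (1 + c)\<^sup>2 < Q" by blast
  \<comment> \<open>The ratio 4 makes the enlarged weight dominate \<open>W\<close>, by the inequality \<open>\<alpha> \<le> 4 sin (\<alpha> / 2)\<close>.\<close>
  define e where "e = c / 4"
  have e: "e > 0" using c by (simp add: e_def)
  define h where "h = (\<lambda>\<alpha>. ln (cos (\<alpha> / 2) + e) - ln (sin (\<alpha> / 2) + e))"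
  define L where "L = (\<lambda>\<alpha>. ln 2 + ln (\<alpha> + c) + h \<alpha>)"
  have cs: "cos (\<alpha> / 2) \<ge> 0" "sin (\<alpha> / 2) \<ge> 0" if "0 \<le> \<alpha>" "\<alpha> \<le> pi" for \<alpha>
    using that by (auto intro!: cos_ge_zero sin_ge_zero)
  have ch: "continuous_on {0..pi} h"
    unfolding h_def using cs e by (intro continuous_intros) (auto simp: add_nonneg_eq_0_iff)
  have cl: "continuous_on {0..pi} (\<lambda>\<alpha>. ln (\<alpha> + c))"
    using c by (intro continuous_intros) auto
  have cL: "continuous_on {0..pi} L"
    unfolding L_def by (intro continuous_intros cl ch)
  have "h (pi - x) = - h x" for x
    by (simp add: h_def diff_divide_distrib cos_diff sin_diff)
  hence ih: "(h has_integral 0) {0..pi}" by (intro has_integral_antisymmetric ch)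
  have "(L has_integral (pi * ln 2 + ((pi + c) * ln (pi + c) - c * ln c - pi) + 0)) {0..pi}"
    unfolding L_def
    using has_integral_const_real[of "ln 2 :: real" 0 pi]
    by (intro has_integral_add has_integral_ln_shift ih c) simp
  hence iL: "integral {0..pi} L = pi * ln 2 + ((pi + c) * ln (pi + c) - c * ln c - pi)"
    by (simp add: integral_unique)
  have "- (c * ln c) \<le> 2 * sqrt c"
  proof -
    have "ln (1 / sqrt c) \<le> 1 / sqrt c - 1" using c by (intro ln_le_minus_one) auto
    hence "- ln c / 2 \<le> 1 / sqrt c" using c by (simp add: ln_div ln_sqrt)
    hence "2 * c * (- ln c / 2) \<le> 2 * c * (1 / sqrt c)" using c by (intro mult_left_mono) auto
    also have "2 * c * (1 / sqrt c) = 2 * sqrt c" using real_div_sqrt[of c] c by (simp add: field_simps)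
    finally show ?thesis by simp
  qed
  hence iG: "integral {0..pi} L \<le> pi * G c" unfolding iL G_def by simp
  from approximate_by_Re_poly[OF cL c(1)]
  obtain P :: "complex poly" where P: "\<And>\<alpha>. \<alpha> \<in> {0..pi} \<Longrightarrow> \<bar>Re (poly P (cis \<alpha>)) - L \<alpha>\<bar> \<le> c"
    "\<And>\<alpha>. Re (poly P (cis (- \<alpha>))) = Re (poly P (cis \<alpha>))"
    "pi * Re (poly P 0) \<le> integral {0..pi} L + pi * c" by blast
  have "pi * Re (poly P 0) \<le> pi * (G c + c)" using P(3) iG by (simp add: algebra_simps)
  hence P0: "Re (poly P 0) \<le> G c + c" by simp
  \<comment> \<open>The exponential of \<open>X\<close> is 1 at 0, and its squared modulus is about \<open>exp (P(0) - L)\<close> on the circle.\<close>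
  define X where "X = smult (-1/2) (P - [:poly P 0:])"
  have X: "poly X w = (poly P 0 - poly P w) / 2" for w by (simp add: X_def field_simps)
  obtain q where q: "poly q 0 = 1" "\<And>w. norm w \<le> 1 \<Longrightarrow> norm (poly q w) \<le> (1 + c) * exp (Re (poly X w))"
    using exp_poly_approximation[of X c] c X by auto
  show ?thesis
  proof (rule that[of q])
    show "poly q 0 = 1" by (rule q)
    fix \<alpha> w assume \<alpha>: "0 \<le> \<alpha>" "\<alpha> \<le> pi" and w: "w = cis \<alpha> \<or> w = cis (- \<alpha>)"
    have "norm (poly q w) \<le> (1 + c) * exp (Re (poly X w))" using w by (intro q) auto
    hence "(norm (poly q w))\<^sup>2 \<le> ((1 + c) * exp (Re (poly X w)))\<^sup>2" by (intro power_mono) auto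
    also have "\<dots> = (1 + c)\<^sup>2 * exp (Re (poly P 0) - Re (poly P w))"
      by (simp add: power_mult_distrib X exp_double[symmetric] flip: exp_of_nat_mult)
    also have "\<dots> \<le> (1 + c)\<^sup>2 * exp ((G c + 2 * c) - L \<alpha>)"
    proof -
      have "Re (poly P w) = Re (poly P (cis \<alpha>))" using w P(2) by auto
      hence "Re (poly P 0) - Re (poly P w) \<le> (G c + 2 * c) - L \<alpha>"
        using P(1)[of \<alpha>] \<alpha> P0 by (simp add: abs_le_iff)
      thus ?thesis by (intro mult_left_mono) auto
    qed
    also have "\<dots> = (exp (G c + 2 * c) * (1 + c)\<^sup>2) / exp (L \<alpha>)" by (simp add: exp_diff)
    also have "\<dots> \<le> Q / exp (L \<alpha>)" using c by (intro divide_right_mono) auto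
    finally have 1: "(norm (poly q w))\<^sup>2 * exp (L \<alpha>) \<le> Q" by (simp add: field_simps)
    let ?s = "sin (\<alpha> / 2)" and ?k = "cos (\<alpha> / 2)"
    have eL: "exp (L \<alpha>) = 2 * (\<alpha> + c) * (?k + e) / (?s + e)"
      using cs[OF \<alpha>] e c \<alpha> by (simp add: L_def h_def exp_add exp_diff)
    have "\<alpha> * e \<le> c * ?s"
      using half_angle_sine_lower_bound[OF \<alpha>] c by (simp add: e_def)
    hence "\<alpha> * (?s + e) \<le> (\<alpha> + c) * ?s" by (simp add: algebra_simps)
    hence "\<alpha> * (?s + e) * ?k \<le> (\<alpha> + c) * ?s * (?k + e)"
      by (rule mult_mono) (use cs[OF \<alpha>] e c \<alpha> in auto)
    hence "2 * (\<alpha> * (?s + e) * ?k) \<le> 2 * ((\<alpha> + c) * ?s * (?k + e))" by simp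
    hence "2 * \<alpha> * ?k * (?s + e) \<le> 2 * (\<alpha> + c) * (?k + e) * ?s" by (simp only: mult_ac)
    moreover have "?s + e > 0" using cs[OF \<alpha>] e by linarith
    ultimately have "2 * \<alpha> * ?k \<le> 2 * (\<alpha> + c) * (?k + e) * ?s / (?s + e)"
      by (simp only: pos_le_divide_eq)
    hence "2 * \<alpha> * ?k \<le> exp (L \<alpha>) * ?s" unfolding eL by simp
    hence "(norm (poly q w))\<^sup>2 * (2 * \<alpha> * ?k) \<le> (norm (poly q w))\<^sup>2 * (exp (L \<alpha>) * ?s)"
      by (intro mult_left_mono) auto
    also have "\<dots> \<le> Q * ?s" using 1 cs[OF \<alpha>] by (simp only: mult.assoc[symmetric]) (intro mult_right_mono)
    finally show "(norm (poly q w))\<^sup>2 * (2 * \<alpha> * ?k) \<le> Q * ?s" .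
  qed
qed

section \<open>Poisson integrals along the imaginary axis\<close>

text \<open>
  On the circle \<open>\<bar>a + w q\<bar>\<^sup>2 = \<bar>a\<bar>\<^sup>2 + \<bar>q\<bar>\<^sup>2 + 2 Re (cnj a * w * q)\<close>. Thus the Dirichlet problem
  with boundary values \<open>\<bar>q\<bar>\<^sup>2\<close> has an explicit solution.
\<close>

lemma norm_square_poly_eq_Re_on_circle:
  fixes q :: "complex poly"
  shows "\<exists>R. R holomorphic_on UNIV \<and> (\<forall>w. norm w = 1 \<longrightarrow> Re (R w) = (norm (poly q w))\<^sup>2)"
proof (induction q)
  case 0
  show ?case by (intro exI[of _ "\<lambda>_. 0"]) auto
next
  case (pCons a q)
  then obtain R where R: "R holomorphic_on UNIV" "\<And>w. norm w = 1 \<Longrightarrow> Re (R w) = (norm (poly q w))\<^sup>2" by blast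
  define R' where "R' = (\<lambda>w. of_real ((norm a)\<^sup>2) + R w + 2 * cnj a * (w * poly q w))"
  have "R' holomorphic_on UNIV" unfolding R'_def by (intro holomorphic_intros R)
  moreover have "Re (R' w) = (norm (poly (pCons a q) w))\<^sup>2" if w: "norm w = 1" for w
  proof -
    have "(norm (a + v))\<^sup>2 = (norm a)\<^sup>2 + (norm v)\<^sup>2 + Re (2 * cnj a * v)" for v
      unfolding cmod_power2 by (simp add: power2_eq_square algebra_simps)
    from this[of "w * poly q w"] show ?thesis using w by (simp add: R'_def R norm_mult)
  qed
  ultimately show ?case by blast
qed

text \<open>
  Cauchy's formula at \<open>x\<close> for \<open>u \<mapsto> R(u) (1 - x\<^sup>2) / (1 - x u)\<close>, a function with the same value at
  \<open>x\<close> as \<open>R\<close>: on the circle the quotient by \<open>u - x\<close> becomes the Poisson kernel.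
\<close>

lemma Poisson_formula_real_point:
  assumes R: "R holomorphic_on UNIV" and x: "\<bar>x\<bar> < 1"
  shows "((\<lambda>t. Re (R (cis (2 * pi * t))) * ((1 - x\<^sup>2) / (norm (cis (2 * pi * t) - of_real x))\<^sup>2))
      has_integral Re (R (of_real x))) {0..1}"
proof -
  define f where "f = (\<lambda>u. R u * of_real (1 - x\<^sup>2) / (1 - of_real x * u))"
  have ne: "1 - of_real x * u \<noteq> 0" if "norm u \<le> 1" for u :: complex
  proof
    assume "1 - of_real x * u = 0"
    hence "norm (of_real x * u) = 1" by (metis eq_iff_diff_eq_0 norm_one)
    moreover have "\<bar>x\<bar> * norm u \<le> \<bar>x\<bar> * 1" using that by (intro mult_left_mono) auto
    ultimately show False using x by (simp add: norm_mult)
  qed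
  have fx: "f (of_real x) = R (of_real x)"
    using ne[of "of_real x"] x by (simp add: f_def power2_eq_square)
  have hol: "f holomorphic_on cball 0 1"
    unfolding f_def using R ne by (intro holomorphic_intros) (auto intro: holomorphic_on_subset)
  have "((\<lambda>u. f u / (u - of_real x)) has_contour_integral (2 * of_real pi * \<i> * f (of_real x))) (circlepath 0 1)"
    using x by (intro Cauchy_integral_circlepath_simple hol) auto
  hence "((\<lambda>t. f (circlepath 0 1 t) / (circlepath 0 1 t - of_real x) * vector_derivative (circlepath 0 1) (at t))
      has_integral (2 * of_real pi * \<i> * f (of_real x))) {0..1}"
    unfolding has_contour_integral .
  from has_integral_mult_right[OF this, of "1 / (2 * of_real pi * \<i>)"]
  have "((\<lambda>t. 1 / (2 * of_real pi * \<i>) * (f (circlepath 0 1 t) / (circlepath 0 1 t - of_real x) *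
        vector_derivative (circlepath 0 1) (at t))) has_integral R (of_real x)) {0..1}"
    by (simp add: fx)
  also have "(\<lambda>t. 1 / (2 * of_real pi * \<i>) * (f (circlepath 0 1 t) / (circlepath 0 1 t - of_real x) *
        vector_derivative (circlepath 0 1) (at t)))
      = (\<lambda>t. R (cis (2 * pi * t)) * of_real ((1 - x\<^sup>2) / (norm (cis (2 * pi * t) - of_real x))\<^sup>2))"
  proof
    fix t :: real
    let ?u = "cis (2 * pi * t)"
    have cp: "circlepath 0 1 t = ?u" by (simp add: circlepath cis_conv_exp mult_ac)
    have vd: "vector_derivative (circlepath 0 1) (at t) = 2 * of_real pi * \<i> * ?u"
      by (simp add: vector_derivative_circlepath cis_conv_exp mult_ac)
    have u: "?u * cnj ?u = 1" by (simp add: cis_cnj cis_mult)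
    have e: "1 - of_real x * ?u = ?u * cnj (?u - of_real x)" using u by (simp add: algebra_simps)
    have n2: "of_real ((norm (?u - of_real x))\<^sup>2) = (?u - of_real x) * cnj (?u - of_real x)"
      by (rule complex_norm_square)
    have un: "?u \<noteq> 0" by simp
    show "1 / (2 * of_real pi * \<i>) * (f (circlepath 0 1 t) / (circlepath 0 1 t - of_real x) *
        vector_derivative (circlepath 0 1) (at t))
      = R ?u * of_real ((1 - x\<^sup>2) / (norm (?u - of_real x))\<^sup>2)"
      unfolding cp vd f_def e of_real_divide n2 using un by (simp add: mult_ac del: complex_cnj_diff)
  qed
  finally have "((\<lambda>t. Re (R (cis (2 * pi * t)) * of_real ((1 - x\<^sup>2) / (norm (cis (2 * pi * t) - of_real x))\<^sup>2)))
      has_integral Re (R (of_real x))) {0..1}"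
    by (rule has_integral_Re)
  thus ?thesis by simp
qed

text \<open>
  The real point \<open>(1 - s) / (1 + s)\<close> of the disc corresponds to \<open>\<i> s\<close> in the half-plane; in this
  parameter the Poisson kernel becomes easy to integrate against \<open>ds / s\<close>.
\<close>

lemma Poisson_kernel_half_angle:
  assumes s: "s > 0" and w: "w = cis \<alpha> \<or> w = cis (- \<alpha>)"
  defines "x \<equiv> (1 - s) / (1 + s)"
  shows "(1 - x\<^sup>2) / (norm (w - of_real x))\<^sup>2 = s / (s\<^sup>2 * (cos (\<alpha> / 2))\<^sup>2 + (sin (\<alpha> / 2))\<^sup>2)"
proof -
  let ?c = "cos (\<alpha> / 2)" and ?s = "sin (\<alpha> / 2)"
  have cosd: "cos \<alpha> = ?c\<^sup>2 - ?s\<^sup>2" using cos_double[of "\<alpha> / 2"] by simp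
  have one: "(cos \<alpha>)\<^sup>2 + (sin \<alpha>)\<^sup>2 = 1" by simp
  have "(norm (w - of_real x))\<^sup>2 = (cos \<alpha> - x)\<^sup>2 + (sin \<alpha>)\<^sup>2"
    using w unfolding cmod_power2 by auto
  also have "\<dots> = ((cos \<alpha>)\<^sup>2 + (sin \<alpha>)\<^sup>2) - 2 * x * cos \<alpha> + x\<^sup>2"
    by (simp only: power2_eq_square) (simp only: algebra_simps)
  also have "\<dots> = (?c\<^sup>2 + ?s\<^sup>2) - 2 * x * (?c\<^sup>2 - ?s\<^sup>2) + x\<^sup>2 * (?c\<^sup>2 + ?s\<^sup>2)"
    unfolding one by (simp add: cosd)
  also have "\<dots> = ?c\<^sup>2 * (1 - x)\<^sup>2 + ?s\<^sup>2 * (1 + x)\<^sup>2"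
    by (simp only: power2_eq_square) (simp only: algebra_simps)
  also have "1 - x = 2 * s / (1 + s)" using s by (simp add: x_def field_simps)
  also have "1 + x = 2 / (1 + s)" using s by (simp add: x_def field_simps)
  finally have n: "(norm (w - of_real x))\<^sup>2 = 4 * (s\<^sup>2 * ?c\<^sup>2 + ?s\<^sup>2) / (1 + s)\<^sup>2"
    by (simp add: power_divide power_mult_distrib add_divide_distrib algebra_simps)
  have x2: "1 - x\<^sup>2 = 4 * s / (1 + s)\<^sup>2"
    using s by (simp add: x_def power2_eq_square divide_simps) (simp add: algebra_simps)
  have "4 * s / m / (4 * D / m) = s / D" if "m \<noteq> 0" for m D :: real using that by simp
  from this[of "(1 + s)\<^sup>2"] show ?thesis unfolding n x2 using s by (simp del: distrib_left_numeral)
qed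

text \<open>
  The sum is a Riemann sum of the integral of \<open>s / (s\<^sup>2 cos\<^sup>2 + sin\<^sup>2)\<close> against \<open>ds / s\<close> over
  \<open>s \<ge> 1\<close>, which an arctangent evaluates. By Harnack's inequality the integrand changes at most by a
  factor \<open>r\<close> on \<open>[s, r s]\<close>, and this is the factor on the right.
\<close>

lemma geometric_Poisson_sum_le:
  assumes r: "r > 1" and \<alpha>: "0 < \<alpha>" "\<alpha> < pi"
  shows "cos (\<alpha> / 2) * sin (\<alpha> / 2) *
      (ln r * (\<Sum>l<N. r ^ l / ((r ^ l)\<^sup>2 * (cos (\<alpha> / 2))\<^sup>2 + (sin (\<alpha> / 2))\<^sup>2))) \<le> r * \<alpha> / 2"
proof -
  define c \<sigma> where "c = cos (\<alpha> / 2)" and "\<sigma> = sin (\<alpha> / 2)"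
  have pos: "c > 0" "\<sigma> > 0" using \<alpha> unfolding c_def \<sigma>_def by (auto intro!: cos_gt_zero_pi sin_gt_zero)
  define T where "T = (\<lambda>s. arctan (s * c / \<sigma>))"
  have den: "s\<^sup>2 * c\<^sup>2 + \<sigma>\<^sup>2 > 0" for s using pos by (intro add_nonneg_pos) auto
  have step: "c * \<sigma> * (ln r * (s / (s\<^sup>2 * c\<^sup>2 + \<sigma>\<^sup>2))) \<le> r * (T (r * s) - T s)" if s: "s > 0" for s
  proof -
    have D: "((\<lambda>\<tau>. T (exp \<tau> * s)) has_real_derivative
        c * \<sigma> * (exp \<tau> * s / ((exp \<tau> * s)\<^sup>2 * c\<^sup>2 + \<sigma>\<^sup>2))) (at \<tau>)" for \<tau>
    proof (rule DERIV_cong)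
      show "((\<lambda>\<tau>. T (exp \<tau> * s)) has_real_derivative
          inverse (1 + (exp \<tau> * s * c / \<sigma>)\<^sup>2) * (exp \<tau> * s * c / \<sigma>)) (at \<tau>)"
        unfolding T_def using pos by (auto intro!: derivative_eq_intros)
      have "1 + (exp \<tau> * s * c / \<sigma>)\<^sup>2 = ((exp \<tau> * s)\<^sup>2 * c\<^sup>2 + \<sigma>\<^sup>2) / \<sigma>\<^sup>2"
        using pos by (simp add: power_divide power_mult_distrib add_divide_distrib)
      thus "inverse (1 + (exp \<tau> * s * c / \<sigma>)\<^sup>2) * (exp \<tau> * s * c / \<sigma>)
          = c * \<sigma> * (exp \<tau> * s / ((exp \<tau> * s)\<^sup>2 * c\<^sup>2 + \<sigma>\<^sup>2))"
        using pos by (simp add: power2_eq_square)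
    qed
    \<comment> \<open>In the logarithmic variable \<open>\<tau>\<close> the increment of \<open>T\<close> is \<open>ln r\<close> times a value of the integrand.\<close>
    have "\<exists>\<tau>. 0 < \<tau> \<and> \<tau> < ln r \<and> T (exp (ln r) * s) - T (exp 0 * s)
        = (ln r - 0) * (c * \<sigma> * (exp \<tau> * s / ((exp \<tau> * s)\<^sup>2 * c\<^sup>2 + \<sigma>\<^sup>2)))"
      using r by (intro MVT2 D) auto
    then obtain \<tau> where \<tau>: "0 < \<tau>" "\<tau> < ln r"
      "T (r * s) - T s = ln r * (c * \<sigma> * (exp \<tau> * s / ((exp \<tau> * s)\<^sup>2 * c\<^sup>2 + \<sigma>\<^sup>2)))"
      using r by auto
    have "exp \<tau> \<le> exp (ln r)" using \<tau> by (subst exp_le_cancel_iff) simp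
    hence k: "1 \<le> exp \<tau>" "exp \<tau> \<le> r" using \<tau> r by auto
    have "(exp \<tau> * s)\<^sup>2 * c\<^sup>2 + \<sigma>\<^sup>2 \<le> (exp \<tau>)\<^sup>2 * (s\<^sup>2 * c\<^sup>2 + \<sigma>\<^sup>2)"
      using k mult_right_mono[of 1 "(exp \<tau>)\<^sup>2" "\<sigma>\<^sup>2"] by (simp add: power_mult_distrib algebra_simps)
    hence "exp \<tau> * s / ((exp \<tau>)\<^sup>2 * (s\<^sup>2 * c\<^sup>2 + \<sigma>\<^sup>2)) \<le> exp \<tau> * s / ((exp \<tau> * s)\<^sup>2 * c\<^sup>2 + \<sigma>\<^sup>2)"
      using s den by (intro divide_left_mono mult_pos_pos) auto
    hence "s / (s\<^sup>2 * c\<^sup>2 + \<sigma>\<^sup>2) / exp \<tau> \<le> exp \<tau> * s / ((exp \<tau> * s)\<^sup>2 * c\<^sup>2 + \<sigma>\<^sup>2)"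
      by (simp add: power2_eq_square[of "exp \<tau>"] mult.commute)
    moreover have "s / (s\<^sup>2 * c\<^sup>2 + \<sigma>\<^sup>2) / r \<le> s / (s\<^sup>2 * c\<^sup>2 + \<sigma>\<^sup>2) / exp \<tau>"
      using s den[of s] k r by (intro divide_left_mono mult_pos_pos) auto
    ultimately have "s / (s\<^sup>2 * c\<^sup>2 + \<sigma>\<^sup>2) / r \<le> exp \<tau> * s / ((exp \<tau> * s)\<^sup>2 * c\<^sup>2 + \<sigma>\<^sup>2)" by linarith
    hence "ln r * (c * \<sigma> * (s / (s\<^sup>2 * c\<^sup>2 + \<sigma>\<^sup>2) / r)) \<le> T (r * s) - T s"
      unfolding \<tau>(3) using pos r by (intro mult_left_mono) auto
    hence "r * (ln r * (c * \<sigma> * (s / (s\<^sup>2 * c\<^sup>2 + \<sigma>\<^sup>2) / r))) \<le> r * (T (r * s) - T s)"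
      using r by (intro mult_left_mono) auto
    thus ?thesis using r by (simp add: mult_ac)
  qed
  have "c * \<sigma> * (ln r * (\<Sum>l<N. r ^ l / ((r ^ l)\<^sup>2 * c\<^sup>2 + \<sigma>\<^sup>2)))
      = (\<Sum>l<N. c * \<sigma> * (ln r * (r ^ l / ((r ^ l)\<^sup>2 * c\<^sup>2 + \<sigma>\<^sup>2))))"
    by (simp add: sum_distrib_left)
  also have "\<dots> \<le> (\<Sum>l<N. r * (T (r * r ^ l) - T (r ^ l)))"
    using r by (intro sum_mono step) auto
  also have "\<dots> = r * (\<Sum>l<N. T (r ^ Suc l) - T (r ^ l))" by (simp add: sum_distrib_left)
  also have "\<dots> = r * (T (r ^ N) - T 1)" by (subst sum_lessThan_telescope) simp
  also have "\<dots> \<le> r * (\<alpha> / 2)"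
  proof -
    have "arctan (c / \<sigma>) = arctan (tan (pi / 2 - \<alpha> / 2))"
      unfolding tan_cot by (simp add: tan_def c_def \<sigma>_def)
    also have "\<dots> = pi / 2 - \<alpha> / 2" using \<alpha> by (intro arctan_tan) auto
    finally have "T 1 = pi / 2 - \<alpha> / 2" by (simp add: T_def)
    moreover have "T (r ^ N) \<le> pi / 2" unfolding T_def using arctan_ubound less_imp_le by blast
    ultimately show ?thesis using r by (intro mult_left_mono) auto
  qed
  finally show ?thesis by (simp add: c_def \<sigma>_def)
qed

text \<open>
  Insert the Poisson formula and bound the resulting integrand pointwise. The factor \<open>[:1, 1:]\<close> of
  \<open>q\<close> vanishes at \<open>w = -1\<close>, the point at infinity of the half-plane, and so tames the
  weight \<open>\<alpha> / sin \<alpha>\<close> there.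
\<close>

lemma sum_harmonic_geometric_le:
  fixes q q1 :: "complex poly"
  assumes q: "q = [:1, 1:] * q1"
    and q1: "\<And>\<alpha> w. 0 \<le> \<alpha> \<Longrightarrow> \<alpha> \<le> pi \<Longrightarrow> w = cis \<alpha> \<or> w = cis (- \<alpha>) \<Longrightarrow>
      (norm (poly q1 w))\<^sup>2 * (2 * \<alpha> * cos (\<alpha> / 2)) \<le> Q * sin (\<alpha> / 2)"
    and R: "R holomorphic_on UNIV" "\<And>w. norm w = 1 \<Longrightarrow> Re (R w) = (norm (poly q w))\<^sup>2"
    and r: "r > 1" and Q: "Q \<ge> 0"
  shows "ln r * (\<Sum>l<N. Re (R (of_real ((1 - r ^ l) / (1 + r ^ l))))) \<le> r * Q"
proof -
  define x where "x = (\<lambda>l. (1 - r ^ l) / (1 + r ^ l))"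
  have rl: "r ^ l \<ge> 1" for l using r by simp
  have x: "\<bar>x l\<bar> < 1" for l using rl[of l] by (simp add: x_def abs_less_iff field_simps)
  define I where "I = (\<lambda>t. ln r * (\<Sum>l<N. Re (R (cis (2 * pi * t))) * ((1 - (x l)\<^sup>2) / (norm (cis (2 * pi * t) - of_real (x l)))\<^sup>2)))"
  have int: "(I has_integral (ln r * (\<Sum>l<N. Re (R (of_real (x l)))))) {0..1}"
    unfolding I_def by (intro has_integral_mult_right has_integral_sum Poisson_formula_real_point R x) auto
  have bound: "I t \<le> r * Q" if t: "t \<in> {0<..<1}" for t
  proof -
    \<comment> \<open>The circle is parametrised by \<open>t\<close> in \<open>[0, 1]\<close>; \<open>\<alpha>\<close> is the modulus of the argument.\<close>
    define \<alpha> where "\<alpha> = (if t \<le> 1/2 then 2 * pi * t else 2 * pi * (1 - t))"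
    let ?w = "cis (2 * pi * t)"
    have \<alpha>: "0 < \<alpha>" "\<alpha> \<le> pi" using t by (auto simp: \<alpha>_def field_simps)
    have w: "?w = cis \<alpha> \<or> ?w = cis (- \<alpha>)"
    proof (cases "t \<le> 1/2")
      case False
      have "cis (- (2 * pi * (1 - t))) = cis (2 * pi * t - 2 * pi)" by (simp add: algebra_simps)
      also have "\<dots> = ?w" by (simp add: complex_eq_iff cos_diff sin_diff)
      finally show ?thesis using False by (simp add: \<alpha>_def)
    qed (simp add: \<alpha>_def)
    let ?c = "cos (\<alpha> / 2)" and ?s = "sin (\<alpha> / 2)"
    let ?S = "\<Sum>l<N. r ^ l / ((r ^ l)\<^sup>2 * ?c\<^sup>2 + ?s\<^sup>2)"
    have s: "?s > 0" using \<alpha> by (intro sin_gt_zero) auto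
    have c: "?c \<ge> 0" using \<alpha> by (intro cos_ge_zero) auto
    have "(norm (1 + ?w))\<^sup>2 = (1 + cos \<alpha>)\<^sup>2 + (sin \<alpha>)\<^sup>2"
      using w by (elim disjE)
        (simp_all only: cmod_power2 plus_complex.sel one_complex.sel cis.sel cos_minus sin_minus power2_minus add_0)
    also have "\<dots> = 2 + 2 * cos \<alpha>" using sin_cos_squared_add[of \<alpha>] by (simp add: power2_eq_square algebra_simps)
    also have "\<dots> = 4 * ?c\<^sup>2" using cos_double_cos[of "\<alpha> / 2"] by simp
    finally have n1: "(norm (1 + ?w))\<^sup>2 = 4 * ?c\<^sup>2" .
    have pq: "poly q ?w = (1 + ?w) * poly q1 ?w" unfolding q poly_mult by simp
    have "Re (R ?w) = 4 * ?c\<^sup>2 * (norm (poly q1 ?w))\<^sup>2"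
      unfolding R(2)[OF norm_cis] pq norm_mult power_mult_distrib n1 ..
    moreover have "(1 - (x l)\<^sup>2) / (norm (?w - of_real (x l)))\<^sup>2 = r ^ l / ((r ^ l)\<^sup>2 * ?c\<^sup>2 + ?s\<^sup>2)" for l
      unfolding x_def using r by (intro Poisson_kernel_half_angle w) auto
    ultimately have It: "I t = 4 * ?c\<^sup>2 * (norm (poly q1 ?w))\<^sup>2 * (ln r * ?S)"
      unfolding I_def by (simp add: sum_distrib_left mult_ac)
    show "I t \<le> r * Q"
    proof (cases "\<alpha> = pi")
      case True
      then show ?thesis using It r Q by simp
    next
      case False
      hence "?c * ?s * (ln r * ?S) \<le> r * \<alpha> / 2" using \<alpha> by (intro geometric_Poisson_sum_le r) auto
      hence "4 * ?c * (norm (poly q1 ?w))\<^sup>2 * (?c * ?s * (ln r * ?S)) \<le> 4 * ?c * (norm (poly q1 ?w))\<^sup>2 * (r * \<alpha> / 2)"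
        using c by (intro mult_left_mono) auto
      also have "\<dots> = r * ((norm (poly q1 ?w))\<^sup>2 * (2 * \<alpha> * ?c))" by simp
      also have "\<dots> \<le> r * (Q * ?s)" using r \<alpha> w by (intro mult_left_mono q1) auto
      finally have "I t * ?s \<le> (r * Q) * ?s" unfolding It by (simp add: power2_eq_square mult_ac)
      thus ?thesis using s by simp
    qed
  qed
  have "I t \<le> r * Q" if t: "t \<in> {0..1}" for t
  \<comment> \<open>At the end points \<open>\<alpha> = 0\<close> the bound divides by \<open>sin (\<alpha> / 2) = 0\<close>; it extends by continuity.\<close>
  proof (rule continuous_le_on_closure[of "{0<..<1}" I])
    have ne: "norm (cis (2 * pi * t) - of_real (x l)) \<noteq> 0" for t l
    proof
      assume "norm (cis (2 * pi * t) - of_real (x l)) = 0"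
      hence "norm (cis (2 * pi * t)) = norm (complex_of_real (x l))" by simp
      thus False using x[of l] by simp
    qed
    have "continuous_on {0..1} (\<lambda>t. R (cis (2 * pi * t)))"
      by (rule continuous_on_compose2[OF holomorphic_on_imp_continuous_on[OF R(1)]]) (auto intro!: continuous_intros)
    thus "continuous_on (closure {0<..<1}) I"
      unfolding I_def using ne by (auto intro!: continuous_intros)
  qed (use t bound in auto)
  hence "ln r * (\<Sum>l<N. Re (R (of_real (x l)))) \<le> r * Q"
    using has_integral_const_real[of "r * Q" 0 1] by (intro has_integral_le[OF int]) auto
  thus ?thesis by (simp add: x_def)
qed

section \<open>Least harmonic majorants from polynomials in the disc variable\<close>

text \<open>
  The Cayley transform with \<open>\<i> \<mapsto> 0\<close> and \<open>0 \<mapsto> 1\<close>: it sends \<open>\<infinity>\<close> to -1, so that on the boundary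
  the weight \<open>\<alpha> / sin \<alpha>\<close> is singular exactly at infinity.
\<close>

definition to_disc :: "complex \<Rightarrow> complex" where
  "to_disc \<zeta> = (\<i> - \<zeta>) / (\<i> + \<zeta>)"

lemma i_plus_nonzero: "\<zeta> \<in> uhp \<Longrightarrow> \<i> + \<zeta> \<noteq> 0"
  by (auto simp: uhp_def complex_eq_iff)

lemma norm_to_disc: 
  assumes "\<zeta> \<in> uhp"
  shows "norm (to_disc \<zeta>) < 1"
proof -
  have "to_disc \<zeta> = - ((\<zeta> - \<i>) / (\<zeta> - cnj \<i>))"
    using i_plus_nonzero[OF assms] by (simp add: to_disc_def field_simps)
  thus ?thesis using pseudohyperbolic_less_1[OF assms i_in_uhp] by simp
qed

lemma holomorphic_to_disc: "to_disc holomorphic_on uhp"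
  unfolding to_disc_def using i_plus_nonzero by (intro holomorphic_intros) auto

lemma of_disc_in_uhp: "norm v < 1 \<Longrightarrow> \<i> * (1 - v) / (1 + v) \<in> uhp"
  using Cayley_maps_ball_to_uhp[of "- v"] by simp

lemma to_disc_of_disc:
  assumes "norm v < 1"
  shows "to_disc (\<i> * (1 - v) / (1 + v)) = v"
proof -
  have "1 + v \<noteq> 0" using assms by (metis add_eq_0_iff norm_minus_cancel norm_one less_irrefl)
  hence "\<i> - \<i> * (1 - v) / (1 + v) = 2 * \<i> * v / (1 + v)" "\<i> + \<i> * (1 - v) / (1 + v) = 2 * \<i> / (1 + v)"
    by (simp_all add: field_simps)
  thus ?thesis using \<open>1 + v \<noteq> 0\<close> by (simp add: to_disc_def)
qed

lemma of_disc_to_disc: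
  assumes "\<zeta> \<in> uhp"
  shows "\<i> * (1 - to_disc \<zeta>) / (1 + to_disc \<zeta>) = \<zeta>"
proof -
  note ne = i_plus_nonzero[OF assms]
  hence "1 - to_disc \<zeta> = 2 * \<zeta> / (\<i> + \<zeta>)" "1 + to_disc \<zeta> = 2 * \<i> / (\<i> + \<zeta>)"
    by (simp_all add: to_disc_def field_simps)
  thus ?thesis using ne by simp
qed

lemma to_disc_imaginary_axis:
  "s > 0 \<Longrightarrow> to_disc (\<i> * of_real s) = of_real ((1 - s) / (1 + s))"
proof -
  assume "s > 0"
  hence "complex_of_real (1 + s) \<noteq> 0" by (subst of_real_eq_0_iff) simp
  moreover have "\<i> - \<i> * of_real s = \<i> * of_real (1 - s)" "\<i> + \<i> * of_real s = \<i> * of_real (1 + s)"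
    by (simp_all add: algebra_simps)
  ultimately show ?thesis unfolding to_disc_def by simp
qed

text \<open>
  Both halves follow from the maximum principle. For the majorant property apply it to \<open>c * q\<^sup>2 - R\<close>
  with \<open>c\<close> chosen to rotate \<open>q\<^sup>2\<close> to a positive value at the given point. For the minimality compare
  \<open>R\<close> with a majorant on slightly smaller discs, where the continuity of \<open>Re R - \<bar>q\<bar>\<^sup>2\<close> up to the
  circle controls the boundary values.
\<close>

lemma least_harmonic_majorant_norm_square_poly:
  fixes q :: "complex poly"
  assumes R: "R holomorphic_on UNIV" "\<And>w. norm w = 1 \<Longrightarrow> Re (R w) = (norm (poly q w))\<^sup>2"
  shows "least_harmonic_majorant (\<lambda>\<zeta>. Re (R (to_disc \<zeta>))) (\<lambda>\<zeta>. norm ((poly q (to_disc \<zeta>))\<^sup>2))"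
proof -
  have Rd: "(\<lambda>\<zeta>. R (to_disc \<zeta>)) holomorphic_on uhp"
    using holomorphic_on_compose_gen[OF holomorphic_to_disc R(1)] by (simp add: o_def)
  have "(norm (poly q w0))\<^sup>2 \<le> Re (R w0)" if w0: "norm w0 < 1" for w0
  proof -
    define c where "c = cnj (sgn ((poly q w0)\<^sup>2))"
    have c: "norm c \<le> 1" by (simp add: c_def norm_sgn)
    have cw: "c * (poly q w0)\<^sup>2 = of_real ((norm (poly q w0))\<^sup>2)"
    proof (cases "poly q w0 = 0")
      case False
      have "c * (poly q w0)\<^sup>2 = ((poly q w0)\<^sup>2 * cnj ((poly q w0)\<^sup>2)) / of_real (norm ((poly q w0)\<^sup>2))"
        by (simp add: c_def sgn_eq)
      also have "\<dots> = of_real (norm ((poly q w0)\<^sup>2))"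
        using False by (subst complex_norm_square[symmetric]) (simp add: power2_eq_square)
      finally show ?thesis by (simp add: norm_power)
    qed simp
    have "Re (c * (poly q w0)\<^sup>2 - R w0) \<le> 0"
    proof (rule maximum_real_frontier[of "\<lambda>w. c * (poly q w)\<^sup>2 - R w" "ball 0 1"])
      show "(\<lambda>w. c * (poly q w)\<^sup>2 - R w) holomorphic_on interior (ball 0 1)"
        by (intro holomorphic_intros holomorphic_on_subset[OF R(1)]) auto
      show "continuous_on (closure (ball 0 1)) (\<lambda>w. c * (poly q w)\<^sup>2 - R w)"
        by (intro continuous_intros continuous_on_subset[OF holomorphic_on_imp_continuous_on[OF R(1)]]) auto
      show "Re (c * (poly q w)\<^sup>2 - R w) \<le> 0" if "w \<in> frontier (ball 0 1)" for w
      proof -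
        have w: "norm w = 1" using that by (simp add: frontier_ball)
        have "Re (c * (poly q w)\<^sup>2) \<le> norm (c * (poly q w)\<^sup>2)" by (rule complex_Re_le_cmod)
        also have "\<dots> \<le> 1 * (norm (poly q w))\<^sup>2"
          unfolding norm_mult norm_power using c by (intro mult_right_mono) auto
        finally show ?thesis using R(2)[OF w] by simp
      qed
    qed (use w0 in auto)
    thus ?thesis unfolding cw by simp
  qed
  hence maj: "harmonic_majorant (\<lambda>\<zeta>. Re (R (to_disc \<zeta>))) (\<lambda>\<zeta>. norm ((poly q (to_disc \<zeta>))\<^sup>2))"
    using harmonic_on_Re[OF open_uhp Rd] norm_to_disc by (auto simp: harmonic_majorant_def norm_power)
  have "Re (R (to_disc \<zeta>)) \<le> v \<zeta>"
    if v: "harmonic_majorant v (\<lambda>\<zeta>. norm ((poly q (to_disc \<zeta>))\<^sup>2))" and \<zeta>: "\<zeta> \<in> uhp" for v \<zeta>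
  proof (rule field_le_epsilon)
    fix e :: real assume e: "e > 0"
    obtain H where H: "H holomorphic_on uhp" "\<And>\<zeta>. \<zeta> \<in> uhp \<Longrightarrow> Re (H \<zeta>) = v \<zeta>"
      using harmonic_on_imp_Re_holomorphic[OF open_uhp convex_uhp] v
      unfolding harmonic_majorant_def by metis
    let ?\<psi> = "\<lambda>w. \<i> * (1 - w) / (1 + w)"
    define D where "D = (\<lambda>w. Re (R w) - (norm (poly q w))\<^sup>2)"
    have "continuous_on (cball 0 1) D"
      unfolding D_def by (intro continuous_intros continuous_on_subset[OF holomorphic_on_imp_continuous_on[OF R(1)]]) auto
    hence "uniformly_continuous_on (cball 0 1) D" by (intro compact_uniformly_continuous) auto
    then obtain d where d: "d > 0" "\<And>x y. x \<in> cball 0 1 \<Longrightarrow> y \<in> cball 0 1 \<Longrightarrow> dist y x < d \<Longrightarrow> dist (D y) (D x) < e"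
      unfolding uniformly_continuous_on_def using e by meson
    define w0 where "w0 = to_disc \<zeta>"
    have w0: "norm w0 < 1" using norm_to_disc[OF \<zeta>] by (simp add: w0_def)
    \<comment> \<open>A circle that encloses \<open>w0\<close> and on which \<open>Re R - \<bar>q\<bar>\<^sup>2\<close> is at most \<open>e\<close>.\<close>
    define \<rho> where "\<rho> = max ((norm w0 + 1) / 2) (1 - d / 2)"
    have \<rho>: "norm w0 < \<rho>" "\<rho> < 1" "1 - d < \<rho>" using w0 d(1) by (auto simp: \<rho>_def less_max_iff_disj)
    have \<rho>0: "\<rho> > 0" using \<rho>(1) norm_ge_zero[of w0] by linarith
    have near: "D w \<le> e" if w: "norm w = \<rho>" for w
    proof -
      let ?s = "sgn w"
      have w_ne: "w \<noteq> 0" using w \<rho>0 by auto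
      have ns: "norm ?s = 1" using w_ne by (simp add: norm_sgn)
      have "w = of_real \<rho> * ?s" using w \<rho>0 by (auto simp: sgn_eq)
      hence "?s - w = of_real (1 - \<rho>) * ?s" by (simp add: algebra_simps)
      hence "norm (?s - w) = \<bar>1 - \<rho>\<bar>" using ns by (metis mult.right_neutral norm_mult norm_of_real)
      hence "dist (D w) (D ?s) < e" using w ns \<rho> by (intro d(2)) (auto simp: dist_norm norm_minus_commute)
      moreover have "D ?s = 0" using R(2)[OF ns] by (simp add: D_def)
      ultimately show ?thesis by (simp add: dist_real_def)
    qed
    have \<psi>: "?\<psi> w \<in> uhp" if "w \<in> ball 0 1" for w using of_disc_in_uhp that by simp
    have "?\<psi> holomorphic_on ball 0 1"
    proof (intro holomorphic_intros)
      show "1 + w \<noteq> 0" if "w \<in> ball 0 1" for w :: complex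
        using that by (metis add_eq_0_iff mem_ball_0 norm_minus_cancel norm_one less_irrefl)
    qed
    hence "(H \<circ> ?\<psi>) holomorphic_on ball 0 1"
      using H(1) \<psi> by (intro holomorphic_on_compose_gen) auto
    hence f: "(\<lambda>w. R w - H (?\<psi> w)) holomorphic_on ball 0 1"
      by (intro holomorphic_intros holomorphic_on_subset[OF R(1)]) (auto simp: o_def)
    have "Re (R w0 - H (?\<psi> w0)) \<le> e"
    proof (rule maximum_real_frontier[of "\<lambda>w. R w - H (?\<psi> w)" "ball 0 \<rho>"])
      show "(\<lambda>w. R w - H (?\<psi> w)) holomorphic_on interior (ball 0 \<rho>)"
        using \<rho> by (intro holomorphic_on_subset[OF f]) auto
      show "continuous_on (closure (ball 0 \<rho>)) (\<lambda>w. R w - H (?\<psi> w))"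
        using \<rho> \<rho>0 by (intro continuous_on_subset[OF holomorphic_on_imp_continuous_on[OF f]]) auto
      show "Re (R w - H (?\<psi> w)) \<le> e" if "w \<in> frontier (ball 0 \<rho>)" for w
      proof -
        have w: "norm w = \<rho>" using that \<rho>0 by (simp add: frontier_ball)
        have w1: "norm w < 1" using w \<rho> by simp
        note \<psi>w = of_disc_in_uhp[OF w1]
        have "(norm (poly q w))\<^sup>2 \<le> v (?\<psi> w)"
          using v \<psi>w to_disc_of_disc[OF w1] unfolding harmonic_majorant_def by (metis norm_power)
        thus ?thesis using near[OF w] H(2)[OF \<psi>w] by (simp add: D_def)
      qed
    qed (use \<rho> in auto)
    thus "Re (R (to_disc \<zeta>)) \<le> v \<zeta> + e"
      using H(2)[OF \<zeta>] of_disc_to_disc[OF \<zeta>] by (simp add: w0_def)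
  qed
  with maj show ?thesis by (simp add: least_harmonic_majorant_def)
qed

lemma nn_integral_inverse_1_plus_square_finite:
  "(\<integral>\<^sup>+ x. ennreal (1 / (1 + x\<^sup>2)) \<partial>lborel) < \<infinity>"
proof -
  have "integrable lborel (\<lambda>x::real. inverse (1 + x\<^sup>2))"
    using integrable_inverse_1_plus_square by (simp add: set_integrable_def)
  hence "(\<integral>\<^sup>+ x. ennreal (norm (inverse (1 + (x::real)\<^sup>2))) \<partial>lborel) < \<infinity>"
    unfolding integrable_iff_bounded by (rule conjunct2)
  moreover have "norm (inverse (1 + x\<^sup>2)) = 1 / (1 + x\<^sup>2)" for x :: real
    by (simp add: inverse_eq_divide add_nonneg_nonneg)
  ultimately show ?thesis by (simp only:)
qed

text \<open>
  On every horizontal line the function is dominated by a multiple of \<open>1 / (1 + x\<^sup>2)\<close>.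
\<close>

lemma bounded_over_square_in_H1:
  assumes g: "g holomorphic_on uhp" and C: "\<And>\<zeta>. \<zeta> \<in> uhp \<Longrightarrow> norm (g \<zeta>) \<le> C"
  shows "(\<lambda>\<zeta>. g \<zeta> / (\<zeta> + \<i>)\<^sup>2) \<in> H1"
proof -
  have C0: "C \<ge> 0" using order_trans[OF norm_ge_zero C[OF i_in_uhp]] .
  have "(\<lambda>\<zeta>. g \<zeta> / (\<zeta> + \<i>)\<^sup>2) holomorphic_on uhp"
    using i_plus_nonzero by (intro holomorphic_intros g) (auto simp: add.commute)
  moreover have "(SUP y\<in>{0<..}. \<integral>\<^sup>+ x. ennreal (norm (g (Complex x y) / (Complex x y + \<i>)\<^sup>2)) \<partial>lborel)
      \<le> (\<integral>\<^sup>+ x. ennreal C * ennreal (1 / (1 + x\<^sup>2)) \<partial>lborel)"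
  proof (intro SUP_least nn_integral_mono)
    fix y x :: real assume "y \<in> {0<..}"
    hence y: "y > 0" by simp
    have "1 + x\<^sup>2 \<le> (norm (Complex x y + \<i>))\<^sup>2"
      using y unfolding cmod_power2 by (simp add: power2_eq_square algebra_simps)
    moreover have p: "0 < 1 + x\<^sup>2" by (intro add_pos_nonneg) auto
    ultimately have "norm (g (Complex x y)) / (norm (Complex x y + \<i>))\<^sup>2 \<le> C / (1 + x\<^sup>2)"
      using C[of "Complex x y"] y C0 by (intro frac_le) (auto simp: uhp_def)
    hence "norm (g (Complex x y) / (Complex x y + \<i>)\<^sup>2) \<le> C * (1 / (1 + x\<^sup>2))"
      by (simp add: norm_divide norm_power)
    thus "ennreal (norm (g (Complex x y) / (Complex x y + \<i>)\<^sup>2)) \<le> ennreal C * ennreal (1 / (1 + x\<^sup>2))"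
      using C0 p by (subst ennreal_mult[symmetric]) (auto intro: ennreal_leI)
  qed
  moreover have "(\<integral>\<^sup>+ x. ennreal C * ennreal (1 / (1 + x\<^sup>2)) \<partial>lborel) < \<infinity>"
    using nn_integral_inverse_1_plus_square_finite
    by (subst nn_integral_cmult) (auto simp: ennreal_mult_less_top)
  ultimately show ?thesis unfolding H1_def using le_less_trans by blast
qed

lemma blaschke_at_finite:
  "blaschke_at (enat (Suc n)) z j = (\<Prod>k\<in>{..n}-{j}. pseudohyp (z j) (z k))"
proof -
  have "\<forall>\<^sub>F m in sequentially. (\<Prod>k\<in>{k \<in> seq_index (enat (Suc n)). k < m \<and> k \<noteq> j}. norm ((z j - z k) / (z j - cnj (z k))))
      = (\<Prod>k\<in>{..n}-{j}. pseudohyp (z j) (z k))"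
    using eventually_gt_at_top[of n]
  proof eventually_elim
    case (elim m)
    hence "{k \<in> seq_index (enat (Suc n)). k < m \<and> k \<noteq> j} = {..n} - {j}" by (auto simp: seq_index_Suc)
    thus ?case by (simp add: pseudohyp_def)
  qed
  thus ?thesis unfolding blaschke_at_def by (intro limI tendsto_eventually)
qed

lemma blaschke_at_geometric:
  assumes r: "r > 1" and j: "j \<le> n"
  shows "blaschke_at (enat (Suc n)) (\<lambda>j. \<i> * of_real (r ^ j)) j = qprod r j * qprod r (n - j)"
proof -
  have "pseudohyp (\<i> * of_real (r ^ j)) (\<i> * of_real (r ^ k)) = \<bar>r ^ j - r ^ k\<bar> / (r ^ j + r ^ k)" for k
  proof -
    have "\<i> * of_real (r ^ j) - \<i> * of_real (r ^ k) = \<i> * complex_of_real (r ^ j - r ^ k)"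
      "\<i> * of_real (r ^ j) - cnj (\<i> * of_real (r ^ k)) = \<i> * complex_of_real (r ^ j + r ^ k)"
      by (simp_all add: algebra_simps)
    moreover have "r ^ j + r ^ k > 0" using r by (simp add: add_pos_pos)
    ultimately show ?thesis unfolding pseudohyp_def
      by (simp only: norm_divide norm_mult norm_ii norm_of_real abs_of_pos mult_1)
  qed
  thus ?thesis unfolding blaschke_at_finite by (simp only: prod_geometric_pseudohyp[OF r j])
qed

section \<open>The characteristic of a geometric sequence and sharpness\<close>

lemma U_sum_finite_eq:
  assumes \<beta>: "\<And>j. j \<le> n \<Longrightarrow> blaschke_at (enat (Suc n)) z j > 0"
  shows "U_sum (enat (Suc n)) z u k \<zeta> = ereal (\<Sum>j\<in>{j\<in>{..n}. Im (z j) \<le> Im (z k)}.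
    u ((\<zeta> - of_real (Re (z j))) / of_real (Im (z j))) / blaschke_at (enat (Suc n)) z j)"
proof -
  have "U_sum (enat (Suc n)) z u k \<zeta> = (\<Sum>j\<in>{j\<in>{..n}. Im (z j) \<le> Im (z k)}.
      ereal (u ((\<zeta> - of_real (Re (z j))) / of_real (Im (z j)))) / ereal (blaschke_at (enat (Suc n)) z j))"
    unfolding U_sum_def seq_index_Suc by simp
  also have "\<dots> = (\<Sum>j\<in>{j\<in>{..n}. Im (z j) \<le> Im (z k)}.
      ereal (u ((\<zeta> - of_real (Re (z j))) / of_real (Im (z j))) / blaschke_at (enat (Suc n)) z j))"
    using \<beta> by (intro sum.cong) (auto simp: less_imp_neq[symmetric])
  finally show ?thesis by simp
qed

lemma uhp_seq_geometric:
  assumes "r > 1"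
  shows "uhp_seq (enat (Suc n)) (\<lambda>j. \<i> * of_real (r ^ j))"
  unfolding uhp_seq_def
proof (intro conjI)
  show "0 < enat (Suc n)" by (simp add: zero_enat_def)
  show "inj_on (\<lambda>j. \<i> * complex_of_real (r ^ j)) (seq_index (enat (Suc n)))"
    using assms by (auto simp: inj_on_def power_inject_exp simp del: of_real_power)
  show "(\<lambda>j. \<i> * complex_of_real (r ^ j)) ` seq_index (enat (Suc n)) \<subseteq> uhp"
    using assms by (auto simp: uhp_def simp del: of_real_power)
qed

text \<open>
  The admissible function is \<open>g = q\<^sup>2\<close> in the disc variable with \<open>q = (1 + w) q1\<close>, where \<open>q1\<close> is the
  extremal polynomial. As \<open>z_k\<close> in the coordinates of \<open>z_j\<close> is \<open>\<i> r^(k - j)\<close>, every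
  \<open>U_k(z_k)\<close> is bounded by one and the same geometric sum, divided by \<open>L\<^sup>2\<close>.
\<close>

lemma cJ_geometric_le:
  assumes r: "r > 1" and L: "L > 0" "\<And>n. L \<le> qprod r n" and Q: "Q > 2 * pi / exp 1"
  shows "cJ (enat (Suc n)) (\<lambda>j. \<i> * of_real (r ^ j)) \<le> ereal (r * Q / (L\<^sup>2 * ln r))"
proof -
  let ?N = "enat (Suc n)"
  define z where "z = (\<lambda>j. \<i> * complex_of_real (r ^ j))"
  have z: "Re (z j) = 0" "Im (z j) = r ^ j" for j by (simp_all add: z_def del: of_real_power)
  have Q0: "Q \<ge> 0" using Q by (smt (verit) divide_nonneg_pos exp_gt_zero pi_gt_zero)
  obtain q1 :: "complex poly" where q1: "poly q1 0 = 1"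
    "\<And>\<alpha> w. 0 \<le> \<alpha> \<Longrightarrow> \<alpha> \<le> pi \<Longrightarrow> w = cis \<alpha> \<or> w = cis (- \<alpha>) \<Longrightarrow>
      (norm (poly q1 w))\<^sup>2 * (2 * \<alpha> * cos (\<alpha> / 2)) \<le> Q * sin (\<alpha> / 2)"
    using extremal_polynomial[OF Q] by metis
  define q where "q = [:1, 1:] * q1"
  obtain R where R: "R holomorphic_on UNIV" "\<And>w. norm w = 1 \<Longrightarrow> Re (R w) = (norm (poly q w))\<^sup>2"
    using norm_square_poly_eq_Re_on_circle by blast
  define g where "g = (\<lambda>\<zeta>. (poly q (to_disc \<zeta>))\<^sup>2)"
  define u where "u = (\<lambda>\<zeta>. Re (R (to_disc \<zeta>)))"
  have lhm: "least_harmonic_majorant u (\<lambda>\<zeta>. norm (g \<zeta>))"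
    unfolding u_def g_def by (rule least_harmonic_majorant_norm_square_poly[OF R])
  have g_hol: "g holomorphic_on uhp" unfolding g_def by (intro holomorphic_intros holomorphic_to_disc)
  have gi: "g \<i> = 1" by (simp add: g_def to_disc_def q_def q1)
  obtain C where C: "\<And>w. norm w \<le> 1 \<Longrightarrow> norm ((poly q w)\<^sup>2) \<le> C"
  proof -
    have "compact ((\<lambda>w. (poly q w)\<^sup>2) ` cball 0 1)" by (intro compact_continuous_image continuous_intros) auto
    thus ?thesis using that compact_imp_bounded bounded_pos by (metis (no_types, lifting) image_eqI mem_cball_0)
  qed
  have H1: "(\<lambda>\<zeta>. g \<zeta> / (\<zeta> + \<i>)\<^sup>2) \<in> H1"
    using C norm_to_disc by (intro bounded_over_square_in_H1[OF g_hol]) (auto simp: g_def intro: less_imp_le)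
  have \<beta>: "L\<^sup>2 \<le> blaschke_at ?N z j" if "j \<le> n" for j
    unfolding z_def blaschke_at_geometric[OF r that] power2_eq_square using L
    by (intro mult_mono) (auto intro: order_trans[OF less_imp_le])
  have \<beta>0: "blaschke_at ?N z j > 0" if "j \<le> n" for j
    using \<beta>[OF that] L(1) by (smt (verit) zero_less_power)
  have U: "U_sum ?N z u k \<zeta> = ereal (\<Sum>j\<in>{j\<in>{..n}. r ^ j \<le> r ^ k}.
      u (\<zeta> / of_real (r ^ j)) / blaschke_at ?N z j)" for k \<zeta>
    using U_sum_finite_eq[of n z u k \<zeta>] \<beta>0 by (simp add: z)
  have harm: "harmonic_on (\<lambda>\<zeta>. real_of_ereal (U_sum ?N z u k \<zeta>)) uhp" for k
  proof -
    have U_Re: "(\<lambda>\<zeta>. real_of_ereal (U_sum ?N z u k \<zeta>)) = (\<lambda>\<zeta>. Re (\<Sum>j\<in>{j\<in>{..n}. r ^ j \<le> r ^ k}.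
        R (to_disc (\<zeta> / of_real (r ^ j))) / of_real (blaschke_at ?N z j)))"
      unfolding U unfolding u_def by (simp add: fun_eq_iff)
    have "(\<lambda>\<zeta>. (\<Sum>j\<in>{j\<in>{..n}. r ^ j \<le> r ^ k}.
        R (to_disc (\<zeta> / of_real (r ^ j))) / of_real (blaschke_at ?N z j))) holomorphic_on uhp"
    proof (intro holomorphic_intros)
      fix j assume j: "j \<in> {j\<in>{..n}. r ^ j \<le> r ^ k}"
      have "(\<lambda>\<zeta>. \<zeta> / complex_of_real (r ^ j)) holomorphic_on uhp" using r by (intro holomorphic_intros) auto
      moreover have "\<zeta> / complex_of_real (r ^ j) \<in> uhp" if "\<zeta> \<in> uhp" for \<zeta>
        using that r by (simp add: uhp_def del: of_real_power)
      ultimately have "(to_disc \<circ> (\<lambda>\<zeta>. \<zeta> / complex_of_real (r ^ j))) holomorphic_on uhp"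
        by (intro holomorphic_on_compose_gen[OF _ holomorphic_to_disc]) auto
      hence "(R \<circ> (to_disc \<circ> (\<lambda>\<zeta>. \<zeta> / complex_of_real (r ^ j)))) holomorphic_on uhp"
        by (rule holomorphic_on_compose_gen[OF _ R(1)]) auto
      thus "(\<lambda>\<zeta>. R (to_disc (\<zeta> / complex_of_real (r ^ j)))) holomorphic_on uhp" by (simp add: o_def)
      show "complex_of_real (blaschke_at ?N z j) \<noteq> 0" using \<beta>0[of j] j by auto
    qed
    from harmonic_on_Re[OF open_uhp this] show ?thesis unfolding U_Re .
  qed
  have adm: "admissible ?N z g u"
    unfolding admissible_def using g_hol gi H1 lhm harm by (simp add: U)
  have "U_sum ?N z u k (z k) \<le> ereal (r * Q / (L\<^sup>2 * ln r))" if k: "k \<le> n" for k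
  proof -
    have uu: "u (z k / of_real (r ^ j)) = Re (R (of_real ((1 - r ^ (k - j)) / (1 + r ^ (k - j)))))"
      if "j \<le> k" for j
    proof -
      have "r ^ k = r ^ (k - j) * r ^ j" using that by (simp flip: power_add)
      hence "z k / of_real (r ^ j) = \<i> * of_real (r ^ (k - j))"
        using r by (simp add: z_def del: of_real_power)
      thus ?thesis using r by (simp add: u_def to_disc_imaginary_axis del: of_real_power)
    qed
    have u0: "u \<zeta> \<ge> 0" if "\<zeta> \<in> uhp" for \<zeta>
      using lhm that order_trans[OF norm_ge_zero] unfolding least_harmonic_majorant_def harmonic_majorant_def by blast
    have zu: "z k / of_real (r ^ j) \<in> uhp" for j using r by (simp add: uhp_def z del: of_real_power)
    have set: "{j \<in> {..n}. r ^ j \<le> r ^ k} = {..k}" using r k by (auto simp: power_increasing_iff)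
    have "(\<Sum>j\<in>{..k}. u (z k / of_real (r ^ j)) / blaschke_at ?N z j) \<le> (\<Sum>j\<in>{..k}. u (z k / of_real (r ^ j)) / L\<^sup>2)"
      using \<beta> \<beta>0 k L(1) u0[OF zu] by (intro sum_mono divide_left_mono mult_pos_pos) auto
    also have "\<dots> = (\<Sum>j\<in>{..k}. u (z k / of_real (r ^ j))) / L\<^sup>2" by (simp add: sum_divide_distrib)
    also have "(\<Sum>j\<in>{..k}. u (z k / of_real (r ^ j))) = (\<Sum>l<Suc k. Re (R (of_real ((1 - r ^ l) / (1 + r ^ l)))))"
      by (rule sum.reindex_bij_witness[of _ "\<lambda>l. k - l" "\<lambda>j. k - j"]) (auto simp: uu simp del: of_real_power)
    also have "\<dots> \<le> r * Q / ln r"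
      using sum_harmonic_geometric_le[OF q_def q1(2) R r Q0, of "Suc k"] r
      by (simp only: pos_le_divide_eq ln_gt_zero mult.commute)
    also have "r * Q / ln r / L\<^sup>2 = r * Q / (L\<^sup>2 * ln r)" by simp
    finally show ?thesis unfolding U set using L(1) by (simp add: divide_right_mono)
  qed
  hence "cJ_of ?N z u \<le> ereal (r * Q / (L\<^sup>2 * ln r))"
    unfolding cJ_of_def seq_index_Suc by (intro SUP_least) auto
  moreover have "cJ ?N z \<le> cJ_of ?N z u" unfolding cJ_def using adm by (intro Inf_lower) auto
  ultimately show ?thesis unfolding z_def by (rule order_trans[rotated])
qed

text \<open>
  The ends of the sequence are negligible as \<open>n\<close> grows.
\<close>

lemma geometric_lower_bound_limit:
  assumes r: "(r::real) > 1"
  shows "(\<lambda>n. real (n - 2 * b + 1) * K / (2 + n * ln r / (pi * sqrt (1 - (1 / r) ^ n)))) \<longlonglongrightarrow> K * pi / ln r"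
proof -
  have "(\<lambda>n. (1 + (1 - 2 * real b) * (1 / real n)) * K / (2 * (1 / real n) + ln r / (pi * sqrt (1 - (1 / r) ^ n))))
      \<longlonglongrightarrow> (1 + (1 - 2 * real b) * 0) * K / (2 * 0 + ln r / (pi * sqrt (1 - 0)))"
    using r by (intro tendsto_intros lim_1_over_n LIMSEQ_power_zero) auto
  also have "(1 + (1 - 2 * real b) * 0) * K / (2 * 0 + ln r / (pi * sqrt (1 - 0))) = K * pi / ln r" by simp
  finally have *: "(\<lambda>n. (1 + (1 - 2 * real b) * (1 / real n)) * K / (2 * (1 / real n) + ln r / (pi * sqrt (1 - (1 / r) ^ n))))
      \<longlonglongrightarrow> K * pi / ln r" .
  show ?thesis
  proof (rule Lim_transform_eventually[OF *])
    show "\<forall>\<^sub>F n in sequentially. (1 + (1 - 2 * real b) * (1 / real n)) * K / (2 * (1 / real n) + ln r / (pi * sqrt (1 - (1 / r) ^ n)))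
        = real (n - 2 * b + 1) * K / (2 + n * ln r / (pi * sqrt (1 - (1 / r) ^ n)))"
      using eventually_ge_at_top[of "Suc (2 * b)"]
    proof eventually_elim
      case (elim n)
      hence n: "real n > 0" "real (n - 2 * b + 1) = real n - 2 * real b + 1" by (auto simp: of_nat_diff)
      define s where "s = pi * sqrt (1 - (1 / r) ^ n)"
      have "(1 + (1 - 2 * real b) * (1 / real n)) * K / (2 * (1 / real n) + ln r / s)
        = (real n * ((1 + (1 - 2 * real b) * (1 / real n)) * K)) / (real n * (2 * (1 / real n) + ln r / s))"
        using n(1) by simp
      also have "real n * ((1 + (1 - 2 * real b) * (1 / real n)) * K) = real (n - 2 * b + 1) * K"
        unfolding n(2) using n(1) by (simp add: field_simps)
      also have "real n * (2 * (1 / real n) + ln r / s) = 2 + n * ln r / s"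
        using n(1) by (simp add: field_simps)
      finally show ?case unfolding s_def by simp
    qed
  qed
qed

text \<open>
  The quotient of the lower bound \<open>2 \<pi> / (L\<^sup>2 ln r)\<close> and the upper bound \<open>r Q / (L\<^sup>2 ln r)\<close> exceeds
  \<open>C\<close> once \<open>Q\<close> is close to \<open>2 \<pi> / e\<close> and \<open>r\<close> is close to 1. Then \<open>b\<close> and \<open>n\<close> are chosen, in this order,
  to approach the lower bound for the fixed \<open>r\<close>.
\<close>

lemma interpolation_bound_sharp:
  assumes C: "1 \<le> C" "C < exp 1"
  obtains N z where "uhp_seq N z" "ereal C * cJ N z < interp_const N z"
proof -
  have "2 * pi / exp 1 < 2 * pi / C" using C by (intro divide_strict_left_mono) auto
  then obtain Q where Q: "2 * pi / exp 1 < Q" "Q < 2 * pi / C" using dense by blast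
  have Q0: "Q > 0" using Q(1) by (smt (verit) divide_nonneg_pos exp_gt_zero pi_gt_zero)
  have "1 < 2 * pi / (Q * C)" using Q C Q0 by (simp add: field_simps)
  then obtain r where r: "1 < r" "r < 2 * pi / (Q * C)" using dense by blast
  have rQ: "C * (r * Q) < 2 * pi" using r(2) Q0 C by (simp add: field_simps)
  obtain L where L: "L > 0" "qprod r \<longlonglongrightarrow> L" "\<And>n. L \<le> qprod r n" using qprod_limit[OF r(1)] by blast
  have lr: "ln r > 0" using r by simp
  define B where "B = C * (r * Q / (L\<^sup>2 * ln r))"
  have "(\<lambda>b. 2 / (1 + (1 / r) ^ b)\<^sup>2 / (qprod r b)\<^sup>2 * pi / ln r) \<longlonglongrightarrow> 2 / (1 + 0)\<^sup>2 / L\<^sup>2 * pi / ln r"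
    using r lr L(1) by (intro tendsto_intros LIMSEQ_power_zero L(2)) auto
  moreover have "B < 2 / (1 + 0)\<^sup>2 / L\<^sup>2 * pi / ln r"
  proof -
    have "C * (r * Q) / (L\<^sup>2 * ln r) < 2 * pi / (L\<^sup>2 * ln r)"
      using rQ L(1) lr by (intro divide_strict_right_mono) auto
    thus ?thesis by (simp add: B_def)
  qed
  ultimately have "\<forall>\<^sub>F b in sequentially. B < 2 / (1 + (1 / r) ^ b)\<^sup>2 / (qprod r b)\<^sup>2 * pi / ln r"
    by (rule order_tendstoD)
  then obtain b where b: "B < 2 / (1 + (1 / r) ^ b)\<^sup>2 / (qprod r b)\<^sup>2 * pi / ln r"
    by (auto simp: eventually_sequentially)
  have "\<forall>\<^sub>F n in sequentially. B < (n - 2 * b + 1) * (2 / (1 + (1 / r) ^ b)\<^sup>2 / (qprod r b)\<^sup>2)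
      / (2 + n * ln r / (pi * sqrt (1 - (1 / r) ^ n)))"
    by (rule order_tendstoD(1)[OF geometric_lower_bound_limit[OF r(1)] b])
  moreover have "\<forall>\<^sub>F n in sequentially. 2 < r ^ n"
  proof -
    obtain m where m: "2 < r ^ m" using real_arch_pow[OF r(1)] by blast
    have "2 < r ^ n" if "m \<le> n" for n using m power_increasing[OF that less_imp_le[OF r(1)]] by linarith
    thus ?thesis unfolding eventually_sequentially by blast
  qed
  moreover have "\<forall>\<^sub>F n in sequentially. 2 * b \<le> n" by (rule eventually_ge_at_top)
  ultimately have "\<forall>\<^sub>F n in sequentially. B < (n - 2 * b + 1) * (2 / (1 + (1 / r) ^ b)\<^sup>2 / (qprod r b)\<^sup>2)
      / (2 + n * ln r / (pi * sqrt (1 - (1 / r) ^ n))) \<and> 2 < r ^ n \<and> 2 * b \<le> n"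
    by (intro eventually_conj)
  then obtain n where n: "B < (n - 2 * b + 1) * (2 / (1 + (1 / r) ^ b)\<^sup>2 / (qprod r b)\<^sup>2)
      / (2 + n * ln r / (pi * sqrt (1 - (1 / r) ^ n)))" "2 < r ^ n" "2 * b \<le> n"
    unfolding eventually_sequentially by blast
  let ?N = "enat (Suc n)" and ?z = "\<lambda>j. \<i> * complex_of_real (r ^ j)"
  have "ereal C * cJ ?N ?z \<le> ereal C * ereal (r * Q / (L\<^sup>2 * ln r))"
    using C by (intro ereal_mult_left_mono cJ_geometric_le[OF r(1) L(1,3) Q(1)]) auto
  also have "\<dots> = ereal B" by (simp add: B_def)
  also have "\<dots> < ereal ((n - 2 * b + 1) * (2 / (1 + (1 / r) ^ b)\<^sup>2 / (qprod r b)\<^sup>2)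
      / (2 + n * ln r / (pi * sqrt (1 - (1 / r) ^ n))))"
    using n(1) by simp
  also have "\<dots> \<le> interp_const ?N ?z" by (rule interp_const_geometric_ge[OF r(1) n(2,3)])
  finally show ?thesis by (rule that[OF uhp_seq_geometric[OF r(1)]])
qed

lemma one_le_cJ:
  assumes "uhp_seq N z"
  shows "1 \<le> cJ N z"
  unfolding cJ_def using one_le_cJ_of[OF assms] by (intro Inf_greatest) auto

theorem theorem1:
  shows "(\<forall>N z. uhp_seq N z \<longrightarrow> interp_const N z \<le> ereal (exp 1) * cJ N z) \<and>
         (\<forall>C::real. C < exp 1 \<longrightarrow>
            (\<exists>N z. uhp_seq N z \<and> interp_const N z > ereal C * cJ N z))"
proof (intro conjI allI impI)
  show "interp_const N z \<le> ereal (exp 1) * cJ N z" if "uhp_seq N z" for N z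
    using that by (rule interp_const_le_cJ)
next
  fix C :: real assume "C < exp 1"
  hence "1 \<le> max C 1" "max C 1 < exp 1" by auto
  then obtain N z where Nz: "uhp_seq N z" "ereal (max C 1) * cJ N z < interp_const N z"
    by (rule interpolation_bound_sharp)
  have "0 \<le> cJ N z" using order_trans[OF _ one_le_cJ[OF Nz(1)], of 0] by simp
  hence "ereal C * cJ N z \<le> ereal (max C 1) * cJ N z" by (intro ereal_mult_right_mono) auto
  with Nz show "\<exists>N z. uhp_seq N z \<and> interp_const N z > ereal C * cJ N z"
    by (meson le_less_trans)
qed

end
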